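(* The 0-cycle of limit Weierstrass points on the fiber over $s=0$ of the family of plane quartics $G(X,Y,Z)-sX^4=0$ over $\mathbb{C}$ is $$\begin{aligned} & 6(1:1:1) + 3\sum_{j=1}^3 (-\gamma_j-1:\gamma_j:1) + 2(0:-1:1)+(0:0:1)\\ &+(\alpha-\beta-1:\beta:1) + (\bar{\alpha}-\bar{\beta}-1:\bar{\beta}:1)\\ &+(-\xi -1:\xi:1) + (-\bar{\xi}-1:\bar{\xi}:1) + (-\mu -1:\mu:1) +(-\bar{\mu}-1:\bar{\mu}:1). \end{aligned}$$ This is also the 0-cycle of limit Weierstrass points on the fiber over $t=\infty$ of the family $F(X,Y,Z,t)=0$, $t\in\mathbb{P}^1$.
   Context: Work over $\mathbb{C}$, with homogeneous coordinates $(X:Y:Z)$ on $\mathbb{P}^2$. Put $$\begin{aligned}G(X,Y,Z)=\;&X^4 -3X^3Y +6X^3Z -3X^2Y^2 -6X^2YZ +6X^2Z^2 +4XY^3\\&-6XY^2Z -6XYZ^2 +XZ^3 +3Y^4 +3Y^3Z,\end{aligned}$$ $$F(X,Y,Z,t)=X^4+t\,G(X,Y,Z).$$ The family $F=0$ is considered over $t\in\mathbb{P}^1$. Near $t=\infty$ one substitutes $t=-1/s$, so the family becomes $G(X,Y,Z)-sX^4=0$ with the fiber over $t=\infty$ being the fiber over $s=0$, namely the reducible curve $G=0$. Limit Weierstrass points: for a plane quartic that is a smooth fiber, the Weierstrass points (with weights) are the flexes counted with multiplicity, i.e. the degree-24 intersection cycle of the curve with its Hessian curve. The 0-cycle of limit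 Weierstrass points on the fiber over $s=0$ is the limit as $s\to 0$ of these 0-cycles of flexes on nearby smooth fibers, that is, the 0-cycle in $\mathbb{P}^2$ of the fiber over $s=0$ of the closure (flat limit) of the relative scheme of flexes over a punctured neighborhood of $s=0$. The numbers in the formula are as follows. - $\gamma_1,\gamma_2,\gamma_3$ are the three roots of $Y^3-3Y-1=0$ (approximately $-1.532,-0.347,1.879$). - Let $\widehat{G}(X,Y,Z)=X^3 -7X^2Y +2X^2Z+12XY^2 -3XYZ-6XZ^2-3Y^3 + 9YZ^2 +3Z^3$, so that $G(X-Y-Z,Y,Z)=X\,\widehat{G}(X,Y,Z)$. The curve $\widehat G=0$ is an irreducible nodal cubic with node $(3:1:1)$. The points $(\alpha:\beta:1)$ and $(\bar\alpha:\bar\beta:1)$ are its two flexes (at smooth points) other than $(1:0:1)$, with $\alpha\approx 1.643+0.124i$, $\beta\approx 0.429+0.083i$. - $\xi,\bar\xi,\mu,\bar\mu$ are the four roots of $3Y^4+11Y^3+12Y^2+3Y+1=0$, with $\xi\approx -1.734+0.446i$ and $\mu\approx -0.100+0.307i$. Bars denote complex conjugation. *)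

theory Defs
  imports
    "HOL-Analysis.Analysis"
    "HOL-Computational_Algebra.Computational_Algebra"
    "HOL-Library.FuncSet"
    "HOL-Library.Poly_Mapping"
begin

section \<open>Ternary polynomials\<close>

text \<open>Polynomials in \<open>X\<close>, \<open>Y\<close>, \<open>Z\<close> over \<open>'a\<close>, nested as \<open>'a[X][Y][Z]\<close>: the coefficient of
  \<open>X\<^sup>i Y\<^sup>j Z\<^sup>k\<close> in \<open>f\<close> is \<open>coeff (coeff (coeff f k) j) i\<close>.\<close>

type_synonym 'a poly3 = "'a poly poly poly"

definition const3 :: "'a::zero \<Rightarrow> 'a poly3" where
  "const3 c = [:[:[:c:]:]:]"

definition varX :: "'a::comm_ring_1 poly3" where "varX = [:[:[:0, 1:]:]:]"
definition varY :: "'a::comm_ring_1 poly3" where "varY = [:[:0, 1:]:]"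
definition varZ :: "'a::comm_ring_1 poly3" where "varZ = [:0, 1:]"

definition homogeneous :: "nat \<Rightarrow> 'a::zero poly3 \<Rightarrow> bool" where
  "homogeneous d f \<longleftrightarrow>
     (\<forall>i j k. coeff (coeff (coeff f k) j) i \<noteq> 0 \<longrightarrow> i + j + k = d)"

definition map_coeffs :: "('a::zero \<Rightarrow> 'b::zero) \<Rightarrow> 'a poly3 \<Rightarrow> 'b poly3" where
  "map_coeffs h = map_poly (map_poly (map_poly h))"

definition eval3 :: "'a::comm_ring_1 poly3 \<Rightarrow> 'a^3 \<Rightarrow> 'a" where
  "eval3 f v = poly (poly (poly f [:[:v$3:]:]) [:v$2:]) (v$1)"

definition grad :: "'a::idom poly3 \<Rightarrow> 'a poly3^3" where
  "grad f = vector [map_poly (map_poly pderiv) f, map_poly pderiv f, pderiv f]"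

definition hessian :: "'a::idom poly3 \<Rightarrow> 'a poly3" where
  "hessian f = det (\<chi> i. grad (grad f $ i))"


section \<open>The projective plane and plane curves\<close>

quotient_type proj2 = "complex^3" /
  partial: "\<lambda>v w. v \<noteq> 0 \<and> (\<exists>c. c \<noteq> 0 \<and> w = c *s v)"
proof (rule part_equivpI)
  show "\<exists>v::complex^3. v \<noteq> 0 \<and> (\<exists>c. c \<noteq> 0 \<and> v = c *s v)"
    by (rule exI[of _ "axis 1 1"]) (auto simp: axis_eq_0_iff intro!: exI[of _ 1])
  show "symp (\<lambda>v w::complex^3. v \<noteq> 0 \<and> (\<exists>c. c \<noteq> 0 \<and> w = c *s v))"
  proof (rule sympI, clarify)
    fix v :: "complex^3" and c :: complex
    assume "v \<noteq> 0" "c \<noteq> 0"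
    then show "c *s v \<noteq> 0 \<and> (\<exists>d. d \<noteq> 0 \<and> v = d *s (c *s v))"
      by (auto simp: vector_smult_assoc intro!: exI[of _ "inverse c"])
  qed
  show "transp (\<lambda>v w::complex^3. v \<noteq> 0 \<and> (\<exists>c. c \<noteq> 0 \<and> w = c *s v))"
  proof (rule transpI, clarify)
    fix v :: "complex^3" and c d :: complex
    assume "c \<noteq> 0" "d \<noteq> 0"
    then show "\<exists>e. e \<noteq> 0 \<and> d *s (c *s v) = e *s v"
      by (intro exI[of _ "d * c"]) (simp add: vector_smult_assoc)
  qed
qed

text \<open>The point \<open>(x : y : z)\<close>; unspecified if \<open>x = y = z = 0\<close>.\<close>

definition pt :: "complex \<Rightarrow> complex \<Rightarrow> complex \<Rightarrow> proj2" where
  "pt x y z = abs_proj2 (vector [x, y, z])"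

text \<open>For homogeneous \<open>f\<close> this does not depend on the representative of \<open>p\<close>.\<close>

definition vanishes_at :: "complex poly3 \<Rightarrow> proj2 \<Rightarrow> bool" where
  "vanishes_at f p \<longleftrightarrow> eval3 f (rep_proj2 p) = 0"

definition singular_at :: "complex poly3 \<Rightarrow> proj2 \<Rightarrow> bool" where
  "singular_at f p \<longleftrightarrow> vanishes_at f p \<and> (\<forall>i. vanishes_at (grad f $ i) p)"

definition smooth_flex :: "complex poly3 \<Rightarrow> proj2 \<Rightarrow> bool" where
  "smooth_flex f p \<longleftrightarrow>
     vanishes_at f p \<and> \<not> singular_at f p \<and> vanishes_at (hessian f) p"


section \<open>Limit Weierstrass points of one-parameter families of plane quartics\<close>

text \<open>A family is a ternary polynomial \<open>F\<close> over \<open>\<complex>[s]\<close>, that is, of type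
  \<open>complex poly poly3\<close>; its fiber at a parameter value is obtained by evaluating the coefficients.\<close>

definition fiber :: "complex poly poly3 \<Rightarrow> complex \<Rightarrow> complex poly3" where
  "fiber F s = map_coeffs (\<lambda>c. poly c s) F"

text \<open>The function field of \<open>\<complex>\<^sup>3 \<times> \<complex>\<close> with coordinates \<open>X\<close>, \<open>Y\<close>, \<open>Z\<close>, \<open>s\<close>. All local
  rings of \<open>\<^bold>P\<^sup>2 \<times> \<complex>\<close> lie in it as rings of fractions of degree 0 in \<open>X\<close>, \<open>Y\<close>, \<open>Z\<close>.\<close>

type_synonym funfield = "complex poly poly3 fract"

definition param :: funfield where
  "param = Fraction_Field.Fract (const3 [:0, 1:]) 1"

definition scale :: "complex \<Rightarrow> funfield \<Rightarrow> funfield" where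
  "scale c f = Fraction_Field.Fract (const3 [:c:]) 1 * f"

text \<open>The local ring of \<open>\<^bold>P\<^sup>2 \<times> \<complex>\<close> at \<open>(p, 0)\<close>, where \<open>0\<close> is the parameter value \<open>s = 0\<close>.\<close>

definition local_ring :: "proj2 \<Rightarrow> funfield set" where
  "local_ring p = {Fraction_Field.Fract a b |a b d.
     homogeneous d a \<and> homogeneous d b \<and> \<not> vanishes_at (fiber b 0) p}"

text \<open>The stalk at \<open>(p, 0)\<close> of the ideal sheaf of the relative scheme of flexes
  \<open>F = hessian F = 0\<close>.\<close>

definition flex_ideal :: "complex poly poly3 \<Rightarrow> proj2 \<Rightarrow> funfield set" where
  "flex_ideal F p = {Fraction_Field.Fract a b |a b d.
     homogeneous d a \<and> homogeneous d b \<and> \<not> vanishes_at (fiber b 0) p \<and>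
     (\<exists>u v. a = u * F + v * hessian F)}"

text \<open>The stalk at \<open>(p, 0)\<close> of the ideal sheaf of the scheme-theoretic closure of the part of the
  scheme of flexes lying over \<open>s \<noteq> 0\<close>: a local function vanishes on this closure iff its
  restriction to \<open>s \<noteq> 0\<close> vanishes on the scheme of flexes.\<close>

definition closure_ideal :: "complex poly poly3 \<Rightarrow> proj2 \<Rightarrow> funfield set" where
  "closure_ideal F p = {f \<in> local_ring p. \<exists>k::nat. param ^ k * f \<in> flex_ideal F p}"

text \<open>The ideal, in the same local ring, of the fiber of that closure over \<open>s = 0\<close>.\<close>

definition limit_ideal :: "complex poly poly3 \<Rightarrow> proj2 \<Rightarrow> funfield set" where
  "limit_ideal F p = {f + param * g |f g. f \<in> closure_ideal F p \<and> g \<in> local_ring p}"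

text \<open>\<open>V / U\<close> has dimension \<open>n\<close> over \<open>\<complex>\<close>: there are \<open>b 0, \<dots>, b (n - 1)\<close> in \<open>V\<close> whose classes
  form a basis of \<open>V / U\<close>.\<close>

definition has_quotient_dim :: "funfield set \<Rightarrow> funfield set \<Rightarrow> nat \<Rightarrow> bool" where
  "has_quotient_dim V U n \<longleftrightarrow> (\<exists>b. b ` {..<n} \<subseteq> V \<and>
     (\<forall>f\<in>V. \<exists>!c. c \<in> {..<n} \<rightarrow>\<^sub>E UNIV \<and> f - (\<Sum>i<n. scale (c i) (b i)) \<in> U))"

text \<open>0-cycles on \<open>\<^bold>P\<^sup>2\<close> are elements of the free abelian group \<open>proj2 \<Rightarrow>\<^sub>0 int\<close> on its points. The
  multiplicity at \<open>p\<close> in the 0-cycle of limit Weierstrass points over \<open>s = 0\<close> is the length at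
  \<open>p\<close> of the fiber over \<open>s = 0\<close> of the closure of the scheme of flexes (length equals complex
  dimension, as the residue field is \<open>\<complex>\<close>). The fibers over a punctured neighbourhood of \<open>s = 0\<close>
  have to be smooth quartics, so that their Weierstrass points are their flexes.\<close>

definition limit_weierstrass_cycle :: "complex poly poly3 \<Rightarrow> (proj2 \<Rightarrow>\<^sub>0 int) \<Rightarrow> bool" where
  "limit_weierstrass_cycle F W \<longleftrightarrow>
     homogeneous 4 F \<and>
     (\<forall>\<^sub>F s in at 0. \<forall>p. \<not> singular_at (fiber F s) p) \<and>
     (\<forall>p. \<exists>n. has_quotient_dim (local_ring p) (limit_ideal F p) n \<and>
              Poly_Mapping.lookup W p = int n)"

text \<open>A family \<open>F\<close> of degree \<open>d\<close> in its parameter \<open>t\<close> extends over \<open>\<^bold>P\<^sup>1\<close>. In the coordinate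
  \<open>s\<close> around \<open>t = \<infinity>\<close> with \<open>t = -1/s\<close> it is given by \<open>(-s)\<^sup>d F(X, Y, Z, -1/s)\<close>, which is
  a polynomial in \<open>s\<close>; the fiber over \<open>t = \<infinity>\<close> is the one over \<open>s = 0\<close>.\<close>

definition param_degree :: "complex poly poly3 \<Rightarrow> nat" where
  "param_degree F = (LEAST d. \<forall>i j k. degree (coeff (coeff (coeff F k) j) i) \<le> d)"

definition chart_at_infinity :: "complex poly poly3 \<Rightarrow> complex poly poly3" where
  "chart_at_infinity F =
     (let d = param_degree F
      in map_coeffs (\<lambda>c. \<Sum>i\<le>d. smult (coeff c i) ([:0, -1:] ^ (d - i))) F)"

definition limit_weierstrass_cycle_at_infinity ::
    "complex poly poly3 \<Rightarrow> (proj2 \<Rightarrow>\<^sub>0 int) \<Rightarrow> bool" where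
  "limit_weierstrass_cycle_at_infinity F W \<longleftrightarrow>
     limit_weierstrass_cycle (chart_at_infinity F) W"


section \<open>The family\<close>

definition G :: "'a::comm_ring_1 poly3" where
  "G = (let X = varX; Y = varY; Z = varZ in
     X^4 - 3*X^3*Y + 6*X^3*Z - 3*X^2*Y^2 - 6*X^2*Y*Z + 6*X^2*Z^2 + 4*X*Y^3
     - 6*X*Y^2*Z - 6*X*Y*Z^2 + X*Z^3 + 3*Y^4 + 3*Y^3*Z)"

definition G_hat :: "complex poly3" where
  "G_hat = (let X = varX; Y = varY; Z = varZ in
     X^3 - 7*X^2*Y + 2*X^2*Z + 12*X*Y^2 - 3*X*Y*Z - 6*X*Z^2 - 3*Y^3 + 9*Y*Z^2 + 3*Z^3)"

definition F_family :: "complex poly poly3" where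
  "F_family = varX^4 + const3 [:0, 1:] * G"

definition G_family :: "complex poly poly3" where
  "G_family = G - const3 [:0, 1:] * varX^4"

end

theory Submission
  imports Defs
begin

text \<open>Write \<open>G = L C\<close> with a line \<open>L\<close> and a nodal cubic \<open>C\<close>, put \<open>F = G - s X\<^sup>4\<close>, and let \<open>L K\<close> be the
  Hessian of \<open>G\<close> and \<open>M = G\<^bsub>YY\<^esub> G\<^bsub>ZZ\<^esub> - G\<^bsub>YZ\<^esub>\<^sup>2\<close>. Then \<open>H = L K - 12 s X\<^sup>2 M\<close> is the Hessian of \<open>F\<close>,
  and \<open>C H - K F = s X\<^sup>2 N\<close> with \<open>N = X\<^sup>2 K - 12 M C\<close>. Since \<open>L\<close> divides neither \<open>X\<close> nor \<open>N\<close>, and \<open>C\<close> is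
  coprime to \<open>K\<close>, the parameter \<open>s\<close> is a nonzerodivisor modulo \<open>(F, H, X\<^sup>2 N)\<close>. This ideal
  therefore defines the closure of the scheme of flexes, and its fiber over \<open>s = 0\<close> is defined by
  \<open>(L C, L K, X\<^sup>2 N)\<close>.

  The local lengths of the latter follow from two congruences: modulo \<open>C\<close>, \<open>4 K\<close> is
  \<open>9 L\<^sup>2\<close> times the Hessian of \<open>C\<close>, and modulo \<open>L\<close>, \<open>N\<close> is
  \<open>- 1458 (Y\<^sup>3 - 3 Y Z\<^sup>2 - Z\<^sup>3) (3 Y\<^sup>4 + 11 Y\<^sup>3 Z + 12 Y\<^sup>2 Z\<^sup>2 + 3 Y Z\<^sup>3 + Z\<^sup>4)\<close>. Away from \<open>L\<close> the limit ideal is thus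
  generated by \<open>C\<close> and its Hessian, that is, by \<open>x y z\<close> and \<open>x\<^sup>3 - y\<^sup>3\<close>, where \<open>x\<close>, \<open>y\<close> are the tangents at the
  node and \<open>z\<close> is the line through the flexes.\<close>

section \<open>Ternary polynomials\<close>

text \<open>Over \<open>s = 0\<close> both equations of the scheme of flexes acquire the factor
  \<open>L\<close>, so the naive fiber contains a whole line and no length can be read off;
  \<open>X^2 N\<close> is what cuts this line down to points. On \<open>L\<close> it leaves
  \<open>X = 0\<close> counted twice and the seven zeros of \<open>N\<close>. Three of these lie on
  \<open>C\<close>, because \<open>4 K\<close> is a multiple of \<open>C\<close> on
  \<open>L\<close>; there line and cubic both contribute and the length is 3 instead of 1. The
  lengths add up to 6 + 9 + 2 + 1 + 2 + 4 = 24. Every point of the plane gets its own local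
  computation, including those of length 0, since the definition asks for each stalk. Upper bounds
  on a length come from dividing generators of the limit ideal by units; lower bounds come from
  clearing denominators, setting \<open>s = 0\<close> and evaluating at the point. Wherever the
  length is positive, the quotient is generated by one element and powers of it form a basis, except
  at the node of \<open>C\<close>: two tangent directions survive there and six elements have to be
  treated by hand.\<close>

abbreviation coeff3 :: "'a::zero poly3 \<Rightarrow> nat \<Rightarrow> nat \<Rightarrow> nat \<Rightarrow> 'a" where
  "coeff3 f i j k \<equiv> coeff (coeff (coeff f k) j) i"

lemma poly3_eqI: "(\<And>i j k. coeff3 f i j k = coeff3 g i j k) \<Longrightarrow> f = g"
  by (intro poly_eqI)

lemma map_poly_hom_add:
  assumes "h 0 = 0" "\<And>a b. h (a + b) = h a + h b"
  shows "map_poly h (p + q) = map_poly h p + map_poly h q"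
  using assms by (intro poly_eqI) (simp add: coeff_map_poly)

lemma hom_sum:
  assumes "h 0 = 0" "\<And>a b. h (a + b) = h a + h b"
  shows "h (sum f A) = (\<Sum>x\<in>A. h (f x))"
  using assms by (induction A rule: infinite_finite_induct) auto

lemma map_poly_hom_mult:
  fixes h :: "'a::comm_semiring_0 \<Rightarrow> 'b::comm_semiring_0"
  assumes "h 0 = 0" "\<And>a b. h (a + b) = h a + h b" "\<And>a b. h (a * b) = h a * h b"
  shows "map_poly h (p * q) = map_poly h p * map_poly h q"
  using assms by (intro poly_eqI) (simp add: coeff_map_poly coeff_mult hom_sum[of h])

lemma coeff3_map_coeffs: "h 0 = 0 \<Longrightarrow> coeff3 (map_coeffs h f) i j k = h (coeff3 f i j k)"
  by (simp add: map_coeffs_def coeff_map_poly)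

lemma map_coeffs_add:
  assumes "h 0 = 0" "\<And>a b. h (a + b) = h a + h b"
  shows "map_coeffs h (f + g) = map_coeffs h f + map_coeffs h g"
  using assms by (intro poly3_eqI) (simp add: coeff3_map_coeffs)

lemma map_coeffs_mult:
  fixes h :: "'a::comm_semiring_0 \<Rightarrow> 'b::comm_semiring_0"
  assumes "h 0 = 0" "\<And>a b. h (a + b) = h a + h b" "\<And>a b. h (a * b) = h a * h b"
  shows "map_coeffs h (f * g) = map_coeffs h f * map_coeffs h g"
  using assms unfolding map_coeffs_def by (simp add: map_poly_hom_mult map_poly_hom_add)

lemma coeff3_const3_mult: "coeff3 (const3 c * f) i j k = c * coeff3 f i j k"
  for f :: "'a::comm_semiring_0 poly3"
  by (simp add: const3_def)

lemma eval3_simps [simp]: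
  fixes f g :: "'a::comm_ring_1 poly3"
  shows "eval3 (f + g) v = eval3 f v + eval3 g v"
    and "eval3 (f * g) v = eval3 f v * eval3 g v"
    and "eval3 (f - g) v = eval3 f v - eval3 g v"
    and "eval3 (- f) v = - eval3 f v"
    and "eval3 (f ^ n) v = eval3 f v ^ n"
    and "eval3 0 v = 0" and "eval3 1 v = 1" and "eval3 (numeral m) v = numeral m"
    and "eval3 (const3 c) v = c"
    and "eval3 varX v = v $ 1" and "eval3 varY v = v $ 2" and "eval3 varZ v = v $ 3"
  by (simp_all add: eval3_def const3_def varX_def varY_def varZ_def)

lemma const3_simps:
  fixes c :: "'a::comm_ring_1"
  shows "const3 (c + d) = const3 c + const3 d" and "const3 (c * d) = const3 c * const3 d"
    and "const3 (c - d) = const3 c - const3 d" and "const3 (- c) = - const3 c"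
    and "const3 0 = (0 :: 'a poly3)" and "const3 1 = (1 :: 'a poly3)"
    and "const3 (numeral m) = (numeral m :: 'a poly3)"
  by (simp_all add: const3_def one_pCons flip: numeral_poly)

section \<open>Homogeneous polynomials\<close>

lemma homogeneous_0 [simp]: "homogeneous d 0"
  by (simp add: homogeneous_def)

lemma homogeneous_const3 [simp]: "homogeneous 0 (const3 c)"
  by (auto simp: homogeneous_def const3_def coeff_pCons split: nat.splits)

lemma homogeneous_vars [simp]:
  "homogeneous 1 varX" "homogeneous 1 varY" "homogeneous 1 varZ"
  by (auto simp: homogeneous_def varX_def varY_def varZ_def coeff_pCons one_pCons
      split: nat.splits)

lemma homogeneous_add:
  assumes "homogeneous d f" "homogeneous d g"
  shows "homogeneous d (f + g)"
  unfolding homogeneous_def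
proof (intro allI impI)
  fix i j k assume "coeff3 (f + g) i j k \<noteq> 0"
  then have "coeff3 f i j k \<noteq> 0 \<or> coeff3 g i j k \<noteq> 0" by auto
  then show "i + j + k = d" using assms by (auto simp: homogeneous_def)
qed

lemma homogeneous_uminus: "homogeneous d f \<Longrightarrow> homogeneous d (- f)"
  for f :: "'a::ab_group_add poly3"
  by (simp add: homogeneous_def)

lemma homogeneous_diff: "homogeneous d f \<Longrightarrow> homogeneous d g \<Longrightarrow> homogeneous d (f - g)"
  for f g :: "'a::ab_group_add poly3"
  using homogeneous_add[of d f "- g"] by (simp add: homogeneous_uminus)

lemma homogeneous_mult:
  fixes f g :: "'a::comm_semiring_0 poly3"
  assumes "homogeneous d f" "homogeneous e g"
  shows "homogeneous (d + e) (f * g)"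
  unfolding homogeneous_def
proof (intro allI impI)
  fix i j k assume "coeff3 (f * g) i j k \<noteq> 0"
  then have "(\<Sum>c\<le>k. \<Sum>b\<le>j. \<Sum>a\<le>i. coeff3 f a b c * coeff3 g (i - a) (j - b) (k - c)) \<noteq> 0"
    by (simp add: coeff_mult coeff_sum)
  then obtain a b c where "a \<le> i" "b \<le> j" "c \<le> k"
    and *: "coeff3 f a b c * coeff3 g (i - a) (j - b) (k - c) \<noteq> 0"
    by (meson sum.not_neutral_contains_not_neutral atMost_iff)
  from * have "coeff3 f a b c \<noteq> 0" "coeff3 g (i - a) (j - b) (k - c) \<noteq> 0"
    by auto
  then have "a + b + c = d" "(i - a) + (j - b) + (k - c) = e"
    using assms by (auto simp: homogeneous_def)
  then show "i + j + k = d + e"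
    using \<open>a \<le> i\<close> \<open>b \<le> j\<close> \<open>c \<le> k\<close> by linarith
qed

lemma homogeneous_const3_mult: "homogeneous d f \<Longrightarrow> homogeneous d (const3 c * f)"
  for f :: "'a::comm_semiring_0 poly3"
  using homogeneous_mult[of 0 "const3 c" d f] by simp

lemma homogeneous_numeral [simp]: "homogeneous 0 (numeral n :: 'a::comm_ring_1 poly3)"
  using homogeneous_const3[of "numeral n :: 'a"] by (simp only: const3_simps)

lemma homogeneous_1 [simp]: "homogeneous 0 (1 :: 'a::comm_ring_1 poly3)"
  using homogeneous_const3[of "1 :: 'a"] by (simp only: const3_simps)

lemma homogeneous_power: "homogeneous d f \<Longrightarrow> homogeneous (n * d) (f ^ n)"
  for f :: "'a::comm_ring_1 poly3"
  by (induction n) (auto intro: homogeneous_mult)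

lemma homogeneous_map_coeffs:
  "h 0 = 0 \<Longrightarrow> homogeneous d f \<Longrightarrow> homogeneous d (map_coeffs h f)"
  unfolding homogeneous_def by (metis coeff3_map_coeffs)

lemma poly3_eq_sum_monomials:
  fixes f :: "'a::comm_ring_1 poly3"
  obtains n where
    "f = (\<Sum>k\<le>n. \<Sum>j\<le>n. \<Sum>i\<le>n. const3 (coeff3 f i j k) * varX ^ i * varY ^ j * varZ ^ k)"
proof -
  \<comment> \<open>One bound for the degrees at all three levels of nesting lets the triple sum run
    over a cube.\<close>
  define A where "A = insert (degree f) ((\<lambda>k. degree (coeff f k)) ` {..degree f} \<union>
    (\<lambda>(k, j). degree (coeff (coeff f k) j)) ` (SIGMA k:{..degree f}. {..degree (coeff f k)}))"
  define n where "n = Max A"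
  have fin: "finite A"
    by (auto simp: A_def)
  have k: "k \<le> n" if "coeff f k \<noteq> 0" for k
  proof -
    have "degree f \<le> n" unfolding n_def using fin by (intro Max_ge) (auto simp: A_def)
    then show ?thesis using le_degree[OF that] by linarith
  qed
  have j: "j \<le> n" if "coeff (coeff f k) j \<noteq> 0" for j k
  proof -
    have "coeff f k \<noteq> 0" using that by auto
    then have "degree (coeff f k) \<le> n"
      unfolding n_def using fin le_degree by (intro Max_ge) (auto simp: A_def)
    then show ?thesis using le_degree[OF that] by linarith
  qed
  have i: "i \<le> n" if "coeff3 f i j k \<noteq> 0" for i j k
  proof -
    have 1: "coeff (coeff f k) j \<noteq> 0" using that by auto
    then have 2: "coeff f k \<noteq> 0" by auto
    have "degree (coeff (coeff f k) j) \<le> n"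
      unfolding n_def using fin le_degree[OF 1] le_degree[OF 2]
      by (intro Max_ge) (auto simp: A_def image_iff)
    then show ?thesis using le_degree[OF that] by linarith
  qed
  have mono: "const3 c * varX ^ i * varY ^ j * varZ ^ k = monom (monom (monom c i) j) k"
    for c :: 'a and i j k
  proof -
    have "varX ^ i = [:[:monom (1::'a) i:]:]"
      by (simp add: varX_def monom_altdef poly_const_pow)
    moreover have "varY ^ j = [:monom (1::'a poly) j:]"
      by (simp add: varY_def monom_altdef poly_const_pow)
    moreover have "varZ ^ k = monom (1::'a poly poly) k"
      by (simp add: varZ_def monom_altdef)
    ultimately show ?thesis
      by (simp add: const3_def smult_monom)
  qed
  have "f = (\<Sum>k\<le>n. \<Sum>j\<le>n. \<Sum>i\<le>n. const3 (coeff3 f i j k) * varX ^ i * varY ^ j * varZ ^ k)"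
  proof (rule poly3_eqI)
    fix i j k
    have sm: "monom (sum g A) m = (\<Sum>x\<in>A. monom (g x) m)"
      for g :: "nat \<Rightarrow> 'b::comm_monoid_add" and A m
      by (induction A rule: infinite_finite_induct) (auto simp flip: add_monom)
    have "coeff3 (\<Sum>k\<le>n. \<Sum>j\<le>n. \<Sum>i\<le>n. monom (monom (monom (coeff3 f i j k) i) j) k) i j k
      = coeff3 (\<Sum>k\<le>n. monom (\<Sum>j\<le>n. monom (\<Sum>i\<le>n. monom (coeff3 f i j k) i) j) k) i j k"
      by (simp only: sm)
    also have "\<dots> = (if k \<le> n then if j \<le> n then if i \<le> n then coeff3 f i j k else 0 else 0 else 0)"
      by (simp add: coeff_sum if_distrib[of "\<lambda>p. coeff p _"] sum.delta cong: if_cong)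
    also have "\<dots> = coeff3 f i j k"
      using i[of k j i] j[of k j] k[of k] by (metis coeff_0)
    finally show "coeff3 f i j k = coeff3 (\<Sum>k\<le>n. \<Sum>j\<le>n. \<Sum>i\<le>n.
        const3 (coeff3 f i j k) * varX ^ i * varY ^ j * varZ ^ k) i j k"
      unfolding mono by simp
  qed
  then show thesis by (rule that)
qed

lemma homogeneous_induct [consumes 1, case_names zero add monomial]:
  fixes f :: "'a::comm_ring_1 poly3"
  assumes "homogeneous d f" and P0: "P 0" and Padd: "\<And>f g. P f \<Longrightarrow> P g \<Longrightarrow> P (f + g)"
    and Pmono: "\<And>c i j k. i + j + k = d \<Longrightarrow> P (const3 c * varX ^ i * varY ^ j * varZ ^ k)"
  shows "P f"
proof -
  have Psum: "P (sum g A)" if "\<And>x. x \<in> A \<Longrightarrow> P (g x)" for g :: "nat \<Rightarrow> 'a poly3" and A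
    using that by (induction A rule: infinite_finite_induct) (auto intro: P0 Padd)
  obtain n where f: "f = (\<Sum>k\<le>n. \<Sum>j\<le>n. \<Sum>i\<le>n.
      const3 (coeff3 f i j k) * varX ^ i * varY ^ j * varZ ^ k)"
    by (rule poly3_eq_sum_monomials)
  have "P (const3 (coeff3 f i j k) * varX ^ i * varY ^ j * varZ ^ k)" for i j k
  proof (cases "coeff3 f i j k = 0")
    case False
    then show ?thesis using assms(1) by (intro Pmono) (auto simp: homogeneous_def)
  qed (simp add: P0 const3_simps)
  then show ?thesis by (subst f) (intro Psum)
qed

text \<open>Expansion at the point \<open>(\<alpha> : \<beta> : 1)\<close>. Homogeneity is asserted
  for \<open>varZ * u\<close> and \<open>varZ * w\<close>: this avoids the degree
  \<open>d - 1\<close>, which is wrong for \<open>d = 0\<close>, and yields numerators that fit a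
  denominator of degree \<open>d\<close>.\<close>

lemma homogeneous_taylor:
  fixes f :: "'a::comm_ring_1 poly3"
  assumes "homogeneous d f"
  shows "\<exists>c u w. homogeneous d (varZ * u) \<and> homogeneous d (varZ * w) \<and>
    f = const3 c * varZ ^ d + (varX - const3 \<alpha> * varZ) * u + (varY - const3 \<beta> * varZ) * w"
    (is "?P d f")
  using assms
proof (induction rule: homogeneous_induct)
  case zero
  show ?case by (intro exI[of _ 0]) (simp add: const3_simps)
next
  case (add f g)
  then obtain c u w c' u' w' where
    "homogeneous d (varZ * u)" "homogeneous d (varZ * w)"
    "homogeneous d (varZ * u')" "homogeneous d (varZ * w')"
    and fg: "f = const3 c * varZ ^ d + (varX - const3 \<alpha> * varZ) * u + (varY - const3 \<beta> * varZ) * w"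
    "g = const3 c' * varZ ^ d + (varX - const3 \<alpha> * varZ) * u' + (varY - const3 \<beta> * varZ) * w'"
    by blast
  then have "homogeneous d (varZ * (u + u'))" "homogeneous d (varZ * (w + w'))"
    by (simp_all add: distrib_left homogeneous_add)
  moreover have "f + g = const3 (c + c') * varZ ^ d + (varX - const3 \<alpha> * varZ) * (u + u')
      + (varY - const3 \<beta> * varZ) * (w + w')"
    unfolding fg const3_simps by (simp add: algebra_simps)
  ultimately show ?case by blast
next
  case (monomial c i j k)
  have base: "?P k (const3 c * varZ ^ k)" for k
    by (intro exI[of _ c] exI[of _ 0]) simp
  have hom: "homogeneous (j + k) (const3 c * varY ^ j * varZ ^ k)" for j k
    using homogeneous_mult[OF homogeneous_mult[OF homogeneous_const3[of c]
      homogeneous_power[OF homogeneous_vars(2), of j]] homogeneous_power[OF homogeneous_vars(3), of k]]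
    by simp
  have step: "?P (Suc e) (l * f)" 
    if "?P e f" "homogeneous e f" and l: "l = varX \<and> a = \<alpha> \<or> l = varY \<and> a = \<beta>" for e f l a
  proof -
    from that obtain c u w where
      u: "homogeneous e (varZ * u)" "homogeneous e (varZ * w)" and
      f: "f = const3 c * varZ ^ e + (varX - const3 \<alpha> * varZ) * u + (varY - const3 \<beta> * varZ) * w"
      by blast
    have lf: "l * f = const3 a * varZ * f + (l - const3 a * varZ) * f"
      by (simp add: algebra_simps)
    have Z: "homogeneous (Suc e) (varZ * g)" if "homogeneous e g" for g :: "'a poly3"
      using homogeneous_mult[OF homogeneous_vars(3) that] by simp
    have 1: "homogeneous (Suc e) (varZ * (const3 a * varZ * u))"
      "homogeneous (Suc e) (varZ * (const3 a * varZ * w))"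
      "homogeneous (Suc e) (varZ * f)"
      using u \<open>homogeneous e f\<close> by (auto intro!: Z homogeneous_const3_mult simp: mult.assoc)
    have 2: "const3 a * varZ * f = const3 (a * c) * varZ ^ Suc e
        + (varX - const3 \<alpha> * varZ) * (const3 a * varZ * u)
        + (varY - const3 \<beta> * varZ) * (const3 a * varZ * w)"
      by (subst f) (simp add: algebra_simps const3_simps)
    show ?thesis
      using l
    proof
      assume "l = varX \<and> a = \<alpha>"
      then show ?thesis using 1 2 lf
        by (rule_tac x = "a * c" in exI, rule_tac x = "const3 a * varZ * u + f" in exI,
            rule_tac x = "const3 a * varZ * w" in exI) (simp add: distrib_left homogeneous_add)
    next
      assume "l = varY \<and> a = \<beta>"
      then show ?thesis using 1 2 lf
        by (rule_tac x = "a * c" in exI, rule_tac x = "const3 a * varZ * u" in exI,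
            rule_tac x = "const3 a * varZ * w + f" in exI) (simp add: distrib_left homogeneous_add)
    qed
  qed
  have Y: "?P (j + k) (const3 c * varY ^ j * varZ ^ k)" for j k
  proof (induction j)
    case (Suc j)
    show ?case
      using step[OF Suc hom, of varY \<beta>] by (simp add: mult_ac)
  qed (use base[of k] in simp)
  have homX: "homogeneous (i + (j + k)) (const3 c * varX ^ i * varY ^ j * varZ ^ k)" for i j k
    using homogeneous_mult[OF homogeneous_power[OF homogeneous_vars(1)] hom, of i j k]
    by (simp add: mult_ac)
  have "?P (i + (j + k)) (const3 c * varX ^ i * varY ^ j * varZ ^ k)"
  proof (induction i)
    case 0
    show ?case using Y by simp
  next
    case (Suc i)
    show ?case
      using step[OF Suc homX, of varX \<alpha>] by (simp add: mult_ac)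
  qed
  then show ?case using monomial by (simp add: add.assoc)
qed

section \<open>The forms attached to the family\<close>

text \<open>\<open>G\<close> is the product of \<open>line\<close> and \<open>cubic\<close>, \<open>hess_cubic\<close> is the Hessian of \<open>cubic\<close>, and the
  Hessian of \<open>G\<close> is \<open>line * cofactor\<close>. The Hessian of \<open>G - s X\<^sup>4\<close> is linear in \<open>s\<close>, with coefficient
  \<open>- 12 X\<^sup>2 * minor\<close>, where \<open>minor\<close> is the \<open>YZ\<close>-minor of the Hessian matrix of \<open>G\<close>. On the nearby fibers,
  \<open>cubic\<close> times the Hessian equals \<open>s X\<^sup>2 * residual\<close>. The lines \<open>tangent1\<close> and \<open>tangent2\<close> are the
  tangents of the cubic at its node, and \<open>flex_line\<close> passes through its three flexes; \<open>cubic\<close> and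
  \<open>hess_cubic\<close> are combinations of \<open>tangent1 * tangent2 * flex_line\<close> and \<open>tangent1\<^sup>3 - tangent2\<^sup>3\<close>.\<close>

definition line :: "'a::comm_ring_1 \<Rightarrow> 'a \<Rightarrow> 'a \<Rightarrow> 'a" where
  "line x y z = x + y + z"

definition cubic :: "'a::comm_ring_1 \<Rightarrow> 'a \<Rightarrow> 'a \<Rightarrow> 'a" where
  "cubic x y z =
      x^3 - 4 * x^2 * y + 5 * x^2 * z + x * y^2 - 7 * x * y * z + x * z^2 + 3 * y^3"

definition hess_cubic :: "'a::comm_ring_1 \<Rightarrow> 'a \<Rightarrow> 'a \<Rightarrow> 'a" where
  "hess_cubic x y z =
      522 * x^3 - 1944 * x^2 * y + 450 * x^2 * z + 2322 * x * y^2 - 990 * x * y * z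
      + 90 * x * z^2 - 882 * y^3 + 504 * y^2 * z - 72 * y * z^2"

definition cofactor :: "'a::comm_ring_1 \<Rightarrow> 'a \<Rightarrow> 'a \<Rightarrow> 'a" where
  "cofactor x y z =
      1620 * x^5 - 3888 * x^4 * y + 5670 * x^4 * z - 1620 * x^3 * y^2
      - 10854 * x^3 * y * z + 4374 * x^3 * z^2 + 5508 * x^2 * y^3 + 1458 * x^2 * y^2 * z
      - 9720 * x^2 * y * z^2 + 2106 * x^2 * z^3 + 972 * x * y^4 + 6642 * x * y^3 * z
      + 5832 * x * y^2 * z^2 - 3402 * x * y * z^3 + 324 * x * z^4 - 2106 * y^5
      - 4050 * y^4 * z + 486 * y^3 * z^2 + 810 * y^2 * z^3 - 162 * y * z^4"

definition minor :: "'a::comm_ring_1 \<Rightarrow> 'a \<Rightarrow> 'a \<Rightarrow> 'a" where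
  "minor x y z =
      -108 * x^4 + 216 * x^3 * y - 324 * x^3 * z + 108 * x^2 * y^2 + 216 * x^2 * y * z
      - 216 * x^2 * z^2 - 216 * x * y^3 + 216 * x * y^2 * z + 108 * x * y * z^2
      - 81 * y^4"

definition quotient :: "'a::comm_ring_1 \<Rightarrow> 'a \<Rightarrow> 'a \<Rightarrow> 'a" where
  "quotient x y z =
      1782 * x^2 - 324 * x * y + 324 * x * z - 162 * y^2 - 1620 * y * z + 486 * z^2"

definition residual_quotient :: "'a::comm_ring_1 \<Rightarrow> 'a \<Rightarrow> 'a \<Rightarrow> 'a" where
  "residual_quotient x y z =
      2916 * x^6 - 14580 * x^5 * y + 13122 * x^5 * z + 23328 * x^4 * y^2
      - 49572 * x^4 * y * z + 14580 * x^4 * z^2 - 8748 * x^3 * y^3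
      + 51030 * x^3 * y^2 * z - 29160 * x^3 * y * z^2 + 4374 * x^3 * z^3
      - 8748 * x^2 * y^4 + 5832 * x^2 * y^3 * z - 4374 * x^2 * y^2 * z^2
      - 5832 * x^2 * y * z^3 - 1458 * x^2 * z^4 + 1458 * x * y^5 - 24786 * x * y^4 * z
      + 26244 * x * y^3 * z^2 + 17496 * x * y^2 * z^3 + 5832 * x * y * z^4
      + 1458 * x * z^5 + 7290 * y^6 + 8748 * y^5 * z - 4374 * y^4 * z^2
      - 43740 * y^3 * z^3 - 23328 * y^2 * z^4 - 7290 * y * z^5 - 1458 * z^6"

definition residual :: "'a::comm_ring_1 \<Rightarrow> 'a \<Rightarrow> 'a \<Rightarrow> 'a" where
  "residual x y z = x^2 * cofactor x y z - 12 * minor x y z * cubic x y z"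

definition tangent1 :: "'a::comm_ring_1 \<Rightarrow> 'a \<Rightarrow> 'a \<Rightarrow> 'a" where
  "tangent1 x y z = 4 * x - 5 * y + z"

definition tangent2 :: "'a::comm_ring_1 \<Rightarrow> 'a \<Rightarrow> 'a \<Rightarrow> 'a" where
  "tangent2 x y z = x - 2 * y + z"

definition flex_line :: "'a::comm_ring_1 \<Rightarrow> 'a \<Rightarrow> 'a \<Rightarrow> 'a" where
  "flex_line x y z = y - 2 * x"

lemmas form_defs = line_def cubic_def hess_cubic_def cofactor_def minor_def quotient_def
  residual_quotient_def residual_def tangent1_def tangent2_def flex_line_def

text \<open>The forms are functions of three ring elements, so that this one identity serves
  coordinates of points as well as polynomials.\<close>

lemma cofactor_mod_cubic:
  fixes x y z :: "'a::idom"
  shows "4 * cofactor x y z = 9 * line x y z ^ 2 * hess_cubic x y z + cubic x y z * quotient x y z"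
  unfolding form_defs by algebra

text \<open>On the line \<open>4 * cofactor\<close> is a multiple of \<open>cubic\<close>, hence so
  is \<open>residual\<close>. The first factor is \<open>cubic\<close> restricted to the line, up to
  the factor -3 (see \<open>cubic_on_line\<close>); its zeros are nodes of \<open>G\<close>. The
  second is the quartic with the roots \<xi>, \<mu> and their conjugates.\<close>

lemma residual_mod_line:
  fixes x y z :: "'a::idom"
  shows "residual x y z = line x y z * residual_quotient x y z
    - 1458 * (y^3 - 3 * y * z^2 - z^3) * (3 * y^4 + 11 * y^3 * z + 12 * y^2 * z^2 + 3 * y * z^3 + z^4)"
  unfolding form_defs by algebra

lemma cubic_eq_tangents:
  fixes x y z :: "'a::idom"
  shows "9 * cubic x y z = - 9 * (tangent1 x y z * tangent2 x y z * flex_line x y z)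
    - (tangent1 x y z ^ 3 - tangent2 x y z ^ 3)"
  unfolding form_defs by algebra

text \<open>The Hessian of \<open>p x y z + q (x^3 - y^3)\<close> is
  \<open>2 p^3 x y z - 6 p^2 q (x^3 - y^3)\<close>. Here \<open>p = -1\<close> and
  \<open>q = -1/9\<close>, and the three linear forms have determinant 3, whose square 9 scales the
  result to -18 and 6.\<close>

lemma hess_cubic_eq_tangents:
  fixes x y z :: "'a::idom"
  shows "hess_cubic x y z = - 18 * (tangent1 x y z * tangent2 x y z * flex_line x y z)
    + 6 * (tangent1 x y z ^ 3 - tangent2 x y z ^ 3)"
  unfolding form_defs by algebra

lemma G_eq: "G = line varX varY varZ * cubic varX varY (varZ :: 'a::idom poly3)"
  unfolding G_def Let_def form_defs by algebra

section \<open>Partial derivatives\<close>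

text \<open>A derivation of the coefficients extends to polynomials. One application gives the
  product rule for \<open>partial_Y\<close>, two nested ones give it for
  \<open>partial_X\<close>.\<close>

lemma map_poly_derivation_mult:
  fixes D :: "'a::comm_ring_1 \<Rightarrow> 'a"
  assumes "D 0 = 0" "\<And>a b. D (a + b) = D a + D b" "\<And>a b. D (a * b) = a * D b + b * D a"
  shows "map_poly D (p * q) = p * map_poly D q + q * map_poly D p"
proof (rule poly_eqI)
  fix n
  have "(\<Sum>i\<le>n. coeff q (n - i) * D (coeff p i)) = (\<Sum>i\<le>n. coeff q i * D (coeff p (n - i)))"
    by (rule sum.reindex_bij_witness[of _ "\<lambda>i. n - i" "\<lambda>i. n - i"]) auto
  then show "coeff (map_poly D (p * q)) n = coeff (p * map_poly D q + q * map_poly D p) n"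
    using assms by (simp add: coeff_map_poly coeff_mult hom_sum[of D] sum.distrib)
qed

definition partial_X :: "'a::idom poly3 \<Rightarrow> 'a poly3" where
  "partial_X = map_poly (map_poly pderiv)"
definition partial_Y :: "'a::idom poly3 \<Rightarrow> 'a poly3" where
  "partial_Y = map_poly pderiv"
definition partial_Z :: "'a::idom poly3 \<Rightarrow> 'a poly3" where
  "partial_Z = pderiv"

lemma partial_add:
  "partial_X (f + g) = partial_X f + partial_X g"
  "partial_Y (f + g) = partial_Y f + partial_Y g"
  "partial_Z (f + g) = partial_Z f + partial_Z g"
  by (simp_all add: partial_X_def partial_Y_def partial_Z_def map_poly_hom_add pderiv_add)

lemma partial_mult:
  "partial_X (f * g) = f * partial_X g + g * partial_X f"
  "partial_Y (f * g) = f * partial_Y g + g * partial_Y f"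
  "partial_Z (f * g) = f * partial_Z g + g * partial_Z f"
  by (simp_all add: partial_X_def partial_Y_def partial_Z_def map_poly_derivation_mult
      map_poly_hom_add pderiv_add pderiv_mult)

lemma partial_const3 [simp]:
  "partial_X (const3 c) = 0" "partial_Y (const3 c) = 0" "partial_Z (const3 c) = 0"
  by (simp_all add: partial_X_def partial_Y_def partial_Z_def const3_def map_poly_pCons)

lemma partial_numeral [simp]:
  "partial_X (numeral n) = 0" "partial_Y (numeral n) = 0" "partial_Z (numeral n) = 0"
  by (simp_all flip: const3_simps(7))

lemma partial_one [simp]: "partial_X 1 = 0" "partial_Y 1 = 0" "partial_Z 1 = 0"
  by (simp_all flip: const3_simps(6))

lemma partial_zero [simp]: "partial_X 0 = 0" "partial_Y 0 = 0" "partial_Z 0 = 0"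
  by (simp_all flip: const3_simps(5))

lemma partial_uminus:
  "partial_X (- f) = - partial_X f" "partial_Y (- f) = - partial_Y f"
  "partial_Z (- f) = - partial_Z f"
  using partial_add[of f "- f"] by (simp_all add: eq_neg_iff_add_eq_0 add.commute)

lemma partial_diff:
  "partial_X (f - g) = partial_X f - partial_X g"
  "partial_Y (f - g) = partial_Y f - partial_Y g"
  "partial_Z (f - g) = partial_Z f - partial_Z g"
  using partial_add[of f "- g"] by (simp_all add: partial_uminus)

lemma partial_vars [simp]:
  "partial_X varX = 1" "partial_X varY = 0" "partial_X varZ = 0"
  "partial_Y varX = 0" "partial_Y varY = 1" "partial_Y varZ = 0"
  "partial_Z varX = 0" "partial_Z varY = 0" "partial_Z varZ = 1"
  by (simp_all add: partial_X_def partial_Y_def partial_Z_def varX_def varY_def varZ_def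
      map_poly_pCons pderiv_pCons one_pCons)

lemma partial_power:
  fixes f :: "'a::idom poly3"
  shows
  "partial_X (f ^ Suc n) = of_nat (Suc n) * f ^ n * partial_X f"
  "partial_Y (f ^ Suc n) = of_nat (Suc n) * f ^ n * partial_Y f"
  "partial_Z (f ^ Suc n) = of_nat (Suc n) * f ^ n * partial_Z f"
  by (induction n) (simp_all add: partial_mult algebra_simps)

lemma partial_powers:
  fixes f :: "'a::idom poly3"
  shows
  "partial_X (f ^ 2) = 2 * f * partial_X f" "partial_Y (f ^ 2) = 2 * f * partial_Y f"
  "partial_Z (f ^ 2) = 2 * f * partial_Z f"
  "partial_X (f ^ 3) = 3 * f ^ 2 * partial_X f" "partial_Y (f ^ 3) = 3 * f ^ 2 * partial_Y f"
  "partial_Z (f ^ 3) = 3 * f ^ 2 * partial_Z f"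
  "partial_X (f ^ 4) = 4 * f ^ 3 * partial_X f" "partial_Y (f ^ 4) = 4 * f ^ 3 * partial_Y f"
  "partial_Z (f ^ 4) = 4 * f ^ 3 * partial_Z f"
  using partial_power[of f 1] partial_power[of f 2] partial_power[of f 3]
  by (simp_all add: numeral_eq_Suc)

lemmas partial_simps = partial_add partial_diff partial_uminus partial_mult partial_powers

lemma grad_eq: "grad f = vector [partial_X f, partial_Y f, partial_Z f]"
  by (simp add: grad_def partial_X_def partial_Y_def partial_Z_def)

lemma hessian_eq:
  "hessian f = partial_X (partial_X f) * (partial_Y (partial_Y f) * partial_Z (partial_Z f)
      - partial_Z (partial_Y f) * partial_Y (partial_Z f))
    - partial_Y (partial_X f) * (partial_X (partial_Y f) * partial_Z (partial_Z f)
      - partial_Z (partial_Y f) * partial_X (partial_Z f))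
    + partial_Z (partial_X f) * (partial_X (partial_Y f) * partial_Y (partial_Z f)
      - partial_Y (partial_Y f) * partial_X (partial_Z f))"
  by (simp add: hessian_def grad_eq det_3 algebra_simps)

lemma partial_G:
  "partial_X G = 4 * varX^3 - 9 * varX^2 * varY + 18 * varX^2 * varZ - 6 * varX * varY^2 - 12 * varX * varY * varZ + 12 * varX * varZ^2
      + 4 * varY^3 - 6 * varY^2 * varZ - 6 * varY * varZ^2 + varZ^3"
  "partial_Y G = -3 * varX^3 - 6 * varX^2 * varY - 6 * varX^2 * varZ + 12 * varX * varY^2 - 12 * varX * varY * varZ - 6 * varX * varZ^2
      + 12 * varY^3 + 9 * varY^2 * varZ"
  "partial_Z G = 6 * varX^3 - 6 * varX^2 * varY + 12 * varX^2 * varZ - 6 * varX * varY^2 - 12 * varX * varY * varZ + 3 * varX * varZ^2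
      + 3 * varY^3"
  unfolding G_def Let_def by (simp_all add: partial_simps algebra_simps)

text \<open>Only the \<open>XX\<close> entry of the Hessian matrix contains \<open>c\<close>, so the
  determinant is linear in \<open>c\<close> with the complementary minor as coefficient. A general
  coefficient ring allows \<open>c\<close> to be the parameter itself.\<close>

lemma hessian_family:
  fixes c :: "'a::idom"
  shows "hessian (G - const3 c * varX ^ 4) = line varX varY varZ * cofactor varX varY varZ
    - 12 * const3 c * varX ^ 2 * minor varX varY varZ"
proof -
  let ?F = "G - const3 c * varX ^ 4 :: 'a poly3"
  have x: "partial_X ?F = 4 * varX^3 - 9 * varX^2 * varY + 18 * varX^2 * varZ - 6 * varX * varY^2 - 12 * varX * varY * varZ + 12 * varX * varZ^2
      + 4 * varY^3 - 6 * varY^2 * varZ - 6 * varY * varZ^2 + varZ^3 - 4 * const3 c * varX ^ 3"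
    by (simp add: partial_simps partial_G)
  have y: "partial_Y ?F = -3 * varX^3 - 6 * varX^2 * varY - 6 * varX^2 * varZ + 12 * varX * varY^2 - 12 * varX * varY * varZ - 6 * varX * varZ^2
      + 12 * varY^3 + 9 * varY^2 * varZ"
    by (simp add: partial_simps partial_G)
  have z: "partial_Z ?F = 6 * varX^3 - 6 * varX^2 * varY + 12 * varX^2 * varZ - 6 * varX * varY^2 - 12 * varX * varY * varZ + 3 * varX * varZ^2
      + 3 * varY^3"
    by (simp add: partial_simps partial_G)
  have xx: "partial_X (partial_X ?F) = 12 * varX^2 - 18 * varX * varY + 36 * varX * varZ - 6 * varY^2 - 12 * varY * varZ + 12 * varZ^2 - 12 * const3 c * varX ^ 2"
    unfolding x by (simp add: partial_simps algebra_simps)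
  have xy: "partial_Y (partial_X ?F) = -9 * varX^2 - 12 * varX * varY - 12 * varX * varZ + 12 * varY^2 - 12 * varY * varZ - 6 * varZ^2"
    unfolding x by (simp add: partial_simps algebra_simps)
  have xz: "partial_Z (partial_X ?F) = 18 * varX^2 - 12 * varX * varY + 24 * varX * varZ - 6 * varY^2 - 12 * varY * varZ + 3 * varZ^2"
    unfolding x by (simp add: partial_simps algebra_simps)
  have yx: "partial_X (partial_Y ?F) = -9 * varX^2 - 12 * varX * varY - 12 * varX * varZ + 12 * varY^2 - 12 * varY * varZ - 6 * varZ^2"
    unfolding y by (simp add: partial_simps algebra_simps)
  have yy: "partial_Y (partial_Y ?F) = -6 * varX^2 + 24 * varX * varY - 12 * varX * varZ + 36 * varY^2 + 18 * varY * varZ"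
    unfolding y by (simp add: partial_simps algebra_simps)
  have yz: "partial_Z (partial_Y ?F) = -6 * varX^2 - 12 * varX * varY - 12 * varX * varZ + 9 * varY^2"
    unfolding y by (simp add: partial_simps algebra_simps)
  have zx: "partial_X (partial_Z ?F) = 18 * varX^2 - 12 * varX * varY + 24 * varX * varZ - 6 * varY^2 - 12 * varY * varZ + 3 * varZ^2"
    unfolding z by (simp add: partial_simps algebra_simps)
  have zy: "partial_Y (partial_Z ?F) = -6 * varX^2 - 12 * varX * varY - 12 * varX * varZ + 9 * varY^2"
    unfolding z by (simp add: partial_simps algebra_simps)
  have zz: "partial_Z (partial_Z ?F) = 12 * varX^2 - 12 * varX * varY + 6 * varX * varZ"
    unfolding z by (simp add: partial_simps algebra_simps)
  show ?thesis
    unfolding hessian_eq xx xy xz yx yy yz zx zy zz form_defs by algebra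
qed

lemma partial_G_hat:
  "partial_X G_hat = 3 * varX^2 - 14 * varX * varY + 4 * varX * varZ + 12 * varY^2 - 3 * varY * varZ - 6 * varZ^2"
  "partial_Y G_hat = -7 * varX^2 + 24 * varX * varY - 3 * varX * varZ - 9 * varY^2 + 9 * varZ^2"
  "partial_Z G_hat = 2 * varX^2 - 3 * varX * varY - 12 * varX * varZ + 18 * varY * varZ + 9 * varZ^2"
  unfolding G_hat_def Let_def by (simp_all add: partial_simps algebra_simps)

text \<open>The substitution of \<open>X - Y - Z\<close> for \<open>X\<close> is unimodular, so
  forming the Hessian commutes with it.\<close>

lemma hessian_G_hat:
  "hessian G_hat = hess_cubic (varX - varY - varZ) varY varZ"
proof -
  have xx: "partial_X (partial_X G_hat) = 6 * varX - 14 * varY + 4 * varZ"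
    unfolding partial_G_hat by (simp add: partial_simps algebra_simps)
  have xy: "partial_Y (partial_X G_hat) = -14 * varX + 24 * varY - 3 * varZ"
    unfolding partial_G_hat by (simp add: partial_simps algebra_simps)
  have xz: "partial_Z (partial_X G_hat) = 4 * varX - 3 * varY - 12 * varZ"
    unfolding partial_G_hat by (simp add: partial_simps algebra_simps)
  have yx: "partial_X (partial_Y G_hat) = -14 * varX + 24 * varY - 3 * varZ"
    unfolding partial_G_hat by (simp add: partial_simps algebra_simps)
  have yy: "partial_Y (partial_Y G_hat) = 24 * varX - 18 * varY"
    unfolding partial_G_hat by (simp add: partial_simps algebra_simps)
  have yz: "partial_Z (partial_Y G_hat) = -3 * varX + 18 * varZ"
    unfolding partial_G_hat by (simp add: partial_simps algebra_simps)
  have zx: "partial_X (partial_Z G_hat) = 4 * varX - 3 * varY - 12 * varZ"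
    unfolding partial_G_hat by (simp add: partial_simps algebra_simps)
  have zy: "partial_Y (partial_Z G_hat) = -3 * varX + 18 * varZ"
    unfolding partial_G_hat by (simp add: partial_simps algebra_simps)
  have zz: "partial_Z (partial_Z G_hat) = -12 * varX + 18 * varY + 18 * varZ"
    unfolding partial_G_hat by (simp add: partial_simps algebra_simps)
  show ?thesis
    unfolding hessian_eq xx xy xz yx yy yz zx zy zz form_defs by algebra
qed

lemma G_hat_eq: "G_hat = cubic (varX - varY - varZ) varY varZ"
  unfolding G_hat_def Let_def form_defs by algebra

section \<open>Specialisation of the parameter\<close>

abbreviation svar :: "complex poly poly3" where "svar \<equiv> const3 [:0, 1:]"

definition lift :: "complex poly3 \<Rightarrow> complex poly poly3" where
  "lift = map_coeffs (\<lambda>c. [:c:])"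

lemma map_coeffs_vars [simp]:
  fixes h :: "'a::comm_ring_1 \<Rightarrow> 'b::comm_ring_1"
  assumes "h 0 = 0" "h 1 = 1"
  shows "map_coeffs h varX = varX" "map_coeffs h varY = varY" "map_coeffs h varZ = varZ"
  using assms by (simp_all add: map_coeffs_def varX_def varY_def varZ_def map_poly_pCons one_pCons)

lemma map_coeffs_const3: "h 0 = 0 \<Longrightarrow> map_coeffs h (const3 c) = const3 (h c)"
  by (simp add: map_coeffs_def const3_def map_poly_pCons)

lemma fiber_simps [simp]:
  "fiber (f + g) s = fiber f s + fiber g s" "fiber (f * g) s = fiber f s * fiber g s"
  "fiber (const3 c) s = const3 (poly c s)"
  "fiber varX s = varX" "fiber varY s = varY" "fiber varZ s = varZ"
  by (simp_all add: fiber_def map_coeffs_add map_coeffs_mult map_coeffs_const3)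

lemma fiber_simps2 [simp]:
  "fiber 0 s = 0" "fiber 1 s = 1" "fiber (numeral n) s = numeral n" "fiber (- f) s = - fiber f s"
proof -
  show [simp]: "fiber 0 s = 0" "fiber 1 s = 1" "fiber (numeral n) s = numeral n"
    using fiber_simps(3)[of 0] fiber_simps(3)[of 1] fiber_simps(3)[of "numeral n"]
    by (simp_all add: const3_simps)
  show "fiber (- f) s = - fiber f s"
    using fiber_simps(1)[of f "- f" s] by (simp add: eq_neg_iff_add_eq_0 add.commute)
qed

lemma fiber_diff [simp]: "fiber (f - g) s = fiber f s - fiber g s"
  using fiber_simps(1)[of f "- g" s] by simp

lemma fiber_power [simp]: "fiber (f ^ n) s = fiber f s ^ n"
  by (induction n) auto

lemma lift_simps [simp]:
  "lift (f + g) = lift f + lift g" "lift (f * g) = lift f * lift g"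
  "lift (const3 c) = const3 [:c:]"
  "lift varX = varX" "lift varY = varY" "lift varZ = varZ"
  by (simp_all add: lift_def map_coeffs_add map_coeffs_mult map_coeffs_const3 one_pCons)

lemma lift_simps2 [simp]:
  "lift 0 = 0" "lift 1 = 1" "lift (numeral n) = numeral n" "lift (- f) = - lift f"
proof -
  show [simp]: "lift 0 = 0" "lift 1 = 1" "lift (numeral n) = numeral n"
    using lift_simps(3)[of 0] lift_simps(3)[of 1] lift_simps(3)[of "numeral n"]
    by (simp_all add: const3_simps flip: one_pCons numeral_poly)
  show "lift (- f) = - lift f"
    using lift_simps(1)[of f "- f"] by (simp add: eq_neg_iff_add_eq_0 add.commute)
qed

lemma lift_diff [simp]: "lift (f - g) = lift f - lift g"
  using lift_simps(1)[of f "- g"] by simp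

lemma lift_power [simp]: "lift (f ^ n) = lift f ^ n"
  by (induction n) auto

lemma fiber_lift [simp]: "fiber (lift f) s = f"
  by (rule poly3_eqI) (simp add: fiber_def lift_def coeff3_map_coeffs)

lemma homogeneous_lift: "homogeneous d f \<Longrightarrow> homogeneous d (lift f)"
  by (simp add: lift_def homogeneous_map_coeffs)

lemma fiber_eq_0_imp_dvd:
  assumes "fiber f 0 = 0"
  shows "svar dvd f"
proof
  have "coeff3 f i j k = [:0, 1:] * poly_shift 1 (coeff3 f i j k)" for i j k
  proof -
    have "poly (coeff3 f i j k) 0 = 0"
      using arg_cong[OF assms, of "\<lambda>f. coeff3 f i j k"]
      by (simp add: fiber_def coeff3_map_coeffs)
    then show ?thesis
      by (intro poly_eqI) (simp add: coeff_poly_shift coeff_pCons poly_0_coeff_0 split: nat.splits)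
  qed
  then show "f = svar * map_coeffs (poly_shift 1) f"
    by (intro poly3_eqI) (simp add: coeff3_const3_mult coeff3_map_coeffs)
qed

text \<open>Separates the value at \<open>s = 0\<close> from a multiple of \<open>s\<close>, so that
  a relation over \<open>\<complex>[s]\<close> can be analysed through its constant part.\<close>

lemma eq_lift_fiber: obtains g where "f = lift (fiber f 0) + svar * g"
proof -
  have "svar dvd f - lift (fiber f 0)"
    by (rule fiber_eq_0_imp_dvd) simp
  then obtain g where "f - lift (fiber f 0) = svar * g" by (elim dvdE)
  then show thesis by (intro that[of g]) (simp add: algebra_simps)
qed

section \<open>The forms as polynomials\<close>

abbreviation "LP \<equiv> line varX varY varZ"
abbreviation "CP \<equiv> cubic varX varY varZ"
abbreviation "HP \<equiv> hess_cubic varX varY varZ"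
abbreviation "KP \<equiv> cofactor varX varY varZ"
abbreviation "MP \<equiv> minor varX varY varZ"
abbreviation "QP \<equiv> quotient varX varY varZ"
abbreviation "NP \<equiv> residual varX varY varZ"
abbreviation "AP \<equiv> residual_quotient varX varY varZ"
abbreviation "T1P \<equiv> tangent1 varX varY varZ"
abbreviation "T2P \<equiv> tangent2 varX varY varZ"
abbreviation "FLP \<equiv> flex_line varX varY varZ"

lemma eval3_forms [simp]:
  "eval3 (line a b c) v = line (eval3 a v) (eval3 b v) (eval3 c v)"
  "eval3 (cubic a b c) v = cubic (eval3 a v) (eval3 b v) (eval3 c v)"
  "eval3 (hess_cubic a b c) v = hess_cubic (eval3 a v) (eval3 b v) (eval3 c v)"
  "eval3 (cofactor a b c) v = cofactor (eval3 a v) (eval3 b v) (eval3 c v)"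
  "eval3 (minor a b c) v = minor (eval3 a v) (eval3 b v) (eval3 c v)"
  "eval3 (quotient a b c) v = quotient (eval3 a v) (eval3 b v) (eval3 c v)"
  "eval3 (residual a b c) v = residual (eval3 a v) (eval3 b v) (eval3 c v)"
  "eval3 (residual_quotient a b c) v = residual_quotient (eval3 a v) (eval3 b v) (eval3 c v)"
  "eval3 (tangent1 a b c) v = tangent1 (eval3 a v) (eval3 b v) (eval3 c v)"
  "eval3 (tangent2 a b c) v = tangent2 (eval3 a v) (eval3 b v) (eval3 c v)"
  "eval3 (flex_line a b c) v = flex_line (eval3 a v) (eval3 b v) (eval3 c v)"
  by (simp_all add: form_defs)

lemma lift_forms [simp]:
  "lift LP = LP" "lift CP = CP" "lift HP = HP" "lift KP = KP" "lift MP = MP" "lift QP = QP"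
  "lift NP = NP" "lift AP = AP" "lift T1P = T1P" "lift T2P = T2P" "lift FLP = FLP"
  by (simp_all add: form_defs)

lemma fiber_forms [simp]:
  "fiber LP s = LP" "fiber CP s = CP" "fiber KP s = KP" "fiber MP s = MP" "fiber NP s = NP"
  by (simp_all add: form_defs)

lemma homogeneous_mult':
  "homogeneous d f \<Longrightarrow> homogeneous e g \<Longrightarrow> n = d + e \<Longrightarrow> homogeneous n (f * g)"
  for f g :: "'a::comm_semiring_0 poly3"
  by (simp add: homogeneous_mult)

lemma homogeneous_power':
  "homogeneous d f \<Longrightarrow> n = k * d \<Longrightarrow> homogeneous n (f ^ k)"
  for f :: "'a::comm_ring_1 poly3"
  by (simp add: homogeneous_power)

lemmas homogeneous_intros = homogeneous_add homogeneous_diff homogeneous_uminus homogeneous_mult'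
  homogeneous_power' homogeneous_vars homogeneous_numeral homogeneous_const3 homogeneous_1

lemma homogeneous_forms:
  shows "homogeneous 1 (LP :: 'a::comm_ring_1 poly3)"
    and "homogeneous 3 (CP :: 'a::comm_ring_1 poly3)" 
    and "homogeneous 3 (HP :: 'a::comm_ring_1 poly3)" 
    and "homogeneous 5 (KP :: 'a::comm_ring_1 poly3)" 
    and "homogeneous 4 (MP :: 'a::comm_ring_1 poly3)" 
    and "homogeneous 2 (QP :: 'a::comm_ring_1 poly3)"
    and "homogeneous 6 (AP :: 'a::comm_ring_1 poly3)" 
    and "homogeneous 1 (T1P :: 'a::comm_ring_1 poly3)" 
    and "homogeneous 1 (T2P :: 'a::comm_ring_1 poly3)"
    and "homogeneous 1 (FLP :: 'a::comm_ring_1 poly3)"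
  unfolding form_defs by ((rule homogeneous_intros refl | simp)+)

lemma homogeneous_residual: "homogeneous 7 (NP :: 'a::comm_ring_1 poly3)"
  unfolding residual_def
  by ((rule homogeneous_intros homogeneous_forms refl | simp)+)

section \<open>Divisibility\<close>

lemma not_dvd_eval3: "eval3 p v = 0 \<Longrightarrow> eval3 q v \<noteq> 0 \<Longrightarrow> \<not> p dvd q"
  by (auto elim!: dvdE)

lemma prime_elem_linear: "prime_elem [:c, 1::'a::idom:]"
proof (rule prime_elemI)
  have dvd: "[:c, 1:] dvd p \<longleftrightarrow> poly p (- c) = 0" for p
    using poly_eq_0_iff_dvd[of p "- c"] by simp
  show "\<not> [:c, 1:] dvd 1"
    by (simp add: dvd)
  show "[:c, 1:] dvd p \<or> [:c, 1:] dvd q" if "[:c, 1:] dvd p * q" for p q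
    using that by (simp add: dvd)
qed simp

lemma prime_forms:
  "prime_elem (LP :: complex poly3)" "prime_elem (T1P :: complex poly3)"
  "prime_elem (T2P :: complex poly3)" "prime_elem (FLP :: complex poly3)"
  "prime_elem (varX :: complex poly3)"
proof -
  \<comment> \<open>Each form is monic of degree one in the outermost variable that it contains,
    which reduces primality to \<open>prime_elem_linear\<close>.\<close>
  have "LP = [:[:[:0, 1:], 1:], 1 :: complex poly poly:]"
    "T1P = [:[:[:0, 4:], -5:], 1 :: complex poly poly:]"
    "T2P = [:[:[:0, 1:], -2:], 1 :: complex poly poly:]"
    "FLP = [:[:[:0, -2:], 1 :: complex poly:]:]"
    by (simp_all add: form_defs varX_def varY_def varZ_def numeral_poly one_pCons)
  then show "prime_elem (LP :: complex poly3)" "prime_elem (T1P :: complex poly3)"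
    "prime_elem (T2P :: complex poly3)" "prime_elem (FLP :: complex poly3)"
    "prime_elem (varX :: complex poly3)"
    by (simp_all only: varX_def prime_elem_linear prime_elem_const_poly_iff)
qed

text \<open>The divisor \<open>c\<close> may be any element: \<open>p\<close> divides the quotient
  of \<open>p * f\<close> by \<open>c\<close>, and cancels. This makes it applicable to
  \<open>CP\<close>, with the linear forms in the role of \<open>p\<close>.\<close>

lemma prime_elem_cancel:
  fixes p c f :: "'a::idom"
  assumes "prime_elem p" "\<not> p dvd c" "c dvd p * f"
  shows "c dvd f"
proof -
  from assms(3) obtain q where q: "p * f = c * q" by (elim dvdE)
  then have "p dvd q" using assms(1,2) by (metis dvd_triv_left prime_elem_dvd_mult_iff)
  then obtain r where "q = p * r" by (elim dvdE)
  with q have "p * f = p * (c * r)" by (simp add: mult_ac)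
  then show ?thesis using assms(1) by (auto simp: prime_elem_def)
qed

lemma dvd_const3_cancel:
  fixes p :: "complex poly3"
  assumes "c \<noteq> 0" "p dvd const3 c * f"
  shows "p dvd f"
proof -
  have "f = const3 (1 / c) * (const3 c * f)"
    using assms(1) by (simp add: mult.assoc[symmetric] const3_simps flip: const3_simps(2))
  then show ?thesis using assms(2) by (metis dvd_mult)
qed

lemma dvd_numeral_cancel: "p dvd numeral n * f \<Longrightarrow> p dvd f" for p :: "complex poly3"
  using dvd_const3_cancel[of "numeral n" p f] by (simp add: const3_simps)

lemma cubic_poly_neq_0: "CP \<noteq> (0 :: complex poly3)"
proof
  assume "CP = (0 :: complex poly3)"
  then have "eval3 CP (vector [-1, 1, 0]) = (0 :: complex)"
    by (simp only: eval3_simps)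
  then show False by (simp add: cubic_def)
qed

lemma cubic_dvd_line_mult: "CP dvd LP * f \<Longrightarrow> CP dvd f" for f :: "complex poly3"
  by (rule prime_elem_cancel[OF prime_forms(1)])
     (rule not_dvd_eval3[of _ "vector [-1, 1, 0]"], simp_all add: form_defs)

lemma cubic_dvd_tangents_mult:
  fixes f :: "complex poly3"
  assumes "CP dvd T1P * T2P * FLP * f"
  shows "CP dvd f"
proof -
  have "CP dvd T1P * (T2P * (FLP * f))" using assms by (simp add: mult_ac)
  moreover have "\<not> T1P dvd (CP :: complex poly3)"
    by (rule not_dvd_eval3[of _ "vector [1, 0, -4]"]) (simp_all add: form_defs)
  ultimately have "CP dvd T2P * (FLP * f)" by (metis prime_elem_cancel prime_forms(2))
  moreover have "\<not> T2P dvd (CP :: complex poly3)"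
    by (rule not_dvd_eval3[of _ "vector [1, 0, -1]"]) (simp_all add: form_defs)
  ultimately have "CP dvd FLP * f" by (metis prime_elem_cancel prime_forms(3))
  moreover have "\<not> FLP dvd (CP :: complex poly3)"
    by (rule not_dvd_eval3[of _ "vector [1, 2, 0]"]) (simp_all add: form_defs)
  ultimately show ?thesis by (metis prime_elem_cancel prime_forms(4))
qed

text \<open>Modulo the cubic, the cofactor is a scalar multiple of \<open>LP\<^sup>2 * HP\<close>, and \<open>HP\<close> is one of the
  product of the tangents and the flex line.\<close>

lemma cubic_dvd_cofactor_mult:
  fixes f :: "complex poly3"
  assumes "CP dvd KP * f"
  shows "CP dvd f"
proof -
  have "9 * (LP * (LP * (HP * f))) = 4 * (KP * f) - CP * (QP * f)"
    using cofactor_mod_cubic[of varX varY "varZ :: complex poly3"] by algebra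
  moreover have "CP dvd 4 * (KP * f) - CP * (QP * f)"
    using assms by simp
  ultimately have "CP dvd 9 * (LP * (LP * (HP * f)))" by simp
  then have H: "CP dvd HP * f"
    using cubic_dvd_line_mult dvd_numeral_cancel by metis
  have "72 * (T1P * T2P * FLP * f) = - (HP * f) - CP * (54 * f)" 
    using arg_cong[OF hess_cubic_eq_tangents[of varX varY "varZ :: complex poly3"], of "\<lambda>x. x * f"]
      arg_cong[OF cubic_eq_tangents[of varX varY "varZ :: complex poly3"], of "\<lambda>x. x * f"]
    by algebra
  then have "CP dvd 72 * (T1P * T2P * FLP * f)" using H by simp
  then show ?thesis using cubic_dvd_tangents_mult dvd_numeral_cancel by metis
qed

section \<open>The saturation of the ideal of flexes\<close>

abbreviation FP :: "complex poly poly3" where "FP \<equiv> LP * CP - svar * varX ^ 4"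
abbreviation HF :: "complex poly poly3" where "HF \<equiv> LP * KP - 12 * svar * varX ^ 2 * MP"

definition sat_ideal :: "complex poly poly3 set" where
  "sat_ideal = {FP * u + HF * v + varX ^ 2 * NP * w |u v w. True}"

definition limit_poly_ideal :: "complex poly3 set" where
  "limit_poly_ideal = {LP * CP * u + LP * KP * v + varX ^ 2 * NP * w |u v w. True}"

lemma G_family_eq: "G_family = FP"
  by (simp add: G_family_def G_eq)

lemma hessian_G_family: "hessian G_family = HF"
  unfolding G_family_def hessian_family ..

text \<open>All syzygies of the generators at \<open>s = 0\<close> lift. They are spanned by
  \<open>(12 X^2 M, - X^4, L)\<close> and \<open>(- K, C, 0)\<close>. Applied to
  \<open>(F, H, X^2 N)\<close>, the first still gives 0 and the second gives \<open>s X^2 N\<close>,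
  which is \<open>s\<close> times an element of the ideal.\<close>

lemma sat_ideal_saturated:
  assumes "svar * f \<in> sat_ideal"
  shows "f \<in> sat_ideal"
proof -
  from assms obtain u v w where f: "svar * f = FP * u + HF * v + varX ^ 2 * NP * w"
    by (auto simp: sat_ideal_def)
  obtain u' where u: "u = lift (fiber u 0) + svar * u'" by (rule eq_lift_fiber)
  obtain v' where v: "v = lift (fiber v 0) + svar * v'" by (rule eq_lift_fiber)
  obtain w' where w: "w = lift (fiber w 0) + svar * w'" by (rule eq_lift_fiber)
  define u0 v0 w0 where "u0 = fiber u 0" and "v0 = fiber v 0" and "w0 = fiber w 0"
  have 0: "LP * (CP * u0 + KP * v0) + varX ^ 2 * NP * w0 = 0"
    using arg_cong[OF f, of "\<lambda>f. fiber f 0"] by (simp add: u0_def v0_def w0_def const3_simps algebra_simps)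
  then have "LP dvd varX ^ 2 * NP * w0"
    by (metis add_diff_cancel_left' dvd_0_right dvd_diff dvd_triv_left)
  moreover have "\<not> LP dvd (varX ^ 2 * NP :: complex poly3)"
    by (rule not_dvd_eval3[of _ "vector [-1, 1, 0]"]) (simp_all add: form_defs)
  ultimately have "LP dvd w0"
    using prime_forms(1) prime_elem_dvd_mult_iff by blast
  then obtain w1 where w1: "w0 = LP * w1" by (elim dvdE)
  have "LP * (CP * u0 + KP * v0 + varX ^ 2 * NP * w1) = 0"
    using 0 w1 by (simp add: algebra_simps)
  then have "CP * u0 + KP * v0 + varX ^ 2 * NP * w1 = 0"
    using prime_forms(1) by (auto simp: prime_elem_def)
  \<comment> \<open>Expanding \<open>N = X^2 K - 12 M C\<close> turns the relation into one between
    \<open>C\<close> and \<open>K\<close> alone.\<close>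
  then have 1: "CP * (u0 - 12 * varX ^ 2 * MP * w1) + KP * (v0 + varX ^ 4 * w1) = 0"
    unfolding residual_def by algebra
  then have "CP dvd KP * (v0 + varX ^ 4 * w1)"
    by (metis add_diff_cancel_left' dvd_0_right dvd_diff dvd_triv_left)
  then have "CP dvd v0 + varX ^ 4 * w1" by (rule cubic_dvd_cofactor_mult)
  then obtain w2 where w2: "v0 + varX ^ 4 * w1 = CP * w2" by (elim dvdE)
  have "CP * (u0 - 12 * varX ^ 2 * MP * w1 + KP * w2) = 0"
    using 1 unfolding w2 by (simp add: algebra_simps)
  moreover have "CP \<noteq> (0 :: complex poly3)"
    by (rule cubic_poly_neq_0)
  ultimately have "u0 - 12 * varX ^ 2 * MP * w1 + KP * w2 = 0"
    by (metis mult_eq_0_iff)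
  then have u0: "u0 = 12 * varX ^ 2 * MP * w1 - KP * w2"
    by algebra
  have v0: "v0 = CP * w2 - varX ^ 4 * w1"
    using w2 by (simp add: algebra_simps)
  \<comment> \<open>The terms with \<open>w1\<close> cancel, and those with \<open>w2\<close>
    combine to \<open>C H - K F = s X^2 N\<close>; this is the origin of the summand
    \<open>lift w2\<close>.\<close>
  have "svar * f = svar * (FP * u' + HF * v' + varX ^ 2 * NP * (w' + lift w2))"
    unfolding f
    by (subst u, subst v, subst w, fold u0_def v0_def w0_def)
       (simp add: u0 v0 w1 residual_def, algebra)
  moreover have "svar \<noteq> 0"
    by (simp add: const3_def)
  ultimately have "f = FP * u' + HF * v' + varX ^ 2 * NP * (w' + lift w2)"
    by (metis mult_left_cancel)
  then show ?thesis by (auto simp: sat_ideal_def)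
qed

lemma sat_ideal_add: "a \<in> sat_ideal \<Longrightarrow> b \<in> sat_ideal \<Longrightarrow> a + b \<in> sat_ideal"
proof -
  assume "a \<in> sat_ideal" "b \<in> sat_ideal"
  then obtain u v w u' v' w' where ab: "a = FP * u + HF * v + varX ^ 2 * NP * w"
    "b = FP * u' + HF * v' + varX ^ 2 * NP * w'" by (auto simp: sat_ideal_def)
  have "a + b = FP * (u + u') + HF * (v + v') + varX ^ 2 * NP * (w + w')"
    unfolding ab by (simp add: algebra_simps)
  then show ?thesis unfolding sat_ideal_def by blast
qed

lemma sat_ideal_mult: "a \<in> sat_ideal \<Longrightarrow> b * a \<in> sat_ideal"
proof -
  assume "a \<in> sat_ideal"
  then obtain u v w where a: "a = FP * u + HF * v + varX ^ 2 * NP * w"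
    by (auto simp: sat_ideal_def)
  have "b * a = FP * (b * u) + HF * (b * v) + varX ^ 2 * NP * (b * w)"
    unfolding a by (simp add: algebra_simps)
  then show ?thesis unfolding sat_ideal_def by blast
qed

lemma fiber_sat_ideal: "a \<in> sat_ideal \<Longrightarrow> fiber a 0 \<in> limit_poly_ideal"
  unfolding sat_ideal_def limit_poly_ideal_def
  by (auto simp: const3_simps) blast

lemma sat_ideal_power:
  assumes "svar ^ k * f \<in> sat_ideal"
  shows "f \<in> sat_ideal"
  using assms by (induction k) (auto simp: mult.assoc intro: sat_ideal_saturated)

section \<open>Points\<close>

lemma rep_proj2_neq_0: "rep_proj2 p \<noteq> 0"
  using Quotient3_rep_reflp[OF Quotient3_proj2, of p] by simp

lemma vector3_eta: "vector [v $ 1, v $ 2, v $ 3] = (v :: 'a::zero ^ 3)"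
  by (simp add: vec_eq_iff forall_3)

lemma pt_rep_proj2: "pt (rep_proj2 p $ 1) (rep_proj2 p $ 2) (rep_proj2 p $ 3) = p"
  by (simp add: pt_def vector3_eta Quotient3_abs_rep[OF Quotient3_proj2])

lemma pt_eq_iff:
  assumes "a \<noteq> 0 \<or> b \<noteq> 0 \<or> c \<noteq> 0" "a' \<noteq> 0 \<or> b' \<noteq> 0 \<or> c' \<noteq> 0"
  shows "pt a b c = pt a' b' c' \<longleftrightarrow> (\<exists>k. k \<noteq> 0 \<and> a' = k * a \<and> b' = k * b \<and> c' = k * c)"
proof -
  let ?v = "vector [a, b, c] :: complex^3" and ?w = "vector [a', b', c'] :: complex^3"
  have "?v \<noteq> 0" "?w \<noteq> 0"
    using assms by (auto simp: vec_eq_iff forall_3)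
  moreover have "v \<noteq> 0 \<and> (\<exists>k. k \<noteq> 0 \<and> v = k *s v)" if "v \<noteq> 0" for v :: "complex^3"
    using that by (auto intro!: exI[of _ 1])
  ultimately have "pt a b c = pt a' b' c' \<longleftrightarrow> (\<exists>k. k \<noteq> 0 \<and> ?w = k *s ?v)"
    using Quotient3_rel[OF Quotient3_proj2, of ?v ?w] unfolding pt_def by blast
  then show ?thesis
    by (simp add: vec_eq_iff forall_3)
qed

lemma rep_pt:
  assumes "a \<noteq> 0 \<or> b \<noteq> 0 \<or> c \<noteq> 0"
  obtains k where "k \<noteq> 0" "rep_proj2 (pt a b c) $ 1 = k * a" "rep_proj2 (pt a b c) $ 2 = k * b"
    "rep_proj2 (pt a b c) $ 3 = k * c"
proof -
  let ?w = "rep_proj2 (pt a b c)"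
  have "?w $ 1 \<noteq> 0 \<or> ?w $ 2 \<noteq> 0 \<or> ?w $ 3 \<noteq> 0"
    using rep_proj2_neq_0[of "pt a b c"] by (auto simp: vec_eq_iff forall_3)
  then show thesis
    using pt_eq_iff[OF assms, of "?w $ 1" "?w $ 2" "?w $ 3"] pt_rep_proj2[of "pt a b c"] that
    by auto
qed

section \<open>Stalks\<close>

definition local_denom :: "proj2 \<Rightarrow> nat \<Rightarrow> complex poly poly3 \<Rightarrow> bool" where
  "local_denom p d b \<longleftrightarrow> homogeneous d b \<and> \<not> vanishes_at (fiber b 0) p"

lemma local_denom_neq_0: "local_denom p d b \<Longrightarrow> b \<noteq> 0"
  by (auto simp: local_denom_def vanishes_at_def)

lemma local_denom_mult: "local_denom p d b \<Longrightarrow> local_denom p e c \<Longrightarrow> local_denom p (d + e) (b * c)"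
  by (simp add: local_denom_def vanishes_at_def homogeneous_mult)

lemma local_denom_one: "local_denom p 0 1"
  by (simp add: local_denom_def vanishes_at_def)

text \<open>Common form of \<open>local_ring\<close> (with \<open>I = UNIV\<close>),
  \<open>flex_ideal\<close> and the closure ideal, so that sums and products of fractions are
  treated once.\<close>

definition stalk :: "complex poly poly3 set \<Rightarrow> proj2 \<Rightarrow> funfield set" where
  "stalk I p = {Fraction_Field.Fract a b |a b d. homogeneous d a \<and> local_denom p d b \<and> a \<in> I}"

lemma stalkI: "homogeneous d a \<Longrightarrow> local_denom p d b \<Longrightarrow> a \<in> I \<Longrightarrow> Fraction_Field.Fract a b \<in> stalk I p"
  by (auto simp: stalk_def)

lemma stalkE:
  assumes "f \<in> stalk I p"
  obtains a b d where "f = Fraction_Field.Fract a b" "homogeneous d a" "local_denom p d b" "a \<in> I"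
  using assms by (auto simp: stalk_def)

lemma local_ring_eq: "local_ring p = stalk UNIV p"
  by (auto simp: local_ring_def stalk_def local_denom_def)

lemma flex_ideal_eq: "flex_ideal F p = stalk {u * F + v * hessian F |u v. True} p"
  by (auto simp: flex_ideal_def stalk_def local_denom_def)

lemma stalk_add:
  assumes I: "\<And>a b. a \<in> I \<Longrightarrow> b \<in> I \<Longrightarrow> a + b \<in> I" "\<And>a b. a \<in> I \<Longrightarrow> b * a \<in> I"
    and "f \<in> stalk I p" "g \<in> stalk I p"
  shows "f + g \<in> stalk I p"
proof -
  from assms obtain a b d a' b' d' where f: "f = Fraction_Field.Fract a b" "homogeneous d a"
    "local_denom p d b" "a \<in> I" and g: "g = Fraction_Field.Fract a' b'" "homogeneous d' a'"
    "local_denom p d' b'" "a' \<in> I" by (auto elim!: stalkE)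
  have "f + g = Fraction_Field.Fract (a * b' + a' * b) (b * b')"
    using f g by (simp add: local_denom_neq_0)
  moreover have "homogeneous (d + d') (a * b' + a' * b)"
    using homogeneous_mult[of d a d' b'] homogeneous_mult[of d' a' d b] f g
    by (intro homogeneous_add) (auto simp: local_denom_def add.commute)
  moreover have "a * b' + a' * b \<in> I"
    using I(1)[OF I(2)[OF f(4), of b'] I(2)[OF g(4), of b]] by (simp add: mult.commute)
  ultimately show ?thesis
    using local_denom_mult[OF f(3) g(3)] by (auto intro: stalkI)
qed

lemma stalk_mult:
  assumes I: "\<And>a b. a \<in> I \<Longrightarrow> b * a \<in> I" and "f \<in> local_ring p" "g \<in> stalk I p"
  shows "f * g \<in> stalk I p"
proof -
  from assms(2) obtain a b d where f: "f = Fraction_Field.Fract a b" "homogeneous d a"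
    "local_denom p d b" unfolding local_ring_eq by (auto elim!: stalkE)
  from assms(3) obtain a' b' d' where g: "g = Fraction_Field.Fract a' b'" "homogeneous d' a'"
    "local_denom p d' b'" "a' \<in> I" by (auto elim!: stalkE)
  have "f * g = Fraction_Field.Fract (a * a') (b * b')"
    using f g by simp
  then show ?thesis
    using f g I local_denom_mult[OF f(3) g(3)] homogeneous_mult[OF f(2) g(2)] by (auto intro: stalkI)
qed

lemma local_ring_add: "f \<in> local_ring p \<Longrightarrow> g \<in> local_ring p \<Longrightarrow> f + g \<in> local_ring p"
  unfolding local_ring_eq by (rule stalk_add) auto

lemma local_ring_mult: "f \<in> local_ring p \<Longrightarrow> g \<in> local_ring p \<Longrightarrow> f * g \<in> local_ring p"
  using stalk_mult[of UNIV f p g] by (simp add: local_ring_eq)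

lemma local_ringI: "homogeneous d a \<Longrightarrow> local_denom p d b \<Longrightarrow> Fraction_Field.Fract a b \<in> local_ring p"
  unfolding local_ring_eq by (rule stalkI) auto

lemma local_ringE:
  assumes "f \<in> local_ring p"
  obtains a b d where "f = Fraction_Field.Fract a b" "homogeneous d a" "local_denom p d b"
  using assms unfolding local_ring_eq by (auto elim: stalkE)

definition cst :: "complex \<Rightarrow> funfield" where
  "cst c = Fraction_Field.Fract (const3 [:c:]) 1"

lemma scale_eq: "scale c f = cst c * f"
  by (simp add: scale_def cst_def)

lemma cst_simps: "cst (a + b) = cst a + cst b" "cst (a * b) = cst a * cst b" "cst 0 = 0" "cst 1 = 1"
  "cst (a - b) = cst a - cst b" "cst (- a) = - cst a"
proof -
  have *: "[:a + b:] = [:a:] + [:b:]" "[:a * b:] = [:a:] * [:b:]" "[:a - b:] = [:a:] - [:b:]"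
    "[:- a:] = - [:a:]" by simp_all
  show "cst (a + b) = cst a + cst b" "cst (a * b) = cst a * cst b" "cst 0 = 0" "cst 1 = 1"
    "cst (a - b) = cst a - cst b" "cst (- a) = - cst a"
    unfolding cst_def * const3_simps(1-4) 
    by (simp_all add: const3_simps Zero_fract_def One_fract_def flip: one_pCons)
qed

lemma cst_local_ring [simp]: "cst c \<in> local_ring p"
  unfolding cst_def by (rule local_ringI[of 0]) (auto simp: local_denom_one)

lemma one_local_ring [simp]: "1 \<in> local_ring p"
  using cst_local_ring[of 1] by (simp add: cst_simps)

lemma zero_local_ring [simp]: "0 \<in> local_ring p"
  using cst_local_ring[of 0] by (simp add: cst_simps)

lemma local_ring_diff: "f \<in> local_ring p \<Longrightarrow> g \<in> local_ring p \<Longrightarrow> f - g \<in> local_ring p"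
  using local_ring_add[of f p "cst (- 1) * g"] local_ring_mult[OF cst_local_ring, of g p "- 1"]
  by (simp add: cst_simps(4,6))

lemma local_ring_power: "f \<in> local_ring p \<Longrightarrow> f ^ n \<in> local_ring p"
  by (induction n) (auto intro: local_ring_mult)

lemma param_power_mult:
  "param ^ k * Fraction_Field.Fract a b = Fraction_Field.Fract (svar ^ k * a) b"
  by (induction k) (simp_all add: param_def mult.assoc)

lemma closure_ideal_G_family: "closure_ideal G_family p = stalk sat_ideal p"
proof (intro set_eqI iffI)
  fix f assume "f \<in> closure_ideal G_family p"
  then obtain k where "f \<in> local_ring p" and
    k: "param ^ k * f \<in> stalk {u * FP + v * HF |u v. True} p"
    by (auto simp: closure_ideal_def flex_ideal_eq hessian_G_family, simp add: G_family_eq)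
  from this(1) obtain a b d where f: "f = Fraction_Field.Fract a b" "homogeneous d a"
    "local_denom p d b" by (rule local_ringE)
  from k obtain a' b' d' u v where g: "param ^ k * f = Fraction_Field.Fract a' b'"
    "homogeneous d' a'" "local_denom p d' b'" "a' = u * FP + v * HF" by (auto elim!: stalkE)
  have nz: "b \<noteq> 0" "b' \<noteq> 0"
    using f g local_denom_neq_0 by auto
  have "svar ^ k * (a * b') = b * a'"
    using g(1) nz unfolding f(1) param_power_mult by (simp add: eq_fract mult_ac)
  also have "b * a' \<in> sat_ideal"
  proof (rule sat_ideal_mult)
    have "a' = FP * u + HF * v + varX ^ 2 * NP * 0"
      by (simp add: g(4) mult.commute)
    then show "a' \<in> sat_ideal"
      unfolding sat_ideal_def by blast
  qed
  finally have "a * b' \<in> sat_ideal" by (rule sat_ideal_power)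
  moreover have "f = Fraction_Field.Fract (a * b') (b * b')"
    using nz by (simp add: f eq_fract)
  moreover have "homogeneous (d + d') (a * b')"
    using f g by (auto simp: local_denom_def intro: homogeneous_mult)
  ultimately show "f \<in> stalk sat_ideal p"
    using local_denom_mult[OF f(3) g(3)] by (auto intro: stalkI)
next
  fix f assume "f \<in> stalk sat_ideal p"
  then obtain a b d where f: "f = Fraction_Field.Fract a b" "homogeneous d a"
    "local_denom p d b" "a \<in> sat_ideal" by (rule stalkE)
  from f(4) obtain u v w where a: "a = FP * u + HF * v + varX ^ 2 * NP * w"
    by (auto simp: sat_ideal_def)
  \<comment> \<open>A single power of \<open>s\<close> suffices, because
    \<open>s X^2 N = C H - K F\<close>.\<close>
  have "svar * a = (svar * u - KP * w) * FP + (svar * v + CP * w) * HF"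
    unfolding a residual_def by algebra
  moreover have "homogeneous d (svar * a)"
    using f(2) by (rule homogeneous_const3_mult)
  ultimately have "Fraction_Field.Fract (svar * a) b \<in> stalk {u * FP + v * HF |u v. True} p"
    using f(3) by (intro stalkI) auto
  then have "param ^ 1 * f \<in> flex_ideal G_family p"
    by (simp add: param_power_mult[of 1, simplified] f(1) flex_ideal_eq hessian_G_family, simp add: G_family_eq)
  moreover have "f \<in> local_ring p" using f by (auto intro: local_ringI)
  ultimately show "f \<in> closure_ideal G_family p"
    unfolding closure_ideal_def by blast
qed

section \<open>The limit ideal\<close>

abbreviation limit_stalk :: "proj2 \<Rightarrow> funfield set" where
  "limit_stalk \<equiv> limit_ideal G_family"

lemma limit_stalk_eq:
  "limit_stalk p = {f + param * g |f g. f \<in> stalk sat_ideal p \<and> g \<in> local_ring p}"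
  by (simp add: limit_ideal_def closure_ideal_G_family)

lemma limit_stalk_add: "f \<in> limit_stalk p \<Longrightarrow> g \<in> limit_stalk p \<Longrightarrow> f + g \<in> limit_stalk p"
proof -
  assume "f \<in> limit_stalk p" "g \<in> limit_stalk p"
  then obtain f1 f2 g1 g2 where *: "f = f1 + param * f2" "g = g1 + param * g2"
    "f1 \<in> stalk sat_ideal p" "g1 \<in> stalk sat_ideal p" "f2 \<in> local_ring p" "g2 \<in> local_ring p"
    by (auto simp: limit_stalk_eq)
  then have "f + g = (f1 + g1) + param * (f2 + g2)" by (simp add: algebra_simps)
  then show ?thesis
    using * stalk_add[OF sat_ideal_add sat_ideal_mult] local_ring_add
    unfolding limit_stalk_eq by blast
qed

lemma limit_stalk_mult: "f \<in> local_ring p \<Longrightarrow> g \<in> limit_stalk p \<Longrightarrow> f * g \<in> limit_stalk p"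
proof -
  assume f: "f \<in> local_ring p" and "g \<in> limit_stalk p"
  then obtain g1 g2 where *: "g = g1 + param * g2" "g1 \<in> stalk sat_ideal p" "g2 \<in> local_ring p"
    by (auto simp: limit_stalk_eq)
  then have "f * g = f * g1 + param * (f * g2)" by (simp add: algebra_simps)
  then show ?thesis
    using * f stalk_mult[OF sat_ideal_mult] local_ring_mult
    unfolding limit_stalk_eq by blast
qed

lemma stalk_sat_ideal_subset: "f \<in> stalk sat_ideal p \<Longrightarrow> f \<in> limit_stalk p"
  unfolding limit_stalk_eq using zero_local_ring[of p] by force

lemma zero_stalk_sat_ideal: "0 \<in> stalk sat_ideal p"
proof -
  have "(0 :: complex poly poly3) = FP * 0 + HF * 0 + varX ^ 2 * NP * 0" by simp
  then have "0 \<in> sat_ideal" unfolding sat_ideal_def by blast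
  then have "Fraction_Field.Fract 0 1 \<in> stalk sat_ideal p"
    by (intro stalkI[of 0]) (auto simp: local_denom_one)
  then show ?thesis by (simp add: Zero_fract_def)
qed

lemma zero_limit_stalk [simp]: "0 \<in> limit_stalk p"
  by (rule stalk_sat_ideal_subset[OF zero_stalk_sat_ideal])

lemma param_mult_limit_stalk: "f \<in> local_ring p \<Longrightarrow> param * f \<in> limit_stalk p"
  unfolding limit_stalk_eq using zero_stalk_sat_ideal[of p] by force

lemma limit_stalk_uminus: "f \<in> limit_stalk p \<Longrightarrow> - f \<in> limit_stalk p"
  using limit_stalk_mult[OF cst_local_ring, of f p "- 1"] by (simp add: cst_simps(4,6))

lemma limit_stalk_diff: "f \<in> limit_stalk p \<Longrightarrow> g \<in> limit_stalk p \<Longrightarrow> f - g \<in> limit_stalk p"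
  using limit_stalk_add[of f p "- g"] limit_stalk_uminus[of g p] by simp

lemma limit_poly_ideal_mult: "a \<in> limit_poly_ideal \<Longrightarrow> b * a \<in> limit_poly_ideal"
proof -
  assume "a \<in> limit_poly_ideal"
  then obtain u v w where a: "a = LP * CP * u + LP * KP * v + varX ^ 2 * NP * w"
    by (auto simp: limit_poly_ideal_def)
  have "b * a = LP * CP * (b * u) + LP * KP * (b * v) + varX ^ 2 * NP * (b * w)"
    unfolding a by (simp add: algebra_simps)
  then show ?thesis unfolding limit_poly_ideal_def by blast
qed

text \<open>The source of all lower bounds on lengths: after clearing denominators and setting
  \<open>s = 0\<close>, the denominators merge into a polynomial \<open>g\<close> that is a unit at
  \<open>p\<close>.\<close>

lemma limit_stalk_fiber:
  assumes "Fraction_Field.Fract (lift a) b \<in> limit_stalk p" "local_denom p d b"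
  obtains g where "eval3 g (rep_proj2 p) \<noteq> 0" "g * a \<in> limit_poly_ideal"
proof -
  from assms(1) obtain f h where fh: "Fraction_Field.Fract (lift a) b = f + param * h"
    "f \<in> stalk sat_ideal p" "h \<in> local_ring p" by (auto simp: limit_stalk_eq)
  obtain a1 b1 d1 where f: "f = Fraction_Field.Fract a1 b1" "local_denom p d1 b1" "a1 \<in> sat_ideal"
    using fh(2) by (auto elim!: stalkE)
  obtain a2 b2 d2 where h: "h = Fraction_Field.Fract a2 b2" "local_denom p d2 b2"
    using fh(3) by (auto elim!: local_ringE)
  have nz: "b \<noteq> 0" "b1 \<noteq> 0" "b2 \<noteq> 0"
    using assms f h local_denom_neq_0 by auto
  have "lift a * (b1 * b2) = (a1 * b2 + svar * a2 * b1) * b"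
    using fh(1) nz by (simp add: f h param_def eq_fract)
  from arg_cong[OF this, of "\<lambda>f. fiber f 0"]
  have "(fiber b1 0 * fiber b2 0) * a = (fiber b2 0 * fiber b 0) * fiber a1 0"
    by (simp add: const3_simps mult_ac)
  also have "\<dots> \<in> limit_poly_ideal"
    by (rule limit_poly_ideal_mult[OF fiber_sat_ideal[OF f(3)]])
  finally show thesis
    using f(2) h(2) by (intro that) (auto simp: local_denom_def vanishes_at_def)
qed

text \<open>For homogeneous polynomials without the parameter, membership in the limit ideal does not
  depend on the denominator, so that all local computations can be done in \<open>\<complex>[X, Y, Z]\<close>.\<close>

definition in_limit :: "proj2 \<Rightarrow> nat \<Rightarrow> complex poly3 \<Rightarrow> bool" where
  "in_limit p d a \<longleftrightarrow> homogeneous d a \<and>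
     (\<exists>b. local_denom p d b \<and> Fraction_Field.Fract (lift a) b \<in> limit_stalk p)"

lemma in_limitD:
  assumes "in_limit p d a" "local_denom p d b"
  shows "Fraction_Field.Fract (lift a) b \<in> limit_stalk p"
proof -
  obtain c where c: "local_denom p d c" "Fraction_Field.Fract (lift a) c \<in> limit_stalk p"
    using assms(1) by (auto simp: in_limit_def)
  have "Fraction_Field.Fract (lift a) b = Fraction_Field.Fract c b * Fraction_Field.Fract (lift a) c"
    using assms(2) c(1) by (simp add: eq_fract local_denom_neq_0)
  moreover have "Fraction_Field.Fract c b \<in> local_ring p"
    using assms(2) c(1) by (auto simp: local_denom_def intro: local_ringI)
  ultimately show ?thesis using c(2) limit_stalk_mult by metis
qed

lemma local_denom_exists: "\<exists>b. local_denom p d b"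
proof -
  have "\<exists>b. local_denom p 1 b"
    using rep_proj2_neq_0[of p] homogeneous_vars
    unfolding local_denom_def vanishes_at_def vec_eq_iff forall_3
    by (metis eval3_simps(10,11,12) fiber_simps(4,5,6) zero_index)
  then obtain b where "local_denom p 1 b" ..
  then have "local_denom p d (b ^ d)"
    using homogeneous_power[of 1 b d] by (auto simp: local_denom_def vanishes_at_def)
  then show ?thesis ..
qed

lemma local_denom_lift:
  "homogeneous d a \<Longrightarrow> eval3 a (rep_proj2 p) \<noteq> 0 \<Longrightarrow> local_denom p d (lift a)"
  by (simp add: local_denom_def homogeneous_lift vanishes_at_def)

lemma in_limit_mult:
  assumes "in_limit p d a" "homogeneous e c"
  shows "in_limit p (e + d) (c * a)"
proof -
  obtain b where b: "local_denom p d b" "Fraction_Field.Fract (lift a) b \<in> limit_stalk p"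
    using assms(1) by (auto simp: in_limit_def)
  obtain b' where b': "local_denom p e b'" using local_denom_exists by blast
  have "Fraction_Field.Fract (lift c) b' * Fraction_Field.Fract (lift a) b \<in> limit_stalk p"
    using b b' assms by (intro limit_stalk_mult) (auto intro!: local_ringI homogeneous_lift)
  then show ?thesis
    using assms local_denom_mult[OF b'(1) b(1)] 
    by (auto simp: in_limit_def homogeneous_mult intro!: exI[of _ "b' * b"])
qed

lemma in_limit_add:
  assumes "in_limit p d a" "in_limit p d c"
  shows "in_limit p d (a + c)"
proof -
  obtain b where b: "local_denom p d b" using local_denom_exists by blast
  have "Fraction_Field.Fract (lift a) b + Fraction_Field.Fract (lift c) b \<in> limit_stalk p"
    using assms b by (intro limit_stalk_add in_limitD)
  also have "Fraction_Field.Fract (lift a) b + Fraction_Field.Fract (lift c) b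
      = Fraction_Field.Fract (lift (a + c)) b"
    using b by (simp add: local_denom_neq_0 eq_fract algebra_simps)
  finally show ?thesis
    using assms b by (auto simp: in_limit_def homogeneous_add)
qed

lemma in_limit_cancel:
  assumes "in_limit p (e + d) (c * a)" "homogeneous e c" "homogeneous d a"
    and c: "eval3 c (rep_proj2 p) \<noteq> 0"
  shows "in_limit p d a"
proof -
  obtain b where b: "local_denom p d b" using local_denom_exists by blast
  have c: "local_denom p e (lift c)" using assms by (simp add: local_denom_lift)
  have "Fraction_Field.Fract (lift (c * a)) (lift c * b) \<in> limit_stalk p"
    using assms(1) local_denom_mult[OF c b] by (rule in_limitD)
  also have "Fraction_Field.Fract (lift (c * a)) (lift c * b) = Fraction_Field.Fract (lift a) b"
    using b c by (simp add: local_denom_neq_0 eq_fract)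
  finally show ?thesis using assms b by (auto simp: in_limit_def)
qed

text \<open>\<open>L C\<close> and \<open>L K\<close> differ from \<open>F\<close> and
  \<open>H\<close> by multiples of \<open>s\<close>, which belong to the limit ideal anyway.\<close>

lemma in_limit_generators:
  "in_limit p 4 (LP * CP)" "in_limit p 6 (LP * KP)" "in_limit p 9 (varX ^ 2 * NP)"
proof -
  have sat: "FP \<in> sat_ideal" "HF \<in> sat_ideal" "varX ^ 2 * NP \<in> sat_ideal"
  proof -
    have "FP = FP * 1 + HF * 0 + varX ^ 2 * NP * 0" "HF = FP * 0 + HF * 1 + varX ^ 2 * NP * 0"
      "varX ^ 2 * NP = FP * 0 + HF * 0 + varX ^ 2 * NP * (1 :: complex poly poly3)" by simp_all
    then show "FP \<in> sat_ideal" "HF \<in> sat_ideal" "varX ^ 2 * NP \<in> sat_ideal"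
      unfolding sat_ideal_def by blast+
  qed
  have hom4: "homogeneous 4 (LP * CP :: 'a::comm_ring_1 poly3)"
    by (rule homogeneous_mult'[OF homogeneous_forms(1,2)]) simp
  have hom6: "homogeneous 6 (LP * KP :: 'a::comm_ring_1 poly3)"
    by (rule homogeneous_mult'[OF homogeneous_forms(1,4)]) simp
  have hom9: "homogeneous 9 (varX ^ 2 * NP :: 'a::comm_ring_1 poly3)"
    by (rule homogeneous_mult'[OF homogeneous_power'[OF homogeneous_vars(1)] homogeneous_residual])
      simp_all
  have gen: "in_limit p d a"
    if "homogeneous d a" "lift a = f + svar * r" "f \<in> sat_ideal" "homogeneous d r" for d a f r
  proof -
    obtain b where b: "local_denom p d b" using local_denom_exists by blast
    have f: "f = lift a - svar * r" using that by simp
    have "homogeneous d f"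
      unfolding f using that by (intro homogeneous_diff homogeneous_lift homogeneous_const3_mult)
    then have "Fraction_Field.Fract f b + param * Fraction_Field.Fract r b \<in> limit_stalk p"
      using that b by (intro limit_stalk_add param_mult_limit_stalk stalk_sat_ideal_subset)
        (auto intro: stalkI local_ringI)
    also have "Fraction_Field.Fract f b + param * Fraction_Field.Fract r b
        = Fraction_Field.Fract (lift a) b"
      using b by (simp add: param_def local_denom_neq_0 eq_fract f algebra_simps)
    finally show ?thesis using that b by (auto simp: in_limit_def)
  qed
  have "homogeneous 4 (varX ^ 4 :: complex poly poly3)"
    by (rule homogeneous_power'[OF homogeneous_vars(1)]) simp
  then show "in_limit p 4 (LP * CP)"
    by (intro gen[OF hom4 _ sat(1)]) auto
  have "homogeneous 6 (12 * varX ^ 2 * MP :: complex poly poly3)"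
    by ((rule homogeneous_intros homogeneous_forms(5) refl | simp)+)
  then show "in_limit p 6 (LP * KP)"
    by (intro gen[OF hom6 _ sat(2)]) (auto simp: mult_ac)
  show "in_limit p 9 (varX ^ 2 * NP)"
    by (intro gen[OF hom9 _ sat(3), of 0]) auto
qed

section \<open>Dimensions of quotients\<close>

lemma has_quotient_dimI:
  assumes b: "\<And>i. i < n \<Longrightarrow> b i \<in> V"
    and diff: "\<And>f g. f \<in> U \<Longrightarrow> g \<in> U \<Longrightarrow> f - g \<in> U"
    and span: "\<And>f. f \<in> V \<Longrightarrow> \<exists>c. f - (\<Sum>i<n. scale (c i) (b i)) \<in> U"
    and indep: "\<And>c i. (\<Sum>i<n. scale (c i) (b i)) \<in> U \<Longrightarrow> i < n \<Longrightarrow> c i = 0"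
  shows "has_quotient_dim V U n"
  unfolding has_quotient_dim_def
proof (intro exI[of _ b] conjI ballI)
  show "b ` {..<n} \<subseteq> V" using b by auto
  fix f assume "f \<in> V"
  then obtain c where c: "f - (\<Sum>i<n. scale (c i) (b i)) \<in> U" using span by blast
  show "\<exists>!c. c \<in> {..<n} \<rightarrow>\<^sub>E UNIV \<and> f - (\<Sum>i<n. scale (c i) (b i)) \<in> U"
  \<comment> \<open>Restriction supplies the default value outside \<open>{..<n}\<close> that
    uniqueness of the coefficient function requires.\<close>
  proof (rule ex1I[of _ "restrict c {..<n}"])
    show "restrict c {..<n} \<in> {..<n} \<rightarrow>\<^sub>E UNIV \<and>
        f - (\<Sum>i<n. scale (restrict c {..<n} i) (b i)) \<in> U"
      using c by auto
    fix d assume d: "d \<in> {..<n} \<rightarrow>\<^sub>E UNIV \<and> f - (\<Sum>i<n. scale (d i) (b i)) \<in> U"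
    have "(\<Sum>i<n. scale (c i - d i) (b i))
        = (f - (\<Sum>i<n. scale (d i) (b i))) - (f - (\<Sum>i<n. scale (c i) (b i)))"
      by (simp add: scale_eq cst_simps left_diff_distrib sum_subtractf)
    also have "\<dots> \<in> U" by (rule diff[OF conjunct2[OF d] c])
    finally have "(\<Sum>i<n. scale (c i - d i) (b i)) \<in> U" .
    from indep[OF this] have "c i = d i" if "i < n" for i
      using that by simp
    then have "d i = restrict c {..<n} i" for i
      using PiE_arb[OF conjunct1[OF d], of i] by (cases "i < n") simp_all
    then show "d = restrict c {..<n}" by (rule ext)
  qed
qed

text \<open>Modulo the limit ideal, \<open>l\<close> generates the maximal ideal at
  \<open>p\<close>, so powers of \<open>l\<close> span the quotient once some power vanishes. The
  element \<open>l\<close> may be nilpotent there, and \<open>l = 0\<close> is the case of a reduced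
  point.\<close>

definition uniformizer :: "proj2 \<Rightarrow> funfield \<Rightarrow> bool" where
  "uniformizer p l \<longleftrightarrow> l \<in> local_ring p \<and>
     (\<forall>f\<in>local_ring p. \<exists>c. \<exists>g\<in>local_ring p. f - (cst c + l * g) \<in> limit_stalk p)"

lemma uniformizer_span:
  assumes "uniformizer p l" "f \<in> local_ring p"
  shows "\<exists>c. \<exists>g\<in>local_ring p. f - ((\<Sum>i<n. cst (c i) * l ^ i) + l ^ n * g) \<in> limit_stalk p"
proof (induction n)
  case 0
  show ?case using assms(2) by (intro exI bexI[of _ f]) auto
next
  case (Suc n)
  then obtain c g where g: "g \<in> local_ring p"
    "f - ((\<Sum>i<n. cst (c i) * l ^ i) + l ^ n * g) \<in> limit_stalk p" by blast
  obtain a h where h: "h \<in> local_ring p" "g - (cst a + l * h) \<in> limit_stalk p"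
    using assms(1) g(1) by (auto simp: uniformizer_def)
  have l: "l ^ n \<in> local_ring p"
    using assms(1) by (simp add: uniformizer_def local_ring_power)
  have comb: "f - ((S + e * L) + (l * L) * h) = (f - (S + L * g)) + L * (g - (e + l * h))" for S L e
    by algebra
  have "(\<Sum>i<Suc n. cst ((c(n := a)) i) * l ^ i) = (\<Sum>i<n. cst (c i) * l ^ i) + cst a * l ^ n"
    by simp
  then have "f - ((\<Sum>i<Suc n. cst ((c(n := a)) i) * l ^ i) + l ^ Suc n * h)
    = (f - ((\<Sum>i<n. cst (c i) * l ^ i) + l ^ n * g)) + l ^ n * (g - (cst a + l * h))"
    by (simp only: comb power_Suc)
  also have "\<dots> \<in> limit_stalk p"
    by (rule limit_stalk_add[OF g(2) limit_stalk_mult[OF l h(2)]])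
  finally show ?case
    by (rule_tac exI[of _ "c(n := a)"], rule_tac bexI[OF _ h(1)])
qed

text \<open>For independence, let \<open>j\<close> be the first index with nonzero coefficient.
  Multiplication by \<open>l ^ (m - j)\<close> pushes all later terms to exponents above
  \<open>m\<close>, where they vanish, and leaves \<open>c j\<close> times
  \<open>l ^ m\<close>.\<close>

lemma has_quotient_dim_powers:
  assumes l: "uniformizer p l" and n: "l ^ Suc m \<in> limit_stalk p" "l ^ m \<notin> limit_stalk p"
  shows "has_quotient_dim (local_ring p) (limit_stalk p) (Suc m)"
proof (rule has_quotient_dimI[of _ "\<lambda>i. l ^ i"])
  have lV: "l \<in> local_ring p" using l by (simp add: uniformizer_def)
  have high: "l ^ k \<in> limit_stalk p" if "k \<ge> Suc m" for k
  proof -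
    have "l ^ (k - Suc m) * l ^ Suc m \<in> limit_stalk p"
      using lV n by (intro limit_stalk_mult local_ring_power)
    then show ?thesis using that by (simp flip: power_add del: power_Suc)
  qed
  show "l ^ i \<in> local_ring p" for i using lV by (rule local_ring_power)
  show "\<exists>c. f - (\<Sum>i<Suc m. scale (c i) (l ^ i)) \<in> limit_stalk p" if f: "f \<in> local_ring p" for f
  proof -
    obtain c g where g: "g \<in> local_ring p"
      "f - ((\<Sum>i<Suc m. cst (c i) * l ^ i) + l ^ Suc m * g) \<in> limit_stalk p"
      using uniformizer_span[OF l f] by blast
    have "(f - ((\<Sum>i<Suc m. cst (c i) * l ^ i) + l ^ Suc m * g)) + g * l ^ Suc m \<in> limit_stalk p"
      using g n by (intro limit_stalk_add limit_stalk_mult)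
    then show ?thesis by (intro exI[of _ c]) (simp add: scale_eq algebra_simps)
  qed
  show "c i = 0" if "(\<Sum>i<Suc m. scale (c i) (l ^ i)) \<in> limit_stalk p" "i < Suc m" for c i
    using that(2)
  proof (induction i rule: less_induct)
    case (less j)
    show ?case
    proof (rule ccontr)
      assume cj: "c j \<noteq> 0"
      have "l ^ (m - j) * (\<Sum>i<Suc m. scale (c i) (l ^ i)) \<in> limit_stalk p"
        using lV that by (intro limit_stalk_mult local_ring_power)
      also have "l ^ (m - j) * (\<Sum>i<Suc m. scale (c i) (l ^ i))
        = (\<Sum>i<Suc m. cst (c i) * l ^ (m - j + i))"
        by (simp add: sum_distrib_left scale_eq power_add mult_ac del: sum.lessThan_Suc)
      also have "\<dots> = cst (c j) * l ^ m + (\<Sum>i\<in>{..<Suc m} - {j}. cst (c i) * l ^ (m - j + i))"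
        using less.prems by (subst sum.remove[of _ j]) auto
      finally have 1: "cst (c j) * l ^ m + (\<Sum>i\<in>{..<Suc m} - {j}. cst (c i) * l ^ (m - j + i))
        \<in> limit_stalk p" .
      have sum: "sum h A \<in> limit_stalk p" if "\<And>i. i \<in> A \<Longrightarrow> h i \<in> limit_stalk p"
        for h :: "nat \<Rightarrow> funfield" and A
        using that by (induction A rule: infinite_finite_induct) (auto intro: limit_stalk_add)
      have "(\<Sum>i\<in>{..<Suc m} - {j}. cst (c i) * l ^ (m - j + i)) \<in> limit_stalk p"
      proof (rule sum)
        fix i assume i: "i \<in> {..<Suc m} - {j}"
        show "cst (c i) * l ^ (m - j + i) \<in> limit_stalk p"
        proof (cases "i < j")
          case True
          then show ?thesis using less by (simp add: cst_simps)
        next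
          case False
          then show ?thesis using i less.prems by (intro limit_stalk_mult high) auto
        qed
      qed
      from limit_stalk_diff[OF 1 this] have "cst (c j) * l ^ m \<in> limit_stalk p" by simp
      then have "cst (1 / c j) * (cst (c j) * l ^ m) \<in> limit_stalk p"
        by (rule limit_stalk_mult[OF cst_local_ring])
      also have "cst (1 / c j) * (cst (c j) * l ^ m) = cst (1 / c j * c j) * l ^ m"
        by (simp only: cst_simps(2) mult.assoc)
      also have "\<dots> = l ^ m"
        using cj by (simp add: cst_simps(4))
      finally show False using n(2) by simp
    qed
  qed
qed (rule limit_stalk_diff)

lemma has_quotient_dim_0:
  assumes "in_limit p d a" "eval3 a (rep_proj2 p) \<noteq> 0"
  shows "has_quotient_dim (local_ring p) (limit_stalk p) 0"
proof -
  have hom: "homogeneous d a" using assms(1) by (simp add: in_limit_def)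
  have "Fraction_Field.Fract (lift a) (lift a) \<in> limit_stalk p"
    using in_limitD[OF assms(1) local_denom_lift[OF hom assms(2)]] .
  moreover have "lift a \<noteq> 0"
    using local_denom_lift[OF hom assms(2)] by (rule local_denom_neq_0)
  moreover have "Fraction_Field.Fract (lift a) (lift a) = 1"
    using \<open>lift a \<noteq> 0\<close> by (simp add: One_fract_def eq_fract)
  ultimately have "1 \<in> limit_stalk p"
    by simp
  then have "f \<in> limit_stalk p" if "f \<in> local_ring p" for f
    using limit_stalk_mult[OF that, of 1] by simp
  then show ?thesis
    by (intro has_quotient_dimI[of _ "\<lambda>_. 0"] limit_stalk_diff) auto
qed

section \<open>The affine chart\<close>

text \<open>Dehomogenisation of a form of degree \<open>d\<close> on the chart
  \<open>Z \<noteq> 0\<close>, which contains the support of the limit cycle.\<close>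

definition germ :: "nat \<Rightarrow> complex poly3 \<Rightarrow> funfield" where
  "germ d a = Fraction_Field.Fract (lift a) (varZ ^ d)"

lemma local_denom_varZ:
  assumes "rep_proj2 p $ 3 \<noteq> 0"
  shows "local_denom p d (varZ ^ d)"
  using assms homogeneous_power[OF homogeneous_vars(3), of d]
  by (simp add: local_denom_def vanishes_at_def)

lemma varZ_neq_0: "varZ \<noteq> (0 :: 'a::comm_ring_1 poly3)"
  by (simp add: varZ_def)

lemma fract_add_same:
  "b \<noteq> 0 \<Longrightarrow> Fraction_Field.Fract a b + Fraction_Field.Fract c b = Fraction_Field.Fract (a + c) b"
  by (simp add: eq_fract distrib_right)

lemma germ_mult: "germ (d + e) (a * b) = germ d a * germ e b"
  by (simp add: germ_def power_add)

lemma germ_add: "germ d (a + b) = germ d a + germ d b"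
  by (simp add: germ_def varZ_neq_0 eq_fract algebra_simps)

lemma germ_diff: "germ d (a - b) = germ d a - germ d b"
  by (simp add: germ_def varZ_neq_0 eq_fract algebra_simps)

lemma germ_const3_mult: "germ d (const3 c * a) = cst c * germ d a"
  by (simp add: germ_def cst_def)

lemma germ_one: "germ 0 1 = 1"
  by (simp add: germ_def One_fract_def)

lemma germ_power: "germ (n * d) (a ^ n) = germ d a ^ n"
proof (induction n)
  case (Suc n)
  then show ?case using germ_mult[where d = d and e = "n * d" and a = a and b = "a ^ n"] by simp
qed (simp add: germ_one)

lemma germ_local_ring:
  "rep_proj2 p $ 3 \<noteq> 0 \<Longrightarrow> homogeneous d a \<Longrightarrow> germ d a \<in> local_ring p"
  unfolding germ_def by (rule local_ringI[OF homogeneous_lift local_denom_varZ])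

lemma germ_in_limit_stalk:
  "rep_proj2 p $ 3 \<noteq> 0 \<Longrightarrow> in_limit p d a \<Longrightarrow> germ d a \<in> limit_stalk p"
  unfolding germ_def by (rule in_limitD[OF _ local_denom_varZ])

text \<open>A local function minus its value at \<open>(p, 0)\<close> lies in the ideal of the two
  affine coordinates and \<open>s\<close>; the \<open>s\<close>-part is absorbed by the limit
  ideal.\<close>

lemma local_ring_decomposition:
  fixes v :: "complex ^ 3"
  assumes v_def: "v = rep_proj2 p" and v3: "v $ 3 \<noteq> 0" and v: "v $ 1 = \<alpha> * v $ 3" "v $ 2 = \<beta> * v $ 3"
    and f: "f \<in> local_ring p"
  shows "\<exists>c. \<exists>g\<in>local_ring p. \<exists>h\<in>local_ring p.
    f - (cst c + germ 1 (varX - const3 \<alpha> * varZ) * g + germ 1 (varY - const3 \<beta> * varZ) * h)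
      \<in> limit_stalk p"
proof -
  from f obtain a b d where ab: "f = Fraction_Field.Fract a b" "homogeneous d a"
    "local_denom p d b" by (rule local_ringE)
  have b: "homogeneous d b" "eval3 (fiber b 0) v \<noteq> 0" "b \<noteq> 0"
    using ab(3) local_denom_neq_0 by (auto simp: local_denom_def vanishes_at_def v_def)
  define c where "c = eval3 (fiber a 0) v / eval3 (fiber b 0) v"
  have "homogeneous d (a - const3 [:c:] * b)"
    using ab b by (intro homogeneous_diff homogeneous_const3_mult)
  from homogeneous_taylor[OF this, of "[:\<alpha>:]" "[:\<beta>:]"] obtain e u w where
    uw: "homogeneous d (varZ * u)" "homogeneous d (varZ * w)" and
    eq: "a - const3 [:c:] * b = const3 e * varZ ^ d + (varX - const3 [:\<alpha>:] * varZ) * u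
      + (varY - const3 [:\<beta>:] * varZ) * w" by blast
  \<comment> \<open>At \<open>(p, 0)\<close> the left side vanishes by the choice of
    \<open>c\<close>, and both linear forms vanish, so the remaining coefficient \<open>e\<close> is
    divisible by \<open>s\<close>.\<close>
  from arg_cong[OF eq, of "\<lambda>f. eval3 (fiber f 0) v"] have "poly e 0 * v $ 3 ^ d = 0"
    using b(2) v by (simp add: c_def)
  then have "poly e 0 = 0" using v3 by simp
  then obtain e' where e: "e = [:0, 1:] * e'" 
    using poly_eq_0_iff_dvd[of e 0] by (auto elim: dvdE)
  define g h r where "g = Fraction_Field.Fract (varZ * u) b"
    and "h = Fraction_Field.Fract (varZ * w) b" and "r = Fraction_Field.Fract (const3 e' * varZ ^ d) b"
  have gh: "g \<in> local_ring p" "h \<in> local_ring p"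
    using uw ab(3) by (auto simp: g_def h_def intro: local_ringI)
  have hZ: "homogeneous d (varZ ^ d :: complex poly poly3)"
    using homogeneous_power[OF homogeneous_vars(3), of d] by simp
  have "r \<in> local_ring p"
    unfolding r_def using ab(3) hZ by (intro local_ringI homogeneous_const3_mult)
  then have r: "param * r \<in> limit_stalk p" by (rule param_mult_limit_stalk)
  have rearrange: "f - k = A + B + C \<Longrightarrow> f - (k + B + C) = A" for A B C k
    by (simp add: algebra_simps)
  have "f - cst c = Fraction_Field.Fract (a - const3 [:c:] * b) b"
    using b(3) by (simp add: ab(1) cst_def eq_fract)
  also have "\<dots> = Fraction_Field.Fract (svar * (const3 e' * varZ ^ d)) b
      + Fraction_Field.Fract ((varX - const3 [:\<alpha>:] * varZ) * u) b
      + Fraction_Field.Fract ((varY - const3 [:\<beta>:] * varZ) * w) b"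
    unfolding eq e const3_simps(2) fract_add_same[OF b(3)] by (simp only: mult.assoc)
  also have "Fraction_Field.Fract (svar * (const3 e' * varZ ^ d)) b = param * r"
    by (simp add: param_def r_def)
  also have "Fraction_Field.Fract ((varX - const3 [:\<alpha>:] * varZ) * u) b
      = germ 1 (varX - const3 \<alpha> * varZ) * g"
    using b(3) by (simp add: germ_def g_def eq_fract varZ_neq_0 mult_ac)
  also have "Fraction_Field.Fract ((varY - const3 [:\<beta>:] * varZ) * w) b
      = germ 1 (varY - const3 \<beta> * varZ) * h"
    using b(3) by (simp add: germ_def h_def eq_fract varZ_neq_0 mult_ac)
  finally have "f - (cst c + germ 1 (varX - const3 \<alpha> * varZ) * g
      + germ 1 (varY - const3 \<beta> * varZ) * h) = param * r"
    by (rule rearrange)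
  then have "f - (cst c + germ 1 (varX - const3 \<alpha> * varZ) * g
      + germ 1 (varY - const3 \<beta> * varZ) * h) \<in> limit_stalk p"
    using r by (simp only:)
  then show ?thesis using gh by blast
qed

lemma uniformizerI:
  fixes v :: "complex ^ 3"
  assumes v_def: "v = rep_proj2 p" and v3: "v $ 3 \<noteq> 0" and v: "v $ 1 = \<alpha> * v $ 3" "v $ 2 = \<beta> * v $ 3"
    and l: "l \<in> local_ring p" "r \<in> local_ring p" "r' \<in> local_ring p"
    and xy: "germ 1 (varX - const3 \<alpha> * varZ) - l * r \<in> limit_stalk p"
      "germ 1 (varY - const3 \<beta> * varZ) - l * r' \<in> limit_stalk p"
  shows "uniformizer p l"
  unfolding uniformizer_def
proof (intro conjI ballI l)
  fix f assume "f \<in> local_ring p"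
  then obtain c g h where gh: "g \<in> local_ring p" "h \<in> local_ring p"
    and f: "f - (cst c + germ 1 (varX - const3 \<alpha> * varZ) * g
      + germ 1 (varY - const3 \<beta> * varZ) * h) \<in> limit_stalk p"
    using local_ring_decomposition[OF v_def v3 v] by blast
  have comb: "f - (k + l * (r * g + r' * h)) = (f - (k + x * g + y * h))
      + (g * (x - l * r) + h * (y - l * r'))" for x y k
    by algebra
  have "f - (cst c + l * (r * g + r' * h)) \<in> limit_stalk p"
    unfolding comb[of _ "germ 1 (varX - const3 \<alpha> * varZ)" "germ 1 (varY - const3 \<beta> * varZ)"]
    by (rule limit_stalk_add[OF f limit_stalk_add[OF limit_stalk_mult[OF gh(1) xy(1)]
      limit_stalk_mult[OF gh(2) xy(2)]]])
  then show "\<exists>c. \<exists>g\<in>local_ring p. f - (cst c + l * g) \<in> limit_stalk p"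
    using local_ring_add[OF local_ring_mult[OF l(2) gh(1)] local_ring_mult[OF l(3) gh(2)]] by blast
qed

lemma germ_not_in_limit_stalk:
  assumes "rep_proj2 p $ 3 \<noteq> 0"
    and "\<And>g. g * a \<in> limit_poly_ideal \<Longrightarrow> eval3 g (rep_proj2 p) = 0"
  shows "germ d a \<notin> limit_stalk p"
  using limit_stalk_fiber[OF _ local_denom_varZ[OF assms(1)], of a d] assms(2)
  unfolding germ_def by blast

lemma has_quotient_dim_1:
  fixes v :: "complex ^ 3"
  assumes v_def: "v = rep_proj2 p" and v3: "v $ 3 \<noteq> 0" and v: "v $ 1 = \<alpha> * v $ 3" "v $ 2 = \<beta> * v $ 3"
    and lim: "in_limit p 1 (varX - const3 \<alpha> * varZ)" "in_limit p 1 (varY - const3 \<beta> * varZ)"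
    and gen: "eval3 (LP * CP) v = 0" "eval3 (LP * KP) v = 0" "eval3 (varX ^ 2 * NP) v = 0"
  shows "has_quotient_dim (local_ring p) (limit_stalk p) 1"
proof -
  have "germ 1 (varX - const3 \<alpha> * varZ) \<in> limit_stalk p"
    "germ 1 (varY - const3 \<beta> * varZ) \<in> limit_stalk p"
    using germ_in_limit_stalk[OF _ lim(1)] germ_in_limit_stalk[OF _ lim(2)] v3
    by (simp_all add: v_def)
  then have "uniformizer p 0"
    by (intro uniformizerI[OF v_def v3 v, of 0 0 0]) simp_all
  moreover have "germ 0 1 \<notin> limit_stalk p"
  proof (rule germ_not_in_limit_stalk)
    show "rep_proj2 p $ 3 \<noteq> 0" using v3 by (simp add: v_def)
    fix g assume "g * 1 \<in> limit_poly_ideal"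
    then obtain a b c where "g = LP * CP * a + LP * KP * b + varX ^ 2 * NP * c"
      by (auto simp: limit_poly_ideal_def)
    then have "eval3 g v = eval3 (LP * CP) v * eval3 a v + eval3 (LP * KP) v * eval3 b v
        + eval3 (varX ^ 2 * NP) v * eval3 c v" by (simp only: eval3_simps)
    then show "eval3 g (rep_proj2 p) = 0"
      unfolding gen by (simp add: v_def)
  qed
  then have "1 \<notin> limit_stalk p" by (simp add: germ_one)
  ultimately show ?thesis
    \<comment> \<open>With \<open>l = 0\<close> and \<open>m = 0\<close> the relevant power is
      \<open>0 ^ 0 = 1\<close>.\<close>
    using has_quotient_dim_powers[of p 0 0] by simp
qed

section \<open>Elements of the limit ideal where the line, the cubic or \<open>X\<close> is a
  unit\<close>

lemma const3_power: "const3 (c ^ n) = const3 c ^ n" for c :: "'a::comm_ring_1"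
  by (induction n) (simp_all add: const3_simps)

lemma in_limit_diff: "in_limit p d a \<Longrightarrow> in_limit p d b \<Longrightarrow> in_limit p d (a - b)"
  using in_limit_add[of p d a "const3 (- 1) * b"] in_limit_mult[OF _ homogeneous_const3, of p d b "- 1"]
  by (simp add: const3_simps)

lemma in_limit_mult':
  "in_limit p d a \<Longrightarrow> homogeneous e c \<Longrightarrow> n = e + d \<Longrightarrow> in_limit p n (c * a)"
  by (simp add: in_limit_mult)

lemma in_limit_cancel':
  assumes "in_limit p n b" "b = c * a" "homogeneous e c" "homogeneous d a" "n = e + d"
    "eval3 c (rep_proj2 p) \<noteq> 0"
  shows "in_limit p d a"
  using in_limit_cancel[of p e d c a] assms by simp

lemma in_limit_line:
  assumes "eval3 CP (rep_proj2 p) \<noteq> 0"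
  shows "in_limit p 1 LP"
  by (rule in_limit_cancel'[OF in_limit_generators(1) _ homogeneous_forms(2,1) _ assms])
     (simp_all add: mult.commute)

lemma in_limit_residual:
  assumes "rep_proj2 p $ 1 \<noteq> 0"
  shows "in_limit p 7 NP"
  by (rule in_limit_cancel'[OF in_limit_generators(3) refl homogeneous_power'[OF homogeneous_vars(1) refl]
     homogeneous_residual]) (use assms in simp_all)

lemma
  assumes L: "eval3 LP (rep_proj2 p) \<noteq> 0"
  shows in_limit_cofactor: "in_limit p 5 KP"
    and in_limit_tangents: "in_limit p 3 (T1P * T2P * FLP)" "in_limit p 3 (T1P ^ 3 - T2P ^ 3)"
proof -
  have C: "in_limit p 3 CP"
    by (rule in_limit_cancel'[OF in_limit_generators(1) refl homogeneous_forms(1,2) _ L]) simp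
  show K: "in_limit p 5 KP"
    by (rule in_limit_cancel'[OF in_limit_generators(2) refl homogeneous_forms(1,4) _ L]) simp
  have "in_limit p 5 (4 * KP - QP * CP)"
    by (intro in_limit_diff in_limit_mult'[OF K homogeneous_numeral]
        in_limit_mult'[OF C homogeneous_forms(6)]) simp_all
  moreover have "4 * KP - QP * CP = 9 * LP ^ 2 * (HP :: complex poly3)"
    using cofactor_mod_cubic[of varX varY "varZ :: complex poly3"] by algebra
  moreover have "homogeneous 2 (9 * LP ^ 2 :: complex poly3)"
    by ((rule homogeneous_intros homogeneous_forms(1) refl | simp)+)
  ultimately have H: "in_limit p 3 HP"
    by (rule in_limit_cancel'[OF _ _ _ homogeneous_forms(3)]) (use L in simp_all)
  have hom: "homogeneous 3 (T1P * T2P * FLP :: complex poly3)"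
    by ((rule homogeneous_mult' homogeneous_forms refl | simp)+)
  \<comment> \<open>The factor -54 makes the multiples of \<open>T1P ^ 3 - T2P ^ 3\<close> in
    \<open>CP\<close> and \<open>HP\<close> cancel.\<close>
  have "in_limit p 3 ((- 54) * CP - 1 * HP)"
    by (intro in_limit_diff in_limit_mult'[OF C] in_limit_mult'[OF H] homogeneous_uminus
        homogeneous_numeral homogeneous_1) simp_all
  moreover have "(- 54) * CP - 1 * HP = 72 * (T1P * T2P * FLP :: complex poly3)"
    using hess_cubic_eq_tangents[of varX varY "varZ :: complex poly3"]
      cubic_eq_tangents[of varX varY "varZ :: complex poly3"] by algebra
  ultimately show P: "in_limit p 3 (T1P * T2P * FLP)"
    by (rule in_limit_cancel'[OF _ _ homogeneous_numeral hom]) simp_all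
  have "in_limit p 3 ((- 9) * CP - 9 * (T1P * T2P * FLP))"
    by (intro in_limit_diff in_limit_mult'[OF C] in_limit_mult'[OF P] homogeneous_uminus
        homogeneous_numeral) simp_all
  moreover have "(- 9) * CP - 9 * (T1P * T2P * FLP) = T1P ^ 3 - (T2P ^ 3 :: complex poly3)"
    using cubic_eq_tangents[of varX varY "varZ :: complex poly3"] by algebra
  ultimately show "in_limit p 3 (T1P ^ 3 - T2P ^ 3)" by simp
qed

section \<open>Local multiplicities\<close>

lemma multiplicity_off_curve:
  assumes "eval3 LP (rep_proj2 p) \<noteq> 0" "eval3 CP (rep_proj2 p) \<noteq> 0"
  shows "has_quotient_dim (local_ring p) (limit_stalk p) 0"
  by (rule has_quotient_dim_0[OF in_limit_generators(1)]) (use assms in simp)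

lemma multiplicity_cubic_nonflex:
  assumes "eval3 LP (rep_proj2 p) \<noteq> 0" "eval3 CP (rep_proj2 p) = 0" "eval3 HP (rep_proj2 p) \<noteq> 0"
  shows "has_quotient_dim (local_ring p) (limit_stalk p) 0"
proof (rule has_quotient_dim_0[OF in_limit_cofactor[OF assms(1)]])
  show "eval3 KP (rep_proj2 p) \<noteq> 0"
    using cofactor_mod_cubic[of "rep_proj2 p $ 1" "rep_proj2 p $ 2" "rep_proj2 p $ 3"] assms by auto
qed

lemma multiplicity_line_nonresidual:
  assumes "rep_proj2 p $ 1 \<noteq> 0" "eval3 NP (rep_proj2 p) \<noteq> 0"
  shows "has_quotient_dim (local_ring p) (limit_stalk p) 0"
  by (rule has_quotient_dim_0[OF in_limit_residual[OF assms(1)] assms(2)])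

lemma multiplicity_line_residual:
  fixes v :: "complex ^ 3"
  assumes v: "v = rep_proj2 p" and v3: "v $ 3 \<noteq> 0"
    and v12: "v $ 1 = (- \<beta> - 1) * v $ 3" "v $ 2 = \<beta> * v $ 3"
    and \<beta>: "3 * \<beta> ^ 4 + 11 * \<beta> ^ 3 + 12 * \<beta> ^ 2 + 3 * \<beta> + 1 = 0"
  shows "has_quotient_dim (local_ring p) (limit_stalk p) 1"
proof -
  \<comment> \<open>Up to constants and powers of \<open>Z\<close>, \<kappa> is the value of
    \<open>cubic\<close>, and \<delta> is the derivative of the quartic at its root \<beta>. Both
    are nonzero: the quartic has no root in common with the cubic factor and no double root.\<close>
  define \<kappa> \<delta> where \<kappa>: "\<kappa> = \<beta> ^ 3 - 3 * \<beta> - 1"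
    and \<delta>: "\<delta> = 12 * \<beta> ^ 3 + 33 * \<beta> ^ 2 + 24 * \<beta> + 3"
  have \<beta>1: "\<kappa> \<noteq> 0" unfolding \<kappa> using \<beta> by algebra
  have \<beta>2: "\<delta> \<noteq> 0" unfolding \<delta> using \<beta> by algebra
  have L0: "eval3 LP v = 0"
    unfolding eval3_forms eval3_simps v12 line_def by algebra
  have C: "eval3 CP v = - 3 * \<kappa> * v $ 3 ^ 3"
    unfolding eval3_forms eval3_simps v12 cubic_def \<kappa> by algebra
  have X: "v $ 1 \<noteq> 0"
  proof
    assume "v $ 1 = 0"
    then have "(\<beta> + 1) * v $ 3 = 0" using v12(1) by algebra
    then have "\<beta> + 1 = 0" using v3 by simp
    then show False using \<beta> by algebra
  qed
  have N: "eval3 NP v = 0"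
  proof -
    have "eval3 NP v = - 1458 * \<kappa> * v $ 3 ^ 7
      * (3 * \<beta> ^ 4 + 11 * \<beta> ^ 3 + 12 * \<beta> ^ 2 + 3 * \<beta> + 1)"
      using L0 unfolding eval3_forms eval3_simps residual_mod_line v12 \<kappa> by algebra
    then show ?thesis using \<beta> by simp
  qed
  \<comment> \<open>As a constant polynomial, \<beta> enters identities between polynomials, modulo
    its own equation.\<close>
  define b where "b = (const3 \<beta> :: complex poly3)"
  have b: "3 * b ^ 4 + 11 * b ^ 3 + 12 * b ^ 2 + 3 * b + 1 = 0"
    using arg_cong[OF \<beta>, of const3] by (simp add: const3_simps const3_power b_def)
  have hb: "homogeneous 0 (b ^ n)" "homogeneous 0 b" for n
    unfolding b_def const3_power[symmetric] by simp_all
  \<comment> \<open>Quotient of the homogenised quartic by \<open>varY - b * varZ\<close>; its value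
    at the point is \<delta> times a power of \<open>Z\<close>.\<close>
  define q where "q = 3 * varY ^ 3 + (11 + 3 * b) * varY ^ 2 * varZ
    + (12 + 11 * b + 3 * b ^ 2) * varY * varZ ^ 2 + (3 + 12 * b + 11 * b ^ 2 + 3 * b ^ 3) * varZ ^ 3"
  define c where "c = - 1458 * (varY ^ 3 - 3 * varY * varZ ^ 2 - varZ ^ 3) * q"
  have homq: "homogeneous 3 q"
    unfolding q_def by ((rule homogeneous_intros hb refl | simp)+)
  have homc: "homogeneous 6 c"
    unfolding c_def by ((rule homogeneous_intros homq refl | simp)+)
  have homY: "homogeneous 1 (varY - b * varZ)"
    by ((rule homogeneous_intros hb refl | simp)+)
  have CL: "eval3 CP (rep_proj2 p) \<noteq> 0"
    using C \<beta>1 v3 by (simp add: v)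
  have L: "in_limit p 1 LP" by (rule in_limit_line[OF CL])
  have N7: "in_limit p 7 NP" using X by (intro in_limit_residual) (simp add: v)
  have "in_limit p 7 (NP - AP * LP)"
    by (intro in_limit_diff N7 in_limit_mult'[OF L homogeneous_forms(7)]) simp
  moreover have "NP - AP * LP = c * (varY - b * varZ)"
    using residual_mod_line[of varX varY "varZ :: complex poly3"] b unfolding c_def q_def by algebra
  moreover have "7 = 6 + (1::nat)" by simp
  moreover have "eval3 c (rep_proj2 p) \<noteq> 0"
  proof -
    have "eval3 c v = - 1458 * \<kappa> * \<delta> * v $ 3 ^ 6"
      unfolding c_def q_def b_def eval3_simps v12 \<kappa> \<delta> by algebra
    then show ?thesis using \<beta>1 \<beta>2 v3 by (simp add: v)
  qed
  ultimately have Y: "in_limit p 1 (varY - b * varZ)"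
    by (rule in_limit_cancel'[OF _ _ homc homY])
  have "LP - (varY - b * varZ) = varX - const3 (- \<beta> - 1) * varZ"
    by (simp add: line_def b_def const3_simps algebra_simps)
  then have X: "in_limit p 1 (varX - const3 (- \<beta> - 1) * varZ)"
    using in_limit_diff[OF L Y] by simp
  show ?thesis
    by (rule has_quotient_dim_1[OF v v3 v12 X Y[unfolded b_def]]) (use L0 N in simp_all)
qed

text \<open>At \<open>(0 : -1 : 1)\<close> both \<open>cubic\<close> and \<open>residual\<close> are
  units, so the limit ideal is generated by \<open>line\<close> and \<open>X^2\<close>;
  \<open>X\<close> is the local parameter.\<close>

lemma multiplicity_line_tangency:
  fixes v :: "complex ^ 3"
  assumes v: "v = rep_proj2 p" and v3: "v $ 3 \<noteq> 0" and v12: "v $ 1 = 0" "v $ 2 = - v $ 3"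
  shows "has_quotient_dim (local_ring p) (limit_stalk p) 2"
proof -
  note v3' = v3[unfolded v]
  have C: "eval3 CP v \<noteq> 0" using v12 v3 by (simp add: cubic_def)
  have N: "eval3 NP v \<noteq> 0"
  proof -
    have "eval3 NP v = - 2916 * v $ 3 ^ 7"
      unfolding eval3_forms eval3_simps v12 residual_mod_line line_def by algebra
    then show ?thesis using v3 by simp
  qed
  have L: "in_limit p 1 LP" using C by (intro in_limit_line) (simp add: v)
  have X2: "in_limit p 2 (varX ^ 2)"
    by (rule in_limit_cancel'[OF in_limit_generators(3) mult.commute homogeneous_residual
      homogeneous_power'[OF homogeneous_vars(1)]]) (use N in \<open>simp_all add: v\<close>)
  define l where "l = germ 1 varX"
  have l: "l \<in> local_ring p"
    unfolding l_def using v3' by (intro germ_local_ring homogeneous_vars)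
  have "germ 1 (varY - const3 (- 1) * varZ) - l * cst (- 1) = germ 1 LP"
    unfolding l_def
    by (simp add: cst_simps(4,6) const3_simps line_def flip: germ_add) (simp add: add_ac)
  then have y: "germ 1 (varY - const3 (- 1) * varZ) - l * cst (- 1) \<in> limit_stalk p"
    using germ_in_limit_stalk[OF v3' L] by simp
  have x: "germ 1 (varX - const3 0 * varZ) - l * 1 \<in> limit_stalk p"
    by (simp add: l_def const3_simps)
  have "uniformizer p l"
    by (rule uniformizerI[OF v v3 _ _ l one_local_ring cst_local_ring x y]) (use v12 in simp_all)
  moreover have "l ^ Suc 1 \<in> limit_stalk p"
    using germ_in_limit_stalk[OF v3' X2] germ_power[of 2 1 varX]
    by (simp add: l_def power2_eq_square)
  moreover have "l ^ 1 \<notin> limit_stalk p"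
  proof -
    have "eval3 g (rep_proj2 p) = 0" if "g * varX \<in> limit_poly_ideal" for g
    proof -
      from that obtain a b c where g: "g * varX = LP * CP * a + LP * KP * b + varX ^ 2 * NP * c"
        by (auto simp: limit_poly_ideal_def)
      then have "varX * (g - varX * NP * c) = LP * (CP * a + KP * b)" by algebra
      then have "LP dvd varX * (g - varX * NP * c)" by simp
      moreover have "\<not> LP dvd (varX :: complex poly3)"
        by (rule not_dvd_eval3[of _ "vector [-1, 1, 0]"]) (simp_all add: form_defs)
      ultimately have "LP dvd g - varX * NP * c"
        using prime_forms(1) prime_elem_dvd_mult_iff by blast
      then obtain r where "g - varX * NP * c = LP * r" by (elim dvdE)
      then have "g = varX * NP * c + LP * r" by (simp add: algebra_simps)
      then have "eval3 g v = 0" using v12 by (simp add: line_def)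
      then show ?thesis by (simp add: v)
    qed
    then show ?thesis
      using germ_not_in_limit_stalk[OF v3', of varX 1] by (simp add: l_def)
  qed
  ultimately show ?thesis
    using has_quotient_dim_powers[of p l 1] by (simp add: numeral_2_eq_2)
qed

text \<open>Off the node both tangents are units at a flex. The limit ideal therefore contains
  \<open>flex_line\<close> and one linear factor of \<open>tangent1^3 - tangent2^3\<close>, two
  lines that meet transversally.\<close>

lemma multiplicity_cubic_flex:
  fixes v :: "complex ^ 3"
  assumes v: "v = rep_proj2 p" and L: "eval3 LP v \<noteq> 0" and C: "eval3 CP v = 0" and H: "eval3 HP v = 0"
    and node: "\<not> (eval3 T1P v = 0 \<and> eval3 T2P v = 0)"
  shows "has_quotient_dim (local_ring p) (limit_stalk p) 1"
proof -
  define t1 t2 f where "t1 = eval3 T1P v" and "t2 = eval3 T2P v" and "f = eval3 FLP v"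
  have 1: "- 9 * (t1 * t2 * f) - (t1 ^ 3 - t2 ^ 3) = 0" "- 18 * (t1 * t2 * f) + 6 * (t1 ^ 3 - t2 ^ 3) = 0"
    using C H cubic_eq_tangents[of "v $ 1" "v $ 2" "v $ 3"]
      hess_cubic_eq_tangents[of "v $ 1" "v $ 2" "v $ 3"] by (simp_all add: t1_def t2_def f_def)
  have P: "t1 * t2 * f = 0" and S: "t1 ^ 3 = t2 ^ 3" using 1 by algebra+
  have t12: "t1 \<noteq> 0" "t2 \<noteq> 0"
    using S node by (auto simp: t1_def t2_def)
  with P have "f = 0" by simp
  then have v2: "v $ 2 = 2 * v $ 1" by (simp add: f_def flex_line_def)
  have t1: "t1 = - 6 * v $ 1 + v $ 3" and t2: "t2 = - 3 * v $ 1 + v $ 3"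
    by (simp_all add: t1_def t2_def tangent1_def tangent2_def v2)
  have v3: "v $ 3 \<noteq> 0"
  proof
    assume "v $ 3 = 0"
    then have "v $ 1 ^ 3 = 0" using S t1 t2 by algebra
    then show False using t1 t12 \<open>v $ 3 = 0\<close> by simp
  qed
  \<comment> \<open>The cube root of unity \<open>k\<close> selects the flex; solving
    \<open>t1 = k * t2\<close> on the flex line gives its coordinate \<alpha>.\<close>
  define \<alpha> k where "\<alpha> = v $ 1 / v $ 3" and "k = t1 / t2"
  have k: "t1 = k * t2" "k ^ 3 = 1"
    using t12 S by (simp_all add: k_def power_divide)
  have v12: "v $ 1 = \<alpha> * v $ 3" "v $ 2 = (2 * \<alpha>) * v $ 3"
    using v3 by (simp_all add: \<alpha>_def v2)
  \<comment> \<open>\<open>k = 2\<close> would contradict \<open>k ^ 3 = 1\<close>.\<close>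
  have k2: "3 * k - 6 \<noteq> 0" using k(2) by algebra
  have "((3 * k - 6) * \<alpha> + (1 - k)) * v $ 3 = 0"
    using k(1) v12(1) t1 t2 by algebra
  then have \<alpha>: "(3 * k - 6) * \<alpha> + (1 - k) = 0" using v3 by simp
  have lim: "in_limit p 3 (T1P * T2P * FLP)" "in_limit p 3 (T1P ^ 3 - T2P ^ 3)"
    using in_limit_tangents L by (simp_all add: v)
  have F: "in_limit p 1 FLP"
    by (rule in_limit_cancel'[OF lim(1) refl homogeneous_mult'[OF homogeneous_forms(8,9) refl]
      homogeneous_forms(10)]) (use t12 in \<open>simp_all add: t1_def t2_def v\<close>)
  define K where "K = (const3 k :: complex poly3)"
  define A where "A = (const3 \<alpha> :: complex poly3)"
  have K: "K ^ 3 = 1" using arg_cong[OF k(2), of const3] by (simp add: const3_simps const3_power K_def)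
  have A: "(3 * K - 6) * A + (1 - K) = 0"
    using arg_cong[OF \<alpha>, of const3] by (simp add: const3_simps K_def A_def)
  have hK: "homogeneous 0 (K ^ n)" "homogeneous 0 K" "homogeneous 0 A" for n
    unfolding K_def A_def const3_power[symmetric] by simp_all
  have "in_limit p 1 (T1P - K * T2P)"
  proof (rule in_limit_cancel'[OF lim(2)])
    show "T1P ^ 3 - T2P ^ 3 = (T1P ^ 2 + K * T1P * T2P + K ^ 2 * T2P ^ 2) * (T1P - K * T2P)"
      using K by algebra
    show "homogeneous 2 (T1P ^ 2 + K * T1P * T2P + K ^ 2 * T2P ^ 2)"
      "homogeneous 1 (T1P - K * T2P)"
      by ((rule homogeneous_add homogeneous_diff homogeneous_mult' homogeneous_power' hK
          homogeneous_forms refl | simp)+)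
    have "eval3 (T1P ^ 2 + K * T1P * T2P + K ^ 2 * T2P ^ 2) v = 3 * t1 ^ 2"
      using k(1) unfolding K_def eval3_simps t1_def[symmetric] t2_def[symmetric] by algebra
    then show "eval3 (T1P ^ 2 + K * T1P * T2P + K ^ 2 * T2P ^ 2) (rep_proj2 p) \<noteq> 0"
      using t12 by (simp add: v)
  qed simp
  \<comment> \<open>The multiple of \<open>FLP\<close> is chosen so that \<open>varY\<close> drops
    out.\<close>
  then have "in_limit p 1 ((T1P - K * T2P) + (5 - 2 * K) * FLP)"
    by (intro in_limit_add in_limit_mult'[OF F] homogeneous_intros hK refl) (simp_all add: hK)
  moreover have "(T1P - K * T2P) + (5 - 2 * K) * FLP = (3 * K - 6) * (varX - A * varZ)"
    using A unfolding form_defs by algebra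
  moreover have "homogeneous 0 (3 * K - 6)"
    by ((rule homogeneous_intros hK refl | simp)+)
  moreover have "homogeneous 1 (varX - A * varZ)"
    by ((rule homogeneous_intros hK refl | simp)+)
  moreover have "1 = 0 + (1::nat)" by simp
  moreover have "eval3 (3 * K - 6) (rep_proj2 p) \<noteq> 0"
    using k2 by (simp add: K_def)
  ultimately have X: "in_limit p 1 (varX - A * varZ)"
    by (rule in_limit_cancel')
  have "2 * (varX - A * varZ) + FLP = varY - const3 (2 * \<alpha>) * varZ"
    by (simp add: flex_line_def A_def const3_simps algebra_simps)
  moreover have "in_limit p 1 (2 * (varX - A * varZ) + FLP)"
    by (rule in_limit_add[OF in_limit_mult'[OF X homogeneous_numeral] F]) simp
  ultimately have Y: "in_limit p 1 (varY - const3 (2 * \<alpha>) * varZ)" by simp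
  have K0: "eval3 KP v = 0"
    using cofactor_mod_cubic[of "v $ 1" "v $ 2" "v $ 3"] C H by simp
  then have "eval3 NP v = 0" using C by (simp add: residual_def)
  then show ?thesis
    by (intro has_quotient_dim_1[OF v v3 v12 X[unfolded A_def] Y]) (use C K0 in simp_all)
qed

lemma fract_diff_mult:
  assumes "c \<noteq> 0" "z \<noteq> 0"
  shows "Fraction_Field.Fract (c * y - r * l) (c * z) =
    Fraction_Field.Fract y z - Fraction_Field.Fract l z * Fraction_Field.Fract r c"
proof -
  have "Fraction_Field.Fract y z - Fraction_Field.Fract l z * Fraction_Field.Fract r c
    = Fraction_Field.Fract (y * (z * c) - (l * r) * z) (z * (z * c))"
    using assms by (simp only: mult_fract diff_fract mult_eq_0_iff simp_thms)
  also have "\<dots> = Fraction_Field.Fract (c * y - r * l) (c * z)"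
    using assms by (subst eq_fract(1)) (auto simp: algebra_simps)
  finally show ?thesis ..
qed

text \<open>At a node of \<open>G\<close> on the line, \<open>4 * residual = line\<^sup>2 * u1 + cubic * u2\<close> with units \<open>u1\<close> and \<open>u2\<close>.
  Since \<open>line * cubic\<close> also lies in the limit ideal, \<open>line\<close> is a local parameter of the limit
  scheme with \<open>line\<^sup>3 = 0 \<noteq> line\<^sup>2\<close>.\<close>

lemma multiplicity_line_cubic:
  fixes v :: "complex ^ 3"
  assumes v: "v = rep_proj2 p" and v3: "v $ 3 \<noteq> 0"
    and v12: "v $ 1 = (- \<beta> - 1) * v $ 3" "v $ 2 = \<beta> * v $ 3"
    and \<beta>: "\<beta> ^ 3 - 3 * \<beta> - 1 = 0"
  shows "has_quotient_dim (local_ring p) (limit_stalk p) 3"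
proof -
  note v3' = v3[unfolded v]
  \<comment> \<open>Up to powers of \<open>Z\<close>, \<eta> is the value of
    \<open>hess_cubic\<close> and \<delta> the derivative of the cubic equation at \<beta>, while
    \<theta> is the quartic from \<open>residual_mod_line\<close>. None vanishes, as \<beta> is a
    simple root and not a zero of the other two expressions.\<close>
  define \<eta> \<theta> \<delta> where \<eta>: "\<eta> = - 162 * (1 + 11 * \<beta> + 36 * \<beta> ^ 2 + 35 * \<beta> ^ 3)"
    and \<theta>: "\<theta> = 3 * \<beta> ^ 4 + 11 * \<beta> ^ 3 + 12 * \<beta> ^ 2 + 3 * \<beta> + 1"
    and \<delta>: "\<delta> = 3 * \<beta> ^ 2 - 3"
  have nz: "\<eta> \<noteq> 0" "\<theta> \<noteq> 0" "\<delta> \<noteq> 0" "\<beta> + 1 \<noteq> 0"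
    unfolding \<eta> \<theta> \<delta> using \<beta> by algebra+
  define u1 where "u1 = 9 * varX ^ 2 * (HP :: complex poly3)"
  define u2 where "u2 = varX ^ 2 * QP - 48 * (MP :: complex poly3)"
  define A where "A = varX ^ 2 - 5 * varX * varY + 4 * varX * varZ + 6 * varY ^ 2 - 6 * varY * varZ
    - 3 * (varZ :: complex poly3) ^ 2"
  define b where "b = (const3 \<beta> :: complex poly3)"
  define q where "q = varY ^ 2 + b * varY * varZ + (b ^ 2 - 3) * varZ ^ 2"
  have b: "b ^ 3 - 3 * b - 1 = 0"
    using arg_cong[OF \<beta>, of const3] by (simp add: const3_simps const3_power b_def)
  have hb: "homogeneous 0 (b ^ n)" "homogeneous 0 b" for n
    unfolding b_def const3_power[symmetric] by simp_all
  have hom: "homogeneous 5 u1" "homogeneous 4 u2" "homogeneous 2 A" "homogeneous 2 q"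
    "homogeneous 1 (varY - b * varZ)"
    unfolding u1_def u2_def A_def q_def
    by ((rule homogeneous_intros homogeneous_forms hb refl | simp)+)
  have NP: "4 * NP = LP ^ 2 * u1 + CP * u2"
    using cofactor_mod_cubic[of varX varY "varZ :: complex poly3"]
    unfolding u1_def u2_def residual_def by algebra
  have CP: "CP = LP * A - 3 * q * (varY - b * varZ)"
    using b unfolding A_def q_def cubic_def line_def by algebra
  have L0: "eval3 LP v = 0"
    unfolding eval3_forms eval3_simps v12 line_def by algebra
  have C0: "eval3 CP v = 0"
    using \<beta> unfolding eval3_forms eval3_simps v12 cubic_def by algebra
  have X: "v $ 1 \<noteq> 0"
  proof
    assume "v $ 1 = 0"
    then have "(\<beta> + 1) * v $ 3 = 0" using v12(1) by algebra
    then show False using v3 nz by simp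
  qed
  have H: "eval3 HP v = \<eta> * v $ 3 ^ 3"
    unfolding eval3_forms eval3_simps v12 hess_cubic_def \<eta> by algebra
  have "eval3 u1 v = 9 * (v $ 1) ^ 2 * (\<eta> * v $ 3 ^ 3)"
    unfolding u1_def by (simp only: eval3_simps H)
  then have e1: "eval3 u1 v \<noteq> 0" using X nz v3 by simp
  \<comment> \<open>On the line \<open>4 * residual = cubic * u2\<close>. Dividing by the common
    factor of \<open>residual\<close> and \<open>cubic\<close> leaves the quartic times 4 * 1458 / 3
    = 1944.\<close>
  have "eval3 u2 v = 1944 * \<theta> * v $ 3 ^ 4"
    unfolding u2_def eval3_simps eval3_forms v12 quotient_def minor_def \<theta> by algebra
  then have e2: "eval3 u2 v \<noteq> 0" using nz v3 by simp
  have "eval3 q v = \<delta> * v $ 3 ^ 2"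
    unfolding q_def b_def eval3_simps v12 \<delta> by algebra
  then have eq: "eval3 q v \<noteq> 0" using nz v3 by simp
  have N: "in_limit p 7 NP" using X by (intro in_limit_residual) (simp add: v)
  define l where "l = germ 1 LP"
  have l: "l \<in> local_ring p"
    unfolding l_def by (rule germ_local_ring[OF v3' homogeneous_forms(1)])

  have L3: "in_limit p 3 (LP ^ 3)"
  proof -
    have "in_limit p 8 ((4 * LP) * NP - u2 * (LP * CP))"
      by (rule in_limit_diff[OF in_limit_mult'[OF N homogeneous_mult'[OF homogeneous_numeral homogeneous_forms(1) refl]]
        in_limit_mult'[OF in_limit_generators(1) hom(2)]]) simp_all
    moreover have "(4 * LP) * NP - u2 * (LP * CP) = u1 * LP ^ 3"
      using NP by algebra
    ultimately show ?thesis
      by (rule in_limit_cancel'[OF _ _ hom(1) homogeneous_power'[OF homogeneous_forms(1)]])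
         (use e1 in \<open>simp_all add: v\<close>)
  qed
  \<comment> \<open>Substituting the expression for \<open>CP\<close> into that for
    \<open>4 * NP\<close> gives \<open>r * LP - c * (varY - b * varZ)\<close> with \<open>c\<close>
    a unit. Modulo the limit ideal \<open>varY - b * varZ\<close> is thus \<open>r / c\<close> times
    \<open>LP\<close>.\<close>
  define c r where "c = 3 * q * u2" and "r = LP * u1 + A * u2"
  have homc: "homogeneous 6 c" and homr: "homogeneous 6 r"
    unfolding c_def r_def
    by ((rule homogeneous_add homogeneous_mult' hom homogeneous_forms(1) homogeneous_numeral refl | simp)+)
  have c: "local_denom p 6 (lift c)"
    by (rule local_denom_lift[OF homc]) (use eq e2 in \<open>simp add: c_def v\<close>)
  define R where "R = Fraction_Field.Fract (lift r) (lift c)"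
  have R: "R \<in> local_ring p"
    unfolding R_def by (rule local_ringI[OF homogeneous_lift[OF homr] c])
  have "in_limit p 7 ((- 4) * NP)"
    by (rule in_limit_mult'[OF N homogeneous_uminus[OF homogeneous_numeral]]) simp
  moreover have "(- 4) * NP = c * (varY - b * varZ) - r * LP"
    using NP CP unfolding c_def r_def by algebra
  ultimately have "in_limit p 7 (c * (varY - b * varZ) - r * LP)" by simp
  moreover have "local_denom p 7 (lift c * varZ ^ 1)"
    using local_denom_mult[OF c local_denom_varZ[OF v3', of 1]] by simp
  ultimately have "Fraction_Field.Fract (lift (c * (varY - b * varZ) - r * LP)) (lift c * varZ ^ 1)
      \<in> limit_stalk p" by (rule in_limitD)
  also have "Fraction_Field.Fract (lift (c * (varY - b * varZ) - r * LP)) (lift c * varZ ^ 1)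
    = germ 1 (varY - b * varZ) - l * R"
    unfolding l_def R_def germ_def lift_diff[of "c * (varY - b * varZ)"] lift_simps(2)
    using local_denom_neq_0[OF c] by (intro fract_diff_mult) (simp_all add: varZ_neq_0)
  finally have y: "germ 1 (varY - b * varZ) - l * R \<in> limit_stalk p" .
  have "LP - (varY - b * varZ) = varX - const3 (- \<beta> - 1) * varZ"
    by (simp add: line_def b_def const3_simps algebra_simps)
  then have "germ 1 (varX - const3 (- \<beta> - 1) * varZ) = l - germ 1 (varY - b * varZ)"
    unfolding l_def by (metis germ_diff)
  then have "germ 1 (varX - const3 (- \<beta> - 1) * varZ) - l * (1 - R)
    = - (germ 1 (varY - b * varZ) - l * R)"
    by algebra
  then have x: "germ 1 (varX - const3 (- \<beta> - 1) * varZ) - l * (1 - R) \<in> limit_stalk p"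
    using limit_stalk_uminus[OF y] by simp
  have "uniformizer p l"
    by (rule uniformizerI[OF v v3 v12 l local_ring_diff[OF one_local_ring R] R x y[unfolded b_def]])
  moreover have "l ^ Suc 2 \<in> limit_stalk p"
    using germ_in_limit_stalk[OF v3' L3] germ_power[of 3 1 LP] by (simp add: l_def numeral_3_eq_3)
  moreover have "l ^ 2 \<notin> limit_stalk p"
  proof -
    have "eval3 g (rep_proj2 p) = 0" if "g * LP ^ 2 \<in> limit_poly_ideal" for g
    proof -
      from that obtain a b c where g: "g * LP ^ 2 = LP * CP * a + LP * KP * b + varX ^ 2 * NP * c"
        by (auto simp: limit_poly_ideal_def)
      \<comment> \<open>Rewritten through \<open>LP\<close> and \<open>CP\<close>, the relation
        forces \<open>LP\<close> to divide \<open>c\<close>. After cancelling one \<open>LP\<close>,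
        \<open>CP\<close> divides what remains, which puts \<open>4 * g\<close> into the ideal of
        \<open>LP\<close> and \<open>CP\<close>; both vanish at the point.\<close>
      have g4: "4 * g * LP ^ 2 = LP * CP * (4 * a + QP * b) + 9 * LP ^ 3 * HP * b
          + varX ^ 2 * (LP ^ 2 * u1 + CP * u2) * c"
        using g NP cofactor_mod_cubic[of varX varY "varZ :: complex poly3"] by algebra
      then have "CP * u2 * varX ^ 2 * c = LP * (4 * g * LP - CP * (4 * a + QP * b)
          - 9 * LP ^ 2 * HP * b - varX ^ 2 * LP * u1 * c)" by algebra
      then have "LP dvd CP * u2 * varX ^ 2 * c" by simp
      moreover have "\<not> LP dvd (CP :: complex poly3)" "\<not> LP dvd (varX :: complex poly3)"
        by (rule not_dvd_eval3[of _ "vector [-1, 1, 0]"]; simp add: form_defs)+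
      moreover have "\<not> LP dvd u2"
        by (rule not_dvd_eval3[OF L0 e2])
      ultimately have "LP dvd c"
        using prime_forms(1) by (auto simp: prime_elem_dvd_mult_iff dest: prime_elem_dvd_power)
      then obtain d where d: "c = LP * d" by (elim dvdE)
      have "LP * (CP * (4 * a + QP * b + varX ^ 2 * u2 * d))
        = LP * (LP * (4 * g - 9 * LP * HP * b - varX ^ 2 * LP * u1 * d))"
        using g4 unfolding d by algebra
      then have "CP * (4 * a + QP * b + varX ^ 2 * u2 * d)
        = LP * (4 * g - 9 * LP * HP * b - varX ^ 2 * LP * u1 * d)"
        using prime_forms(1) by (metis mult_left_cancel prime_elem_def)
      then have "CP dvd LP * (4 * g - 9 * LP * HP * b - varX ^ 2 * LP * u1 * d)"
        by (metis dvd_triv_left)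
      then have "CP dvd 4 * g - 9 * LP * HP * b - varX ^ 2 * LP * u1 * d"
        by (rule cubic_dvd_line_mult)
      then obtain e where "4 * g - 9 * LP * HP * b - varX ^ 2 * LP * u1 * d = CP * e" by (elim dvdE)
      then have "4 * g = LP * (9 * HP * b + varX ^ 2 * u1 * d) + CP * e" by algebra
      then have "eval3 (4 * g) v = eval3 LP v * eval3 (9 * HP * b + varX ^ 2 * u1 * d) v
          + eval3 CP v * eval3 e v" by (simp only: eval3_simps)
      then have "eval3 (4 * g) v = 0" unfolding L0 C0 by simp
      then show ?thesis by (simp add: v)
    qed
    then show ?thesis
      using germ_not_in_limit_stalk[OF v3', of "LP ^ 2" 2] germ_power[of 2 1 LP] by (simp add: l_def)
  qed
  ultimately show ?thesis
    using has_quotient_dim_powers[of p l 2] by (simp add: numeral_3_eq_3 numeral_2_eq_2)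
qed

text \<open>\<open>C\<close> and \<open>K\<close> lie in the ideal of \<open>T1P * T2P\<close> and
  \<open>T1P ^ 3 - T2P ^ 3\<close>, and \<open>N\<close> is a combination of them. The factor 36
  clears the denominators 9 for \<open>C\<close> and 4 for \<open>K\<close>.\<close>

lemma limit_poly_ideal_tangents:
  assumes "a \<in> limit_poly_ideal"
  obtains u w where "36 * a = T1P * T2P * u + (T1P ^ 3 - T2P ^ 3) * w"
proof -
  from assms obtain x y z where a: "a = LP * CP * x + LP * KP * y + varX ^ 2 * NP * z"
    by (auto simp: limit_poly_ideal_def)
  define P S where "P = T1P * T2P * (FLP :: complex poly3)" and "S = T1P ^ 3 - (T2P ^ 3 :: complex poly3)"
  have C: "9 * CP = - 9 * P - S" and H: "HP = - 18 * P + 6 * S"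
    using cubic_eq_tangents[of varX varY "varZ :: complex poly3"]
      hess_cubic_eq_tangents[of varX varY "varZ :: complex poly3"] by (simp_all add: P_def S_def)
  have K: "36 * KP = 81 * LP ^ 2 * (- 18 * P + 6 * S) + (- 9 * P - S) * QP"
    using cofactor_mod_cubic[of varX varY "varZ :: complex poly3"] C H by algebra
  have "36 * a = 4 * LP * (9 * CP) * x + LP * (36 * KP) * y
    + varX ^ 2 * (varX ^ 2 * (36 * KP) - 48 * MP * (9 * CP)) * z"
    unfolding a residual_def by algebra
  also have "\<dots> = P * (- 36 * LP * x + LP * (- 1458 * LP ^ 2 - 9 * QP) * y
      + varX ^ 2 * (varX ^ 2 * (- 1458 * LP ^ 2 - 9 * QP) + 432 * MP) * z)
    + S * (- 4 * LP * x + LP * (486 * LP ^ 2 - QP) * y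
      + varX ^ 2 * (varX ^ 2 * (486 * LP ^ 2 - QP) + 48 * MP) * z)"
    unfolding K C by algebra
  finally show thesis
    unfolding P_def S_def by (intro that) (simp add: mult.assoc)
qed

lemma tangent_dvd_cancel:
  fixes f :: "complex poly3"
  shows "T1P dvd T2P * f \<Longrightarrow> T1P dvd f" and "T2P dvd T1P * f \<Longrightarrow> T2P dvd f"
proof -
  have 1: "\<not> T1P dvd (T2P :: complex poly3)"
    by (rule not_dvd_eval3[of _ "vector [1, 0, -4]"]) (simp_all add: form_defs)
  have 2: "\<not> T2P dvd (T1P :: complex poly3)"
    by (rule not_dvd_eval3[of _ "vector [1, 0, -1]"]) (simp_all add: form_defs)
  show "T1P dvd T2P * f \<Longrightarrow> T1P dvd f"
    using 1 prime_elem_dvd_mult_iff[OF prime_forms(2)] by blast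
  show "T2P dvd T1P * f \<Longrightarrow> T2P dvd f"
    using 2 prime_elem_dvd_mult_iff[OF prime_forms(3)] by blast
qed

text \<open>Turns an equation that follows from \<open>a = b\<close> into a polynomial identity
  without hypotheses.\<close>

lemma diff_transfer: "a = b \<Longrightarrow> c - d = a - b \<Longrightarrow> c = (d :: 'a::ab_group_add)"
  by simp

text \<open>Independence of \<open>1, x, x^2, x^3, y, y^2\<close> modulo \<open>x y\<close> and
  \<open>x^3 - y^3\<close>, homogenised to degree 3, with a unit \<open>g\<close> as factor.
  Coefficients of lowest order vanish by evaluation at the node; since the tangents are coprime, a
  tangent can then be cancelled and the next order becomes visible.\<close>

lemma node_independent:
  fixes v :: "complex ^ 3" and c :: "nat \<Rightarrow> complex"
  assumes v3: "v $ 3 \<noteq> 0" and T: "eval3 T1P v = 0" "eval3 T2P v = 0" and g: "eval3 g v \<noteq> 0"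
    and eq: "g * (const3 (c 0) * varZ ^ 3 + const3 (c 1) * T1P * varZ ^ 2 + const3 (c 2) * T1P ^ 2 * varZ
      + const3 (c 3) * T1P ^ 3 + const3 (c 4) * T2P * varZ ^ 2 + const3 (c 5) * T2P ^ 2 * varZ)
      = T1P * T2P * u + (T1P ^ 3 - T2P ^ 3) * w"
  shows "c 0 = 0 \<and> c 1 = 0 \<and> c 2 = 0 \<and> c 3 = 0 \<and> c 4 = 0 \<and> c 5 = 0"
proof -
  define t1 t2 z k where "t1 = (T1P :: complex poly3)" and "t2 = (T2P :: complex poly3)"
    and "z = (varZ :: complex poly3)" and "k = (\<lambda>i. const3 (c i) :: complex poly3)"
  have t12: "t1 \<noteq> 0" "t2 \<noteq> 0"
    unfolding t1_def t2_def by (rule prime_elem_not_zeroI, rule prime_forms)+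
  have d1: "t1 dvd f" if "t1 dvd t2 * f" for f
    by (rule tangent_dvd_cancel(1)[folded t1_def t2_def, OF that])
  have d2: "t2 dvd f" if "t2 dvd t1 * f" for f
    by (rule tangent_dvd_cancel(2)[folded t1_def t2_def, OF that])
  \<comment> \<open>Both tangents vanish at the node, whereas \<open>g\<close> and \<open>Z\<close>
    do not.\<close>
  have zero: "c i = 0" if "g * (k i * z ^ n) = t1 * a + t2 * b" for i n a b
  proof -
    have "eval3 (g * (k i * z ^ n)) v = 0"
      unfolding that using T by (simp add: t1_def t2_def)
    then show ?thesis using g v3 by (simp add: k_def z_def)
  qed
  have eq': "g * (k 0 * z ^ 3 + k 1 * t1 * z ^ 2 + k 2 * t1 ^ 2 * z + k 3 * t1 ^ 3 + k 4 * t2 * z ^ 2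
      + k 5 * t2 ^ 2 * z) = t1 * t2 * u + (t1 ^ 3 - t2 ^ 3) * w"
    using eq by (simp only: t1_def t2_def z_def k_def)
  have "g * (k 0 * z ^ 3) = t1 * (t2 * u + t1 ^ 2 * w - g * (k 1 * z ^ 2 + k 2 * t1 * z + k 3 * t1 ^ 2))
      + t2 * (- (t2 ^ 2 * w) - g * (k 4 * z ^ 2 + k 5 * t2 * z))"
    by (rule diff_transfer[OF eq']) algebra
  then have c0: "c 0 = 0" by (rule zero)
  then have k0: "k 0 = 0" by (simp add: k_def const3_simps)
  \<comment> \<open>\<open>t1 * a\<close> collects all terms divisible by \<open>t1\<close>; the
    rest is divisible by \<open>t2\<close>, so \<open>t2\<close> divides \<open>a\<close>.\<close>
  define a where "a = g * (k 1 * z ^ 2 + k 2 * t1 * z + k 3 * t1 ^ 2) - t2 * u - t1 ^ 2 * w"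
  have a: "t1 * a = t2 * (- (g * (k 4 * z ^ 2 + k 5 * t2 * z) + t2 ^ 2 * w))"
    by (rule diff_transfer[OF eq']) (unfold a_def k0, algebra)
  then have "t2 dvd a" by (rule d2[OF dvdI])
  then obtain q where q: "a = t2 * q" by (elim dvdE)
  have "t2 * (t1 * q) = t2 * (- (g * (k 4 * z ^ 2 + k 5 * t2 * z) + t2 ^ 2 * w))"
    using a unfolding q by (simp add: mult_ac)
  then have 2: "t1 * q = - (g * (k 4 * z ^ 2 + k 5 * t2 * z) + t2 ^ 2 * w)"
    using t12 by (metis mult_left_cancel)
  have 1: "g * (k 1 * z ^ 2 + k 2 * t1 * z + k 3 * t1 ^ 2) = t2 * (u + q) + t1 ^ 2 * w"
    by (rule diff_transfer[OF q]) (unfold a_def, algebra)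
  have "g * (k 1 * z ^ 2) = t1 * (t1 * w - g * (k 2 * z + k 3 * t1)) + t2 * (u + q)"
    by (rule diff_transfer[OF 1]) algebra
  then have c1: "c 1 = 0" by (rule zero)
  then have k1: "k 1 = 0" by (simp add: k_def const3_simps)
  have "g * (k 4 * z ^ 2) = t1 * (- q) + t2 * (- t2 * w - g * k 5 * z)"
    by (rule diff_transfer[OF 2]) algebra
  then have c4: "c 4 = 0" by (rule zero)
  then have k4: "k 4 = 0" by (simp add: k_def const3_simps)
  have "t1 * q = t2 * (- (g * k 5 * z + t2 * w))"
    by (rule diff_transfer[OF 2]) (unfold k4, algebra)
  then have "t2 dvd q" by (rule d2[OF dvdI])
  then obtain q' where q': "q = t2 * q'" by (elim dvdE)
  have "t2 * (t1 * q') = t2 * (- (g * k 5 * z + t2 * w))"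
    by (rule diff_transfer[OF 2]) (unfold k4 q', algebra)
  then have 3: "t1 * q' = - (g * k 5 * z + t2 * w)"
    using t12 by (metis mult_left_cancel)
  have "g * (k 5 * z ^ 1) = t1 * (- q') + t2 * (- w)"
    by (rule diff_transfer[OF 3]) algebra
  then have c5: "c 5 = 0" by (rule zero)
  then have k5: "k 5 = 0" by (simp add: k_def const3_simps)
  have "t2 * w = t1 * (- q')"
    by (rule diff_transfer[OF 3]) (unfold k5, algebra)
  then have "t1 dvd w" by (rule d1[OF dvdI])
  then obtain w' where w': "w = t1 * w'" by (elim dvdE)
  have "t2 * (u + q) = t1 * (g * (k 2 * z + k 3 * t1) - t1 ^ 2 * w')"
    by (rule diff_transfer[OF 1[symmetric]]) (unfold k1 w', algebra)
  then have "t1 dvd u + q" by (rule d1[OF dvdI])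
  then obtain r where r: "u + q = t1 * r" by (elim dvdE)
  have "t1 * (g * (k 2 * z + k 3 * t1)) = t1 * (t2 * r + t1 ^ 2 * w')"
    by (rule diff_transfer[OF 1]) (unfold k1 w' r, algebra)
  then have 4: "g * (k 2 * z + k 3 * t1) = t2 * r + t1 ^ 2 * w'"
    using t12 by (metis mult_left_cancel)
  have "g * (k 2 * z ^ 1) = t1 * (t1 * w' - g * k 3) + t2 * r"
    by (rule diff_transfer[OF 4]) algebra
  then have c2: "c 2 = 0" by (rule zero)
  then have k2: "k 2 = 0" by (simp add: k_def const3_simps)
  have "t2 * r = t1 * (g * k 3 - t1 * w')"
    by (rule diff_transfer[OF 4[symmetric]]) (unfold k2, algebra)
  then have "t1 dvd r" by (rule d1[OF dvdI])
  then obtain r' where r': "r = t1 * r'" by (elim dvdE)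
  have "t1 * (g * k 3) = t1 * (t2 * r' + t1 * w')"
    by (rule diff_transfer[OF 4]) (unfold k2 r', algebra)
  then have 5: "g * k 3 = t2 * r' + t1 * w'"
    using t12 by (metis mult_left_cancel)
  have "g * (k 3 * z ^ 0) = t1 * w' + t2 * r'"
    by (rule diff_transfer[OF 5]) algebra
  then have "c 3 = 0" by (rule zero)
  then show ?thesis using c0 c1 c2 c4 c5 by simp
qed

lemma germ_pad: "germ (d + e) (a * varZ ^ e) = germ d a"
proof -
  have "germ e (varZ ^ e) = 1"
    by (simp add: germ_def One_fract_def eq_fract varZ_neq_0)
  then show ?thesis by (simp add: germ_mult)
qed

text \<open>Multiplication by \<open>x\<close> kills the \<open>y\<close>-part of a decomposition,
  so only powers of \<open>x\<close> survive, and three rounds reach \<open>x ^ 4\<close>. The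
  assumptions let the lemma be applied to either tangent.\<close>

lemma axis_span:
  assumes dec: "\<And>f. f \<in> local_ring p \<Longrightarrow> \<exists>c. \<exists>g\<in>local_ring p. \<exists>h\<in>local_ring p.
      f - (cst c + x * g + y * h) \<in> limit_stalk p"
    and x: "x \<in> local_ring p" "x * y \<in> limit_stalk p" "x ^ 4 \<in> limit_stalk p"
    and g: "g \<in> local_ring p"
  shows "\<exists>a b e. x * g - (cst a * x + cst b * x ^ 2 + cst e * x ^ 3) \<in> limit_stalk p"
proof -
  have step: "\<exists>a. \<exists>g'\<in>local_ring p. x * f - (cst a * x + x ^ 2 * g') \<in> limit_stalk p"
    if f: "f \<in> local_ring p" for f
  proof -
    obtain a g' h where 1: "g' \<in> local_ring p" "h \<in> local_ring p"
      "f - (cst a + x * g' + y * h) \<in> limit_stalk p" using dec[OF f] by blast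
    have comb: "x * f - (k * x + x ^ 2 * g') = x * (f - (k + x * g' + y * h)) + h * (x * y)" for k
      by algebra
    have "x * f - (cst a * x + x ^ 2 * g') \<in> limit_stalk p"
      unfolding comb by (rule limit_stalk_add[OF limit_stalk_mult[OF x(1) 1(3)]
        limit_stalk_mult[OF 1(2) x(2)]])
    then show ?thesis using 1(1) by blast
  qed
  obtain a g1 where 1: "g1 \<in> local_ring p" "x * g - (cst a * x + x ^ 2 * g1) \<in> limit_stalk p"
    using step[OF g] by blast
  obtain b g2 where 2: "g2 \<in> local_ring p" "x * g1 - (cst b * x + x ^ 2 * g2) \<in> limit_stalk p"
    using step[OF 1(1)] by blast
  obtain e g3 where 3: "g3 \<in> local_ring p" "x * g2 - (cst e * x + x ^ 2 * g3) \<in> limit_stalk p"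
    using step[OF 2(1)] by blast
  have comb: "x * g - (k * x + l * x ^ 2 + m * x ^ 3) = (x * g - (k * x + x ^ 2 * g1))
      + (x * (x * g1 - (l * x + x ^ 2 * g2)) + (x ^ 2 * (x * g2 - (m * x + x ^ 2 * g3)) + g3 * x ^ 4))"
    for k l m by algebra
  have "x * g - (cst a * x + cst b * x ^ 2 + cst e * x ^ 3) \<in> limit_stalk p"
    unfolding comb
    by (rule limit_stalk_add[OF 1(2) limit_stalk_add[OF limit_stalk_mult[OF x(1) 2(2)]
      limit_stalk_add[OF limit_stalk_mult[OF local_ring_power[OF x(1)] 3(2)]
        limit_stalk_mult[OF 3(1) x(3)]]]])
  then show ?thesis by blast
qed

text \<open>At the node of the cubic the limit ideal is generated by \<open>x y\<close> and \<open>x\<^sup>3 - y\<^sup>3\<close> for the two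
  tangents \<open>x\<close> and \<open>y\<close>.\<close>

lemma multiplicity_node:
  fixes v :: "complex ^ 3"
  assumes v: "v = rep_proj2 p" and v3: "v $ 3 \<noteq> 0" and v12: "v $ 1 = v $ 3" "v $ 2 = v $ 3"
  shows "has_quotient_dim (local_ring p) (limit_stalk p) 6"
proof -
  note v3' = v3[unfolded v]
  have v12': "v $ 1 = 1 * v $ 3" "v $ 2 = 1 * v $ 3" using v12 by simp_all
  have T: "eval3 T1P v = 0" "eval3 T2P v = 0"
    using v12 by (simp_all add: tangent1_def tangent2_def)
  have L: "eval3 LP (rep_proj2 p) \<noteq> 0"
    using v12 v3 by (simp add: line_def flip: v)
  have FL: "eval3 FLP (rep_proj2 p) \<noteq> 0"
    using v12 v3 by (simp add: flex_line_def flip: v)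
  have hom2: "homogeneous 2 (T1P * T2P :: complex poly3)"
    by (rule homogeneous_mult'[OF homogeneous_forms(8,9)]) simp
  \<comment> \<open>The flex line misses the node, so \<open>FLP\<close> can be cancelled as a
    unit.\<close>
  have lim: "in_limit p 2 (T1P * T2P)"
    by (rule in_limit_cancel'[OF in_limit_tangents(1)[OF L] mult.commute homogeneous_forms(10) hom2 _ FL])
       simp
  define x y where "x = germ 1 T1P" and "y = germ 1 T2P"
  have xV: "x \<in> local_ring p" and yV: "y \<in> local_ring p"
    unfolding x_def y_def by (rule germ_local_ring[OF v3' homogeneous_forms(8)],
      rule germ_local_ring[OF v3' homogeneous_forms(9)])
  have xy: "x * y \<in> limit_stalk p"
    using germ_in_limit_stalk[OF v3' lim] germ_mult[of 1 1 T1P T2P] by (simp add: x_def y_def numeral_2_eq_2)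
  then have yx: "y * x \<in> limit_stalk p" by (simp add: mult.commute)
  have "germ 3 (T1P ^ 3 - T2P ^ 3) = x ^ 3 - y ^ 3"
    using germ_power[of 3 1 T1P] germ_power[of 3 1 T2P] by (simp add: germ_diff x_def y_def)
  then have xy3: "x ^ 3 - y ^ 3 \<in> limit_stalk p"
    using germ_in_limit_stalk[OF v3' in_limit_tangents(2)[OF L]] by simp
  have x4: "x ^ 4 \<in> limit_stalk p"
  proof -
    have "x ^ 4 = x * (x ^ 3 - y ^ 3) + y ^ 2 * (x * y)" by algebra
    also have "\<dots> \<in> limit_stalk p"
      by (rule limit_stalk_add[OF limit_stalk_mult[OF xV xy3] limit_stalk_mult[OF local_ring_power[OF yV] xy]])
    finally show ?thesis .
  qed
  have y4: "y ^ 4 \<in> limit_stalk p"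
  proof -
    have "y ^ 4 = x ^ 2 * (x * y) - y * (x ^ 3 - y ^ 3)" by algebra
    also have "\<dots> \<in> limit_stalk p"
      by (rule limit_stalk_diff[OF limit_stalk_mult[OF local_ring_power[OF xV] xy] limit_stalk_mult[OF yV xy3]])
    finally show ?thesis .
  qed
  \<comment> \<open>The coefficients here and in \<open>Y\<close> invert
    \<open>x = 4 X - 5 Y\<close>, \<open>y = X - 2 Y\<close>, written in affine coordinates centred
    at the node.\<close>
  have X: "germ 1 (varX - const3 1 * varZ) = cst (2 / 3) * x + cst (- 5 / 3) * y"
  proof -
    have "varX - const3 1 * varZ = const3 (2 / 3) * T1P + const3 (- 5 / 3) * (T2P :: complex poly3)"
      by (simp add: form_defs const3_def varX_def varY_def varZ_def numeral_poly)
    then show ?thesis by (simp only: germ_add germ_const3_mult x_def y_def)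
  qed
  have Y: "germ 1 (varY - const3 1 * varZ) = cst (1 / 3) * x + cst (- 4 / 3) * y"
  proof -
    have "varY - const3 1 * varZ = const3 (1 / 3) * T1P + const3 (- 4 / 3) * (T2P :: complex poly3)"
      by (simp add: form_defs const3_def varX_def varY_def varZ_def numeral_poly)
    then show ?thesis by (simp only: germ_add germ_const3_mult x_def y_def)
  qed
  have dec: "\<exists>c. \<exists>g\<in>local_ring p. \<exists>h\<in>local_ring p. f - (cst c + x * g + y * h) \<in> limit_stalk p"
    if f: "f \<in> local_ring p" for f
  proof -
    obtain c g h where gh: "g \<in> local_ring p" "h \<in> local_ring p" and
      1: "f - (cst c + germ 1 (varX - const3 1 * varZ) * g + germ 1 (varY - const3 1 * varZ) * h)
        \<in> limit_stalk p"
      using local_ring_decomposition[OF v v3 v12' f] by blast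
    have comb: "f - (e + (a * x + b * y) * g + (a' * x + b' * y) * h)
        = f - (e + x * (a * g + a' * h) + y * (b * g + b' * h))" for e a b a' b'
      by algebra
    have V: "cst a * g + cst b * h \<in> local_ring p" for a b
      by (rule local_ring_add[OF local_ring_mult[OF cst_local_ring gh(1)]
        local_ring_mult[OF cst_local_ring gh(2)]])
    show ?thesis
      by (rule exI[of _ c], rule bexI, rule bexI, rule 1[unfolded X Y comb], (rule V)+)
  qed
  have dec': "\<exists>c. \<exists>g\<in>local_ring p. \<exists>h\<in>local_ring p. f - (cst c + y * g + x * h) \<in> limit_stalk p"
    if f: "f \<in> local_ring p" for f
  proof -
    obtain c g h where gh: "g \<in> local_ring p" "h \<in> local_ring p" and
      1: "f - (cst c + x * g + y * h) \<in> limit_stalk p"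
      using dec[OF f] by blast
    have comb: "f - (e + x * g + y * h) = f - (e + y * h + x * g)" for e
      by algebra
    show ?thesis
      by (rule exI[of _ c], rule bexI, rule bexI, rule 1[unfolded comb], (rule gh)+)
  qed
  define B where "B = (\<lambda>i. [1, x, x ^ 2, x ^ 3, y, y ^ 2] ! i)"
  have sum6: "(\<Sum>i<6. h i) = h 0 + h 1 + h 2 + h 3 + h 4 + h 5" for h :: "nat \<Rightarrow> funfield"
    by (simp add: eval_nat_numeral)
  have B: "(\<Sum>i<6. scale (c i) (B i)) = cst (c 0) + cst (c 1) * x + cst (c 2) * x ^ 2
      + cst (c 3) * x ^ 3 + cst (c 4) * y + cst (c 5) * y ^ 2" for c
    unfolding sum6 scale_eq B_def by simp
  show ?thesis
  proof (rule has_quotient_dimI[of 6 B])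
    show "B i \<in> local_ring p" if "i < 6" for i
    proof -
      have "B i \<in> set [1, x, x ^ 2, x ^ 3, y, y ^ 2]"
        unfolding B_def using that by (intro nth_mem) simp
      then show ?thesis
        using xV yV local_ring_power[OF xV] local_ring_power[OF yV] by auto
    qed
    show "\<exists>c. f - (\<Sum>i<6. scale (c i) (B i)) \<in> limit_stalk p" if f: "f \<in> local_ring p" for f
    proof -
      obtain c0 g h where gh: "g \<in> local_ring p" "h \<in> local_ring p" and
        0: "f - (cst c0 + x * g + y * h) \<in> limit_stalk p" using dec[OF f] by blast
      obtain a b e where 1: "x * g - (cst a * x + cst b * x ^ 2 + cst e * x ^ 3) \<in> limit_stalk p"
        using axis_span[OF dec xV xy x4 gh(1)] by blast
      obtain a' b' e' where 2: "y * h - (cst a' * y + cst b' * y ^ 2 + cst e' * y ^ 3) \<in> limit_stalk p"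
        using axis_span[OF dec' yV yx y4 gh(2)] by blast
      define c where "c = (\<lambda>i::nat. [c0, a, b, e + e', a', b'] ! i)"
      \<comment> \<open>The element \<open>y ^ 3\<close> is missing from the basis: its coefficient
        \<open>k3'\<close> is transferred to \<open>x ^ 3\<close> through
        \<open>x ^ 3 - y ^ 3\<close>.\<close>
      have comb: "f - (k0 + k1 * x + k2 * x ^ 2 + (k3 + k3') * x ^ 3 + k4 * y + k5 * y ^ 2)
        = (f - (k0 + x * g + y * h)) + ((x * g - (k1 * x + k2 * x ^ 2 + k3 * x ^ 3))
          + ((y * h - (k4 * y + k5 * y ^ 2 + k3' * y ^ 3)) - k3' * (x ^ 3 - y ^ 3)))"
        for k0 k1 k2 k3 k3' k4 k5 by algebra
      have "f - (\<Sum>i<6. scale (c i) (B i)) = f - (cst c0 + cst a * x + cst b * x ^ 2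
          + (cst e + cst e') * x ^ 3 + cst a' * y + cst b' * y ^ 2)"
        unfolding B by (simp add: c_def cst_simps)
      also have "\<dots> \<in> limit_stalk p"
        unfolding comb by (rule limit_stalk_add[OF 0 limit_stalk_add[OF 1 limit_stalk_diff[OF 2
          limit_stalk_mult[OF cst_local_ring xy3]]]])
      finally show ?thesis by blast
    qed
    show "c i = 0" if S: "(\<Sum>i<6. scale (c i) (B i)) \<in> limit_stalk p" and i: "i < 6" for c i
    proof -
      define a where "a = const3 (c 0) * varZ ^ 3 + const3 (c 1) * T1P * varZ ^ 2
        + const3 (c 2) * T1P ^ 2 * varZ + const3 (c 3) * T1P ^ 3 + const3 (c 4) * T2P * varZ ^ 2
        + const3 (c 5) * T2P ^ 2 * varZ"
      have "germ 3 a = cst (c 0) + cst (c 1) * x + cst (c 2) * x ^ 2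
        + cst (c 3) * x ^ 3 + cst (c 4) * y + cst (c 5) * y ^ 2"
        using germ_pad[of 0 3 1] germ_pad[of 1 2 T1P] germ_pad[of 2 1 "T1P ^ 2"] germ_pad[of 1 2 T2P]
          germ_pad[of 2 1 "T2P ^ 2"] germ_power[of 2 1 T1P] germ_power[of 3 1 T1P] germ_power[of 2 1 T2P]
        by (simp add: a_def germ_add germ_const3_mult mult.assoc x_def y_def germ_one
            flip: numeral_3_eq_3)
      then have "Fraction_Field.Fract (lift a) (varZ ^ 3) \<in> limit_stalk p"
        using S unfolding B germ_def by simp
      from limit_stalk_fiber[OF this local_denom_varZ[OF v3']] obtain g where
        g: "eval3 g (rep_proj2 p) \<noteq> 0" "g * a \<in> limit_poly_ideal" by blast
      from g(2) obtain u w where "36 * (g * a) = T1P * T2P * u + (T1P ^ 3 - T2P ^ 3) * w"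
        by (rule limit_poly_ideal_tangents)
      then have "(36 * g) * a = T1P * T2P * u + (T1P ^ 3 - T2P ^ 3) * w"
        by (simp only: mult.assoc)
      from node_independent[OF v3 T _ this[unfolded a_def]] g(1)
      have "c 0 = 0 \<and> c 1 = 0 \<and> c 2 = 0 \<and> c 3 = 0 \<and> c 4 = 0 \<and> c 5 = 0"
        by (simp add: v)
      moreover have "i = 0 \<or> i = 1 \<or> i = 2 \<or> i = 3 \<or> i = 4 \<or> i = 5" using i by auto
      ultimately show ?thesis by auto
    qed
  qed (rule limit_stalk_diff)
qed

section \<open>Smoothness of the nearby fibers\<close>

text \<open>A singular point of the fiber over \<open>s\<close> has \<open>X \<noteq> 0\<close>, and on \<open>X = 1\<close> it is a critical point
  of \<open>G\<close> with critical value \<open>s\<close>; there are only finitely many critical points.\<close>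

definition critical_points :: "(complex \<times> complex) set" where
  "critical_points = {(y, z). z ^ 2 + 4 * (1 - y) * z + (2 - 2 * y - 2 * y ^ 2 + y ^ 3) = 0 \<and>
    (1 - 2 * y + 2 * y ^ 3) + z * (y ^ 2 - 4 * y + 2) = 0}"

text \<open>The second equation is linear in \<open>z\<close>. Eliminating \<open>z\<close> leaves
  the polynomial \<open>r\<close> in \<open>y\<close>, nonzero since \<open>r(0) = 1\<close>; for
  fixed \<open>y\<close> the first equation is a monic quadratic in \<open>z\<close>.\<close>

lemma finite_critical_points: "finite critical_points"
proof -
  define r :: "complex poly" where "r = [:1, -2, 0, 2:] ^ 2 - [:4, -4:] * [:1, -2, 0, 2:] * [:2, -4, 1:]
    + [:2, -4, 1:] ^ 2 * [:2, -2, -2, 1:]"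
  have "poly r 0 = 1" by (simp add: r_def)
  then have "r \<noteq> 0" by auto
  then have fin: "finite {y. poly r y = 0}" by (rule poly_roots_finite)
  have "finite {z. poly [:2 - 2 * y - 2 * y ^ 2 + y ^ 3, 4 * (1 - y), 1:] z = 0}" for y :: complex
    by (rule poly_roots_finite) simp
  with fin have "finite (SIGMA y:{y. poly r y = 0}.
      {z. poly [:2 - 2 * y - 2 * y ^ 2 + y ^ 3, 4 * (1 - y), 1:] z = 0})"
    by (intro finite_SigmaI)
  moreover have "critical_points \<subseteq> (SIGMA y:{y. poly r y = 0}.
      {z. poly [:2 - 2 * y - 2 * y ^ 2 + y ^ 3, 4 * (1 - y), 1:] z = 0})"
  proof
    fix q assume q: "q \<in> critical_points"
    define y z where "y = fst q" and "z = snd q"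
    have 1: "z ^ 2 + 4 * (1 - y) * z + (2 - 2 * y - 2 * y ^ 2 + y ^ 3) = 0"
      and 2: "1 - 2 * y + 2 * y ^ 3 + z * (y ^ 2 - 4 * y + 2) = 0"
      using q by (simp_all add: critical_points_def case_prod_unfold y_def z_def)
    have "poly r y = (1 - 2 * y + 2 * y ^ 3) ^ 2 - 4 * (1 - y) * (1 - 2 * y + 2 * y ^ 3) * (y ^ 2 - 4 * y + 2)
      + (y ^ 2 - 4 * y + 2) ^ 2 * (2 - 2 * y - 2 * y ^ 2 + y ^ 3)"
      by (simp add: r_def algebra_simps power2_eq_square power3_eq_cube)
    also have "\<dots> = 0" using 1 2 by algebra
    finally have "poly r y = 0" .
    moreover have "poly [:2 - 2 * y - 2 * y ^ 2 + y ^ 3, 4 * (1 - y), 1:] z = 0"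
    proof -
      have "poly [:2 - 2 * y - 2 * y ^ 2 + y ^ 3, 4 * (1 - y), 1:] z
        = z ^ 2 + 4 * (1 - y) * z + (2 - 2 * y - 2 * y ^ 2 + y ^ 3)"
        by (simp only: poly_pCons poly_0) algebra
      also note 1
      finally show ?thesis .
    qed
    moreover have "q = (y, z)" by (simp add: y_def z_def)
    ultimately show "q \<in> (SIGMA y:{y. poly r y = 0}.
        {z. poly [:2 - 2 * y - 2 * y ^ 2 + y ^ 3, 4 * (1 - y), 1:] z = 0})" by blast
  qed
  ultimately show ?thesis by (rule finite_subset[rotated])
qed

lemma line_scale: "line (k * x) (k * y) (k * z) = k * line x y z"
  for k :: "'a::idom"
  unfolding line_def by algebra

lemma cubic_scale: "cubic (k * x) (k * y) (k * z) = k ^ 3 * cubic x y z"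
  for k :: "'a::idom"
  unfolding cubic_def by algebra

lemma hess_cubic_scale: "hess_cubic (k * x) (k * y) (k * z) = k ^ 3 * hess_cubic x y z"
  for k :: "'a::idom"
  unfolding hess_cubic_def by algebra

lemma fiber_G_family: "fiber G_family s = G - const3 s * varX ^ 4"
  by (simp add: G_family_eq G_eq)

lemma singular_fiber:
  assumes "singular_at (fiber G_family s) p"
  shows "s \<in> (\<lambda>(y, z). line 1 y z * cubic 1 y z) ` critical_points"
proof -
  define v where "v = rep_proj2 p"
  have sing: "eval3 (G - const3 s * varX ^ 4) v = 0" "eval3 (partial_X (G - const3 s * varX ^ 4)) v = 0"
    "eval3 (partial_Y (G - const3 s * varX ^ 4)) v = 0" "eval3 (partial_Z (G - const3 s * varX ^ 4)) v = 0"
    using assms unfolding singular_at_def vanishes_at_def fiber_G_family grad_eq forall_3 v_def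
    by simp_all
  define a b c where "a = v $ 1" and "b = v $ 2" and "c = v $ 3"
  have X: "4 * a ^ 3 - 9 * a ^ 2 * b + 18 * a ^ 2 * c - 6 * a * b ^ 2 - 12 * a * b * c + 12 * a * c ^ 2
      + 4 * b ^ 3 - 6 * b ^ 2 * c - 6 * b * c ^ 2 + c ^ 3 - 4 * s * a ^ 3 = 0"
    and Y: "- 3 * a ^ 3 - 6 * a ^ 2 * b - 6 * a ^ 2 * c + 12 * a * b ^ 2 - 12 * a * b * c - 6 * a * c ^ 2
      + 12 * b ^ 3 + 9 * b ^ 2 * c = 0"
    and Z: "6 * a ^ 3 - 6 * a ^ 2 * b + 12 * a ^ 2 * c - 6 * a * b ^ 2 - 12 * a * b * c + 3 * a * c ^ 2
      + 3 * b ^ 3 = 0"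
    using sing(2-4) by (simp_all add: partial_simps partial_G a_def b_def c_def mult_ac)
  have G: "line a b c * cubic a b c = s * a ^ 4"
    using sing(1) by (simp add: G_eq a_def b_def c_def)
  have "a \<noteq> 0"
  proof
    assume "a = 0"
    then have "b = 0" using Z by simp
    then have "c = 0" using X \<open>a = 0\<close> by simp
    then show False
      using rep_proj2_neq_0[of p] \<open>a = 0\<close> \<open>b = 0\<close>
      by (simp add: vec_eq_iff forall_3 a_def b_def c_def v_def)
  qed
  define y z where "y = b / a" and "z = c / a"
  have bc: "b = y * a" "c = z * a"
    using \<open>a \<noteq> 0\<close> by (simp_all add: y_def z_def)
  \<comment> \<open>This is the \<open>Z\<close>-derivative of \<open>G\<close> divided by
    3.\<close>
  have "(z ^ 2 + 4 * (1 - y) * z + (2 - 2 * y - 2 * y ^ 2 + y ^ 3)) * (3 * a ^ 3) = 0"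
    using Z unfolding bc by algebra
  then have 1: "z ^ 2 + 4 * (1 - y) * z + (2 - 2 * y - 2 * y ^ 2 + y ^ 3) = 0"
    using \<open>a \<noteq> 0\<close> by simp
  \<comment> \<open>Adding twice the \<open>Z\<close>-derivative to the \<open>Y\<close>-derivative
    removes \<open>z^2\<close>, so that the equation becomes linear in \<open>z\<close>.\<close>
  have "((1 - 2 * y + 2 * y ^ 3) + z * (y ^ 2 - 4 * y + 2)) * (9 * a ^ 3) = 0"
    using Y Z unfolding bc by algebra
  then have 2: "(1 - 2 * y + 2 * y ^ 3) + z * (y ^ 2 - 4 * y + 2) = 0"
    using \<open>a \<noteq> 0\<close> by simp
  have "(line 1 y z * cubic 1 y z) * a ^ 4 = s * a ^ 4"
    using G line_scale[of a 1 y z] cubic_scale[of a 1 y z] unfolding bc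
    by (simp add: power_numeral_reduce mult_ac)
  then have "s = line 1 y z * cubic 1 y z" using \<open>a \<noteq> 0\<close> by simp
  then show ?thesis using 1 2 by (auto simp: critical_points_def)
qed

lemma eventually_smooth: "\<forall>\<^sub>F s in at 0. \<forall>p. \<not> singular_at (fiber G_family s) p"
proof -
  let ?S = "(\<lambda>(y, z). line 1 y z * cubic 1 y z) ` critical_points"
  have "\<not> 0 islimpt ?S"
    by (rule islimpt_finite[OF finite_imageI[OF finite_critical_points]])
  then have "\<forall>\<^sub>F s in at 0. s \<notin> ?S" by (simp add: islimpt_iff_eventually)
  then show ?thesis
    by (rule eventually_mono) (use singular_fiber in blast)
qed

section \<open>The chart at infinity\<close>

lemma F_family_eq: "F_family = lift (varX ^ 4) + svar * lift G"
  by (simp add: F_family_def G_eq)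

lemma G_family_lift: "G_family = lift G - svar * lift (varX ^ 4)"
  by (simp add: G_family_eq G_eq)

lemma coeff3_lift: "coeff3 (lift f) i j k = [:coeff3 f i j k:]"
  by (simp add: lift_def coeff3_map_coeffs)

lemma coeff3_F_family: "coeff3 F_family i j k = [:coeff3 (varX ^ 4) i j k, coeff3 G i j k:]"
  unfolding F_family_eq coeff_add coeff3_const3_mult coeff3_lift by simp

lemma coeff3_G_family: "coeff3 G_family i j k = [:coeff3 G i j k, - coeff3 (varX ^ 4) i j k:]"
  unfolding G_family_lift coeff_diff coeff3_const3_mult coeff3_lift by simp

lemma coeff3_G_neq_0: "coeff3 (G :: complex poly3) 4 0 0 \<noteq> 0"
proof
  assume *: "coeff3 (G :: complex poly3) 4 0 0 = 0"
  have "coeff (poly (poly G 0) 0) 4 = coeff3 (G :: complex poly3) 4 0 0"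
    by (simp add: poly_0_coeff_0)
  moreover have "poly (poly G 0) 0 = (monom 1 4 :: complex poly)"
    by (simp add: G_def Let_def varX_def varY_def varZ_def monom_altdef)
  ultimately show False using * by simp
qed

lemma param_degree_F_family: "param_degree F_family = 1"
  unfolding param_degree_def
proof (rule Least_equality)
  show "\<forall>i j k. degree (coeff3 F_family i j k) \<le> 1"
    by (simp add: coeff3_F_family)
  show "1 \<le> d" if "\<forall>i j k. degree (coeff3 F_family i j k) \<le> d" for d
    using that[rule_format, of 0 0 4] coeff3_G_neq_0 by (simp add: coeff3_F_family)
qed

text \<open>In degree 1 the chart is \<open>(-s) (X^4 - G / s) = G - s X^4\<close>.\<close>

lemma chart_at_infinity_F_family: "chart_at_infinity F_family = G_family"
proof (rule poly3_eqI)
  fix i j k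
  show "coeff3 (chart_at_infinity F_family) i j k = coeff3 G_family i j k"
    unfolding chart_at_infinity_def param_degree_F_family Let_def
    by (subst coeff3_map_coeffs) (simp_all add: coeff3_F_family coeff3_G_family)
qed

section \<open>The flexes of the cubic\<close>

text \<open>The two equations say \<open>t1 t2 f = 0\<close> and \<open>t1^3 = t2^3\<close>. If one
  tangent vanishes, so does the other; otherwise the point lies on the flex line.\<close>

lemma cubic_flex_cases:
  fixes x y z :: complex
  assumes "cubic x y z = 0" "hess_cubic x y z = 0"
  shows "tangent1 x y z = 0 \<and> tangent2 x y z = 0
    \<or> tangent1 x y z \<noteq> 0 \<and> tangent2 x y z \<noteq> 0 \<and> flex_line x y z = 0 \<and>
      tangent1 x y z ^ 3 = tangent2 x y z ^ 3"
proof -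
  define t1 t2 f where "t1 = tangent1 x y z" and "t2 = tangent2 x y z" and "f = flex_line x y z"
  have "- 9 * (t1 * t2 * f) - (t1 ^ 3 - t2 ^ 3) = 0" "- 18 * (t1 * t2 * f) + 6 * (t1 ^ 3 - t2 ^ 3) = 0"
    using assms cubic_eq_tangents[of x y z] hess_cubic_eq_tangents[of x y z]
    by (simp_all add: t1_def t2_def f_def)
  then have "t1 * t2 * f = 0" "t1 ^ 3 = t2 ^ 3" by algebra+
  then show ?thesis by (auto simp flip: t1_def t2_def f_def)
qed

lemma tangents_zero_iff:
  fixes x y z :: complex
  shows "tangent1 x y z = 0 \<and> tangent2 x y z = 0 \<longleftrightarrow> x = z \<and> y = z"
proof
  assume "tangent1 x y z = 0 \<and> tangent2 x y z = 0"
  then have "3 * (x - z) = 0" "3 * (y - z) = 0"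
    unfolding tangent1_def tangent2_def by algebra+
  then show "x = z \<and> y = z" by simp
qed (simp add: tangent1_def tangent2_def)

lemma cubic_on_line: "cubic (- y - z) y z = - 3 * (y ^ 3 - 3 * y * z ^ 2 - z ^ 3)"
  for y z :: "'a::idom"
  unfolding cubic_def by algebra

lemma hess_cubic_on_line:
  "hess_cubic (- y - z) y z = - 162 * (z ^ 3 + 11 * y * z ^ 2 + 36 * y ^ 2 * z + 35 * y ^ 3)"
  for y z :: "'a::idom"
  unfolding hess_cubic_def by algebra

lemma cubic_flex_affine:
  fixes x y z :: complex
  assumes "cubic x y z = 0" "hess_cubic x y z = 0" "x \<noteq> 0 \<or> y \<noteq> 0 \<or> z \<noteq> 0"
  shows "z \<noteq> 0"
proof
  assume z: "z = 0"
  from cubic_flex_cases[OF assms(1,2)] show False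
  proof
    assume "tangent1 x y z = 0 \<and> tangent2 x y z = 0"
    then show False using z assms(3) by (auto simp: tangents_zero_iff)
  next
    assume *: "tangent1 x y z \<noteq> 0 \<and> tangent2 x y z \<noteq> 0 \<and> flex_line x y z = 0 \<and>
      tangent1 x y z ^ 3 = tangent2 x y z ^ 3"
    then have y: "y = 2 * x" by (simp add: flex_line_def)
    have "tangent1 x y z ^ 3 = tangent2 x y z ^ 3" using * by blast
    then have "(- 6 * x) ^ 3 = (- 3 * x) ^ 3" by (simp add: tangent1_def tangent2_def y z)
    then have "x ^ 3 = 0" by algebra
    then show False using * y z by (simp add: tangent1_def)
  qed
qed

text \<open>Translates between the sheared coordinates of \<open>G_hat\<close> and those of
  \<open>cubic\<close>, and shows that the node is the only singular point to be excluded.\<close>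

lemma smooth_flex_G_hat_iff:
  fixes w :: "complex ^ 3"
  assumes w_def: "w = rep_proj2 q"
    and x_def: "x = w $ 1 - w $ 2 - w $ 3" and y_def: "y = w $ 2" and z_def: "z = w $ 3"
  shows "smooth_flex G_hat q \<longleftrightarrow>
    cubic x y z = 0 \<and> hess_cubic x y z = 0 \<and> \<not> (tangent1 x y z = 0 \<and> tangent2 x y z = 0)"
proof -
  have w1: "w $ 1 = x + y + z" by (simp add: x_def y_def z_def)
  have C: "vanishes_at G_hat q \<longleftrightarrow> cubic x y z = 0"
    by (simp add: vanishes_at_def G_hat_eq w_def x_def y_def z_def)
  have H: "vanishes_at (hessian G_hat) q \<longleftrightarrow> hess_cubic x y z = 0"
    by (simp add: vanishes_at_def hessian_G_hat w_def x_def y_def z_def)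
  define gx gy gz where "gx = eval3 (partial_X G_hat) w" and "gy = eval3 (partial_Y G_hat) w"
    and "gz = eval3 (partial_Z G_hat) w"
  have g: "gx = 3 * (x + y + z) ^ 2 - 14 * (x + y + z) * y + 4 * (x + y + z) * z + 12 * y ^ 2
      - 3 * y * z - 6 * z ^ 2"
    "gy = - 7 * (x + y + z) ^ 2 + 24 * (x + y + z) * y - 3 * (x + y + z) * z - 9 * y ^ 2 + 9 * z ^ 2"
    "gz = 2 * (x + y + z) ^ 2 - 3 * (x + y + z) * y - 12 * (x + y + z) * z + 18 * y * z + 9 * z ^ 2"
    unfolding gx_def gy_def gz_def partial_G_hat
    by (simp_all add: w1 flip: y_def z_def)
  have sing: "singular_at G_hat q \<longleftrightarrow> cubic x y z = 0 \<and> gx = 0 \<and> gy = 0 \<and> gz = 0"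
    unfolding singular_at_def C by (simp add: vanishes_at_def grad_eq forall_3 gx_def gy_def gz_def w_def)
  have "gx = 0 \<and> gy = 0 \<and> gz = 0 \<longleftrightarrow> tangent1 x y z = 0 \<and> tangent2 x y z = 0"
    if "cubic x y z = 0" "hess_cubic x y z = 0"
  proof
    assume "tangent1 x y z = 0 \<and> tangent2 x y z = 0"
    then have xy: "x = z" "y = z" by (simp_all add: tangents_zero_iff)
    have "gx = 0" "gy = 0" "gz = 0"
      unfolding g xy by (simp_all add: power2_eq_square)
    then show "gx = 0 \<and> gy = 0 \<and> gz = 0" by simp
  next
    assume "gx = 0 \<and> gy = 0 \<and> gz = 0"
    \<comment> \<open>Derivative along \<open>(1, 2, 3)\<close> in the coordinates of
      \<open>cubic\<close>, a direction in which \<open>tangent2\<close> and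
      \<open>flex_line\<close> are constant. At a common zero of \<open>cubic\<close> and
      \<open>hess_cubic\<close> away from the node it equals \<open>tangent1^2\<close>, which is
      nonzero there.\<close>
    then have "6 * gx + 2 * gy + 3 * gz = 0" by simp
    then have "tangent1 x y z ^ 2 + 3 * tangent2 x y z * flex_line x y z = 0"
      unfolding g tangent1_def tangent2_def flex_line_def by algebra
    then show "tangent1 x y z = 0 \<and> tangent2 x y z = 0"
      using cubic_flex_cases[OF that] by auto
  qed
  then show ?thesis
    unfolding smooth_flex_def C H sing by blast
qed

lemma smooth_flex_pt_iff:
  fixes a b :: complex
  shows "smooth_flex G_hat (pt (a + b + 1) b 1) \<longleftrightarrow>
    cubic a b 1 = 0 \<and> hess_cubic a b 1 = 0 \<and> \<not> (a = 1 \<and> b = 1)"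
proof -
  obtain k where k: "k \<noteq> 0" and w: "rep_proj2 (pt (a + b + 1) b 1) $ 1 = k * (a + b + 1)"
    "rep_proj2 (pt (a + b + 1) b 1) $ 2 = k * b" "rep_proj2 (pt (a + b + 1) b 1) $ 3 = k * 1"
    by (rule rep_pt[of "a + b + 1" b 1]) simp_all
  have x: "k * (a + b + 1) - k * b - k * 1 = k * a" by algebra
  show ?thesis
    unfolding smooth_flex_G_hat_iff[OF refl refl refl refl] w x cubic_scale hess_cubic_scale tangents_zero_iff
    using k by simp
qed

section \<open>The multiplicities in the limit cycle\<close>

definition limit_multiplicity :: "complex \<Rightarrow> complex \<Rightarrow> nat" where
  "limit_multiplicity a b =
     (if a + b + 1 = 0
      then if b ^ 3 - 3 * b - 1 = 0 then 3
        else if b = - 1 then 2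
        else if 3 * b ^ 4 + 11 * b ^ 3 + 12 * b ^ 2 + 3 * b + 1 = 0 then 1 else 0
      else if cubic a b 1 = 0 \<and> hess_cubic a b 1 = 0
      then if a = 1 \<and> b = 1 then 6 else 1
      else 0)"

lemma multiplicity_at_infinity:
  assumes v3: "rep_proj2 p $ 3 = 0"
  shows "has_quotient_dim (local_ring p) (limit_stalk p) 0"
proof -
  define x y where "x = rep_proj2 p $ 1" and "y = rep_proj2 p $ 2"
  have nz: "x \<noteq> 0 \<or> y \<noteq> 0"
    using rep_proj2_neq_0[of p] v3 by (auto simp: vec_eq_iff forall_3 x_def y_def)
  show ?thesis
  proof (cases "line x y 0 = 0")
    case True
    then have x: "x = - y" by (simp add: line_def eq_neg_iff_add_eq_0)
    \<comment> \<open>Only the leading terms \<open>y^3\<close> and \<open>3 y^4\<close> of the two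
      factors survive at \<open>z = 0\<close>, and 1458 * 3 = 4374.\<close>
    have "residual x y 0 = - 4374 * y ^ 7"
      unfolding residual_mod_line line_def x by (simp add: eval_nat_numeral)
    then show ?thesis
      using nz x by (intro multiplicity_line_nonresidual) (simp_all add: v3 flip: x_def y_def)
  next
    case L: False
    show ?thesis
    proof (cases "cubic x y 0 = 0")
      case True
      then have "hess_cubic x y 0 \<noteq> 0" using cubic_flex_affine[of x y 0] nz by auto
      then show ?thesis
        using L True by (intro multiplicity_cubic_nonflex) (simp_all add: v3 flip: x_def y_def)
    next
      case False
      then show ?thesis
        using L by (intro multiplicity_off_curve) (simp_all add: v3 flip: x_def y_def)
    qed
  qed
qed

lemma multiplicity_affine:
  fixes v :: "complex ^ 3"
  assumes v: "v = rep_proj2 p" and v3: "v $ 3 \<noteq> 0" and v12: "v $ 1 = a * v $ 3" "v $ 2 = b * v $ 3"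
  shows "has_quotient_dim (local_ring p) (limit_stalk p) (limit_multiplicity a b)"
proof -
  define k where "k = v $ 3"
  have k: "k \<noteq> 0" "v $ 1 = k * a" "v $ 2 = k * b" "v $ 3 = k * 1"
    using v3 v12 by (simp_all add: k_def)
  have val: "eval3 LP v = k * line a b 1" "eval3 CP v = k ^ 3 * cubic a b 1"
    "eval3 HP v = k ^ 3 * hess_cubic a b 1"
    unfolding eval3_forms eval3_simps k(2-4) by (rule line_scale cubic_scale hess_cubic_scale)+
  show ?thesis
  proof (cases "a + b + 1 = 0")
    case True
    then have a: "a = - b - 1" by algebra
    note v12' = v12[unfolded a]
    have L: "eval3 LP v = 0"
      unfolding val using True by (simp add: line_def)
    have C: "cubic a b 1 = - 3 * (b ^ 3 - 3 * b - 1)"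
      using cubic_on_line[of b 1] by (simp add: a)
    consider "b ^ 3 - 3 * b - 1 = 0" | "b ^ 3 - 3 * b - 1 \<noteq> 0" "b = - 1"
      | "b ^ 3 - 3 * b - 1 \<noteq> 0" "b \<noteq> - 1" "3 * b ^ 4 + 11 * b ^ 3 + 12 * b ^ 2 + 3 * b + 1 = 0"
      | "b ^ 3 - 3 * b - 1 \<noteq> 0" "b \<noteq> - 1" "3 * b ^ 4 + 11 * b ^ 3 + 12 * b ^ 2 + 3 * b + 1 \<noteq> 0"
      by blast
    then show ?thesis
    proof cases
      case 1
      then show ?thesis
        using multiplicity_line_cubic[OF v v3 v12' 1] True by (simp add: limit_multiplicity_def)
    next
      case 2
      then have "v $ 1 = 0" "v $ 2 = - v $ 3" using v12' by simp_all
      from multiplicity_line_tangency[OF v v3 this] show ?thesis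
        using 2 True by (simp add: limit_multiplicity_def)
    next
      case 3
      then show ?thesis
        using multiplicity_line_residual[OF v v3 v12' 3(3)] True by (simp add: limit_multiplicity_def)
    next
      case 4
      define \<kappa> \<theta> where \<kappa>: "\<kappa> = b ^ 3 - 3 * b - 1"
        and \<theta>: "\<theta> = 3 * b ^ 4 + 11 * b ^ 3 + 12 * b ^ 2 + 3 * b + 1"
      have "eval3 NP v = - 1458 * \<kappa> * \<theta> * k ^ 7"
        using L unfolding eval3_forms eval3_simps residual_mod_line k \<kappa> \<theta> by algebra
      moreover have "\<kappa> \<noteq> 0" "\<theta> \<noteq> 0" using 4 by (simp_all only: \<kappa> \<theta> not_False_eq_True)
      ultimately have "eval3 NP v \<noteq> 0" using k by simp
      moreover have "v $ 1 \<noteq> 0"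
      proof
        assume "v $ 1 = 0"
        then have "a = 0" using v12 v3 by simp
        then have "b = - 1" using a by algebra
        then show False using 4 by simp
      qed
      ultimately show ?thesis
        using multiplicity_line_nonresidual[of p] 4 True by (simp add: limit_multiplicity_def v)
    qed
  next
    case False
    then have L: "eval3 LP v \<noteq> 0" unfolding val using k by (simp add: line_def)
    consider "cubic a b 1 \<noteq> 0" | "cubic a b 1 = 0" "hess_cubic a b 1 \<noteq> 0"
      | "cubic a b 1 = 0" "hess_cubic a b 1 = 0" "a = 1 \<and> b = 1"
      | "cubic a b 1 = 0" "hess_cubic a b 1 = 0" "\<not> (a = 1 \<and> b = 1)" by blast
    then show ?thesis
    proof cases
      case 1
      then have "eval3 CP v \<noteq> 0" unfolding val using k by simp
      then show ?thesis
        using multiplicity_off_curve[of p] L 1 False by (simp only: limit_multiplicity_def v if_False simp_thms)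
    next
      case 2
      then have "eval3 CP v = 0" "eval3 HP v \<noteq> 0" unfolding val using k by simp_all
      then show ?thesis
        using multiplicity_cubic_nonflex[of p] L 2 False by (simp only: limit_multiplicity_def v if_False simp_thms)
    next
      case 3
      then show ?thesis
        using multiplicity_node[OF v v3] v12 False by (simp add: limit_multiplicity_def)
    next
      case 4
      then have "eval3 CP v = 0" "eval3 HP v = 0" unfolding val by simp_all
      moreover have "\<not> (eval3 T1P v = 0 \<and> eval3 T2P v = 0)"
        using 4(3) v12 v3 by (simp add: tangents_zero_iff)
      ultimately have "has_quotient_dim (local_ring p) (limit_stalk p) 1"
        by (rule multiplicity_cubic_flex[OF v L])
      moreover have "limit_multiplicity a b = 1"
        unfolding limit_multiplicity_def using False 4 by simp
      ultimately show ?thesis by simp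
    qed
  qed
qed

text \<open>The nested cases become a sum of indicators because they are mutually exclusive: node
  and flexes lie off the line, and on the line the cubic, the quartic and \<open>b = -1\<close> have
  no common zeros.\<close>

lemma limit_multiplicity_eq:
  "int (limit_multiplicity a b) = 6 * of_bool (a = 1 \<and> b = 1)
    + 3 * of_bool (a = - b - 1 \<and> b ^ 3 - 3 * b - 1 = 0) + 2 * of_bool (a = 0 \<and> b = - 1)
    + of_bool (smooth_flex G_hat (pt (a + b + 1) b 1))
    + of_bool (a = - b - 1 \<and> 3 * b ^ 4 + 11 * b ^ 3 + 12 * b ^ 2 + 3 * b + 1 = 0)"
proof -
  have line: "a + b + 1 = 0 \<longleftrightarrow> a = - b - 1"
    by (rule iffI; algebra)
  show ?thesis
  proof (cases "a + b + 1 = 0")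
    case True
    then have a: "a = - b - 1" using line by blast
    have C: "cubic a b 1 = - 3 * (b ^ 3 - 3 * b - 1)"
      using cubic_on_line[of b 1] by (simp add: a)
    have H: "hess_cubic a b 1 = - 162 * (1 + 11 * b + 36 * b ^ 2 + 35 * b ^ 3)"
      using hess_cubic_on_line[of b 1] by (simp add: a)
    \<comment> \<open>On the line \<open>cubic\<close> and \<open>hess_cubic\<close> restrict to
      coprime polynomials in \<open>b\<close>.\<close>
    have nflex: "\<not> smooth_flex G_hat (pt (a + b + 1) b 1)"
    proof
      assume "smooth_flex G_hat (pt (a + b + 1) b 1)"
      then have "- 3 * (b ^ 3 - 3 * b - 1) = 0" "- 162 * (1 + 11 * b + 36 * b ^ 2 + 35 * b ^ 3) = 0"
        using C H by (simp_all only: smooth_flex_pt_iff simp_thms)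
      then show False by algebra
    qed
    have nnode: "\<not> (a = 1 \<and> b = 1)" using a by auto
    have tang: "a = 0 \<longleftrightarrow> b = - 1" unfolding a by (rule iffI; algebra)
    have excl: "\<not> (b ^ 3 - 3 * b - 1 = 0 \<and> 3 * b ^ 4 + 11 * b ^ 3 + 12 * b ^ 2 + 3 * b + 1 = 0)"
      by (rule notI) algebra
    have excl2: "b = - 1 \<Longrightarrow> b ^ 3 - 3 * b - 1 \<noteq> 0 \<and> 3 * b ^ 4 + 11 * b ^ 3 + 12 * b ^ 2 + 3 * b + 1 \<noteq> 0"
      by (simp add: power3_eq_cube power4_eq_xxxx power2_eq_square)
    show ?thesis
      unfolding limit_multiplicity_def tang using True nflex nnode excl excl2 a by auto
  next
    case False
    then have "a \<noteq> - b - 1" using line by blast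
    moreover have "\<not> (a = 0 \<and> b = - 1)" using False by auto
    moreover have "cubic 1 1 (1::complex) = 0" "hess_cubic 1 1 (1::complex) = 0"
      by (simp_all add: cubic_def hess_cubic_def)
    ultimately show ?thesis
      unfolding limit_multiplicity_def smooth_flex_pt_iff using False by auto
  qed
qed

section \<open>Assembling the cycle\<close>

lemma homogeneous_G_family: "homogeneous 4 G_family"
  unfolding G_family_eq
  by ((rule homogeneous_intros homogeneous_forms(1,2) refl | simp)+)

lemma eq_pt_affine_iff:
  "p = pt a b 1 \<longleftrightarrow> rep_proj2 p $ 3 \<noteq> 0 \<and> rep_proj2 p $ 1 = a * rep_proj2 p $ 3 \<and>
    rep_proj2 p $ 2 = b * rep_proj2 p $ 3"
proof -
  define v where "v = rep_proj2 p"
  have "v $ 1 \<noteq> 0 \<or> v $ 2 \<noteq> 0 \<or> v $ 3 \<noteq> 0"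
    using rep_proj2_neq_0[of p] by (auto simp: vec_eq_iff forall_3 v_def)
  then have "pt a b 1 = pt (v $ 1) (v $ 2) (v $ 3) \<longleftrightarrow>
      (\<exists>k. k \<noteq> 0 \<and> v $ 1 = k * a \<and> v $ 2 = k * b \<and> v $ 3 = k * 1)"
    by (intro pt_eq_iff) auto
  also have "pt (v $ 1) (v $ 2) (v $ 3) = p" by (simp add: v_def pt_rep_proj2)
  finally show ?thesis by (auto simp: v_def mult.commute)
qed

lemma pt_affine_eq_iff: "pt a b 1 = pt a' b' 1 \<longleftrightarrow> a = a' \<and> b = b'"
  by (subst pt_eq_iff) auto

theorem theorem2p1:
  fixes \<gamma> :: "nat \<Rightarrow> complex" and \<alpha> \<beta> \<xi> \<mu> :: complex and W :: "proj2 \<Rightarrow>\<^sub>0 int"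
  assumes gamma: "bij_betw \<gamma> {1..3} {y. y^3 - 3*y - 1 = 0}"
    and flexes: "{p. smooth_flex G_hat p} - {pt 1 0 1} = {pt \<alpha> \<beta> 1, pt (cnj \<alpha>) (cnj \<beta>) 1}"
      "pt \<alpha> \<beta> 1 \<noteq> pt (cnj \<alpha>) (cnj \<beta>) 1"
    and xi_mu: "{y. 3*y^4 + 11*y^3 + 12*y^2 + 3*y + 1 = 0} = {\<xi>, cnj \<xi>, \<mu>, cnj \<mu>}"
      "distinct [\<xi>, cnj \<xi>, \<mu>, cnj \<mu>]"
    and W: "W =
      frag_cmul 6 (frag_of (pt 1 1 1))
      + (\<Sum>j\<in>{1..3}. frag_cmul 3 (frag_of (pt (- \<gamma> j - 1) (\<gamma> j) 1)))
      + frag_cmul 2 (frag_of (pt 0 (-1) 1)) + frag_of (pt 0 0 1)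
      + frag_of (pt (\<alpha> - \<beta> - 1) \<beta> 1)
      + frag_of (pt (cnj \<alpha> - cnj \<beta> - 1) (cnj \<beta>) 1)
      + frag_of (pt (- \<xi> - 1) \<xi> 1) + frag_of (pt (- cnj \<xi> - 1) (cnj \<xi>) 1)
      + frag_of (pt (- \<mu> - 1) \<mu> 1) + frag_of (pt (- cnj \<mu> - 1) (cnj \<mu>) 1)"
  shows "limit_weierstrass_cycle G_family W \<and> limit_weierstrass_cycle_at_infinity F_family W"
proof -
  have sum_gamma: "(\<Sum>j\<in>{1..3}. of_bool (P \<and> b = \<gamma> j)) = (of_bool (P \<and> b ^ 3 - 3 * b - 1 = 0) :: int)"
    for P and b :: complex
  proof -
    have fin: "finite {y :: complex. y^3 - 3*y - 1 = 0}"
      using bij_betw_finite[OF gamma] by simp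
    have "(\<Sum>j\<in>{1..3}. of_bool (P \<and> b = \<gamma> j)) = (\<Sum>y\<in>{y. y^3 - 3*y - 1 = 0}. of_bool (P \<and> b = y) :: int)"
      by (rule sum.reindex_bij_betw[OF gamma])
    also have "\<dots> = (\<Sum>y\<in>{y. y^3 - 3*y - 1 = 0}. if b = y then of_bool P else 0)"
      by (intro sum.cong) auto
    also have "\<dots> = of_bool (P \<and> b ^ 3 - 3 * b - 1 = 0)"
      using fin by (simp add: sum.delta')
    finally show ?thesis .
  qed
  \<comment> \<open>The point \<open>(0 : 0 : 1)\<close> is the flex \<open>(1 : 0 : 1)\<close> of
    \<open>G_hat\<close> in unsheared coordinates. The set difference in the hypothesis separates it
    from the other two flexes, so exactly one indicator fires at each flex.\<close>
  have sum_flex: "of_bool (a = 0 \<and> b = 0) + of_bool (a = \<alpha> - \<beta> - 1 \<and> b = \<beta>)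
      + of_bool (a = cnj \<alpha> - cnj \<beta> - 1 \<and> b = cnj \<beta>)
      = (of_bool (smooth_flex G_hat (pt (a + b + 1) b 1)) :: int)" for a b
  proof -
    have "smooth_flex G_hat (pt (0 + 0 + 1) 0 1)"
      unfolding smooth_flex_pt_iff by (simp add: cubic_def hess_cubic_def)
    then have "{p. smooth_flex G_hat p} = {pt 1 0 1, pt \<alpha> \<beta> 1, pt (cnj \<alpha>) (cnj \<beta>) 1}"
      and "pt 1 0 1 \<noteq> pt \<alpha> \<beta> 1" "pt 1 0 1 \<noteq> pt (cnj \<alpha>) (cnj \<beta>) 1"
      using flexes(1) by auto
    note flex = this
    have shift: "pt (a + b + 1) b 1 = pt c d 1 \<longleftrightarrow> a = c - d - 1 \<and> b = d" for c d
      unfolding pt_affine_eq_iff by (auto simp: algebra_simps)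
    define q where "q = pt (a + b + 1) b 1"
    have "smooth_flex G_hat q \<longleftrightarrow> q = pt 1 0 1 \<or> q = pt \<alpha> \<beta> 1 \<or> q = pt (cnj \<alpha>) (cnj \<beta>) 1"
      using flex(1) by blast
    then have "of_bool (q = pt 1 0 1) + of_bool (q = pt \<alpha> \<beta> 1) + of_bool (q = pt (cnj \<alpha>) (cnj \<beta>) 1)
      = (of_bool (smooth_flex G_hat q) :: int)"
      using flex(2,3) flexes(2) by (simp add: of_bool_def)
    then show ?thesis unfolding q_def shift by simp
  qed
  have sum_xi: "of_bool (P \<and> b = \<xi>) + of_bool (P \<and> b = cnj \<xi>) + of_bool (P \<and> b = \<mu>)
      + of_bool (P \<and> b = cnj \<mu>) = (of_bool (P \<and> 3 * b ^ 4 + 11 * b ^ 3 + 12 * b ^ 2 + 3 * b + 1 = 0) :: int)"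
    for P and b :: complex
  proof -
    have "3 * b ^ 4 + 11 * b ^ 3 + 12 * b ^ 2 + 3 * b + 1 = 0 \<longleftrightarrow> b \<in> {\<xi>, cnj \<xi>, \<mu>, cnj \<mu>}"
      unfolding xi_mu(1)[symmetric] by simp
    then show ?thesis using xi_mu(2) by auto
  qed
  have "\<exists>n. has_quotient_dim (local_ring p) (limit_stalk p) n \<and> Poly_Mapping.lookup W p = int n" for p
  proof (cases "rep_proj2 p $ 3 = 0")
    case True
    then have "Poly_Mapping.lookup W p = int 0"
      unfolding W by (simp add: lookup_add lookup_sum eq_pt_affine_iff)
    then show ?thesis using multiplicity_at_infinity[OF True] by blast
  next
    case False
    define a b where "a = rep_proj2 p $ 1 / rep_proj2 p $ 3" and "b = rep_proj2 p $ 2 / rep_proj2 p $ 3"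
    have ab: "rep_proj2 p $ 1 = a * rep_proj2 p $ 3" "rep_proj2 p $ 2 = b * rep_proj2 p $ 3"
      using False by (simp_all add: a_def b_def)
    have eq: "p = pt c d 1 \<longleftrightarrow> a = c \<and> b = d" for c d
      unfolding eq_pt_affine_iff ab using False by simp
    \<comment> \<open>Moving the root out of the first conjunct gives the indicators the shape
      \<open>P \<and> b = c\<close> with a fixed \<open>P\<close>, as in \<open>sum_gamma\<close>
      and \<open>sum_xi\<close>.\<close>
    have line: "a = - c - 1 \<and> b = c \<longleftrightarrow> a = - b - 1 \<and> b = c" for c by auto
    have "Poly_Mapping.lookup W p = 6 * of_bool (a = 1 \<and> b = 1)
        + 3 * (\<Sum>j\<in>{1..3}. of_bool (a = - b - 1 \<and> b = \<gamma> j)) + 2 * of_bool (a = 0 \<and> b = - 1)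
        + (of_bool (a = 0 \<and> b = 0) + of_bool (a = \<alpha> - \<beta> - 1 \<and> b = \<beta>)
          + of_bool (a = cnj \<alpha> - cnj \<beta> - 1 \<and> b = cnj \<beta>))
        + (of_bool (a = - b - 1 \<and> b = \<xi>) + of_bool (a = - b - 1 \<and> b = cnj \<xi>)
          + of_bool (a = - b - 1 \<and> b = \<mu>) + of_bool (a = - b - 1 \<and> b = cnj \<mu>))"
      unfolding W by (simp only: lookup_add lookup_sum lookup_frag_cmul lookup_frag_of eq line
        of_bool_def sum_distrib_left add.assoc)
    also have "\<dots> = int (limit_multiplicity a b)"
      unfolding sum_gamma sum_flex sum_xi limit_multiplicity_eq ..
    finally show ?thesis using multiplicity_affine[OF refl False ab] by blast
  qed
  then have "limit_weierstrass_cycle G_family W"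
    unfolding limit_weierstrass_cycle_def using homogeneous_G_family eventually_smooth by blast
  then show ?thesis
    by (simp add: limit_weierstrass_cycle_at_infinity_def chart_at_infinity_F_family)
qed

end
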